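(* With $\omega_{(1)}=(4,4,3)$, $\omega_{(2)}=(4,4,1,1)$, $\omega_{(3)}=(4,2,2,1)$, $\omega_{(4)}=(4,2,4)$, one has $\dim QP_5^+(\omega_{(1)})=75$, $\dim QP_5^+(\omega_{(2)})=145$, $\dim QP_5^+(\omega_{(3)})=390$, $\dim QP_5^+(\omega_{(4)})=1$.
   Context: $P_k=\mathbb F_2[x_1,\dots,x_k]$, $\deg x_j=1$, a module over the mod-2 Steenrod algebra $\mathcal A$ with augmentation ideal $\mathcal A^+$. $P_k^+$ is the span of monomials $x_1^{a_1}\cdots x_k^{a_k}$ with all $a_j>0$. For a monomial $x$ with exponents $\nu_j(x)$, its weight vector is $\omega(x)=(\omega_1(x),\omega_2(x),\dots)$, $\omega_i(x)=\sum_{j}\alpha_{i-1}(\nu_j(x))$, $\alpha_t(a)$ the $t$-th binary digit of $a$. For a weight vector $\omega$, $\deg\omega=\sum_i2^{i-1}\omega_i$, weight vectors ordered left-lexicographically; $P_k(\omega)$ is spanned by monomials $y$ of degree $\deg\omega$ with $\omega(y)\le\omega$, $P_k^-(\omega)$ by those with $\omega(y)<\omega$; $QP_k^+(\omega)=(P_k^+\cap P_k(\omega))/\big((\mathcal A^+P_k\cap P_k^+\cap P_k(\omega))+(P_k^+\cap P_k^-(\omega))\big)$. *)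

theory Defs
  imports Main
begin

text \<open>Conventions.
  A monomial x_1^{a_1}...x_k^{a_k} of P_k is encoded by its exponent list a (length k).
  A polynomial over F_2 is encoded by the finite set of monomials occurring with
  coefficient 1; addition is symmetric difference.\<close>

type_synonym mono = "nat list"
type_synonym poly = "nat list set"

definition padd :: "poly \<Rightarrow> poly \<Rightarrow> poly" where
  "padd f g = (f - g) \<union> (g - f)"

inductive_set f2span :: "poly set \<Rightarrow> poly set" for S :: "poly set" where
  zero: "{} \<in> f2span S"
| add: "p \<in> f2span S \<Longrightarrow> s \<in> S \<Longrightarrow> padd p s \<in> f2span S"

definition psum :: "poly set \<Rightarrow> poly set \<Rightarrow> poly set" where
  "psum U W = {padd u w | u w. u \<in> U \<and> w \<in> W}"

definition Pk :: "nat \<Rightarrow> poly set" where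
  "Pk k = {f. finite f \<and> (\<forall>a\<in>f. length a = k)}"

text \<open>Steenrod square Sq^i of a monomial, via Sq^r(x^n) = binom(n,r) x^{n+r}
  and the Cartan formula (mod 2).\<close>
definition Sq_mono :: "nat \<Rightarrow> mono \<Rightarrow> poly" where
  "Sq_mono i a = {b. length b = length a \<and>
      (\<forall>j<length a. a ! j \<le> b ! j \<and> odd ((a ! j) choose (b ! j - a ! j))) \<and>
      sum_list b = sum_list a + i}"

definition hit :: "nat \<Rightarrow> poly set" where
  "hit k = f2span {Sq_mono i a | i a. i > 0 \<and> length a = k}"

definition Pplus :: "nat \<Rightarrow> poly set" where
  "Pplus k = {f \<in> Pk k. \<forall>a\<in>f. \<forall>j<k. a ! j > 0}"

definition alpha :: "nat \<Rightarrow> nat \<Rightarrow> nat" where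
  "alpha t a = (a div 2 ^ t) mod 2"

text \<open>Weight vector of a monomial; index shifted by one:
  omega_mono a i = omega_{i+1}(x).\<close>
definition omega_mono :: "mono \<Rightarrow> nat \<Rightarrow> nat" where
  "omega_mono a i = (\<Sum>j<length a. alpha i (a ! j))"

text \<open>A weight vector given as a finite list (w_1,...,w_m), padded by zeros;
  again index shifted by one.\<close>
definition wv :: "nat list \<Rightarrow> nat \<Rightarrow> nat" where
  "wv w i = (if i < length w then w ! i else 0)"

definition deg_w :: "nat list \<Rightarrow> nat" where
  "deg_w w = (\<Sum>i<length w. 2 ^ i * w ! i)"

definition wless :: "(nat \<Rightarrow> nat) \<Rightarrow> (nat \<Rightarrow> nat) \<Rightarrow> bool" where
  "wless u v = (\<exists>i. (\<forall>j<i. u j = v j) \<and> u i < v i)"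

definition wle :: "(nat \<Rightarrow> nat) \<Rightarrow> (nat \<Rightarrow> nat) \<Rightarrow> bool" where
  "wle u v = (u = v \<or> wless u v)"

definition Pw :: "nat \<Rightarrow> nat list \<Rightarrow> poly set" where
  "Pw k w = {f \<in> Pk k. \<forall>y\<in>f. sum_list y = deg_w w \<and> wle (omega_mono y) (wv w)}"

definition Pw_minus :: "nat \<Rightarrow> nat list \<Rightarrow> poly set" where
  "Pw_minus k w = {f \<in> Pk k. \<forall>y\<in>f. sum_list y = deg_w w \<and> wless (omega_mono y) (wv w)}"

definition quot_dim :: "poly set \<Rightarrow> poly set \<Rightarrow> nat" where
  "quot_dim V U = (LEAST n. \<exists>B. finite B \<and> B \<subseteq> V \<and> card B = n \<and> V \<subseteq> f2span (B \<union> U))"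

definition dim_QPplus :: "nat \<Rightarrow> nat list \<Rightarrow> nat" where
  "dim_QPplus k w = quot_dim (Pplus k \<inter> Pw k w)
     (psum (hit k \<inter> Pplus k \<inter> Pw k w) (Pplus k \<inter> Pw_minus k w))"

end

theory Submission
  imports Defs "HOL-Library.Multiset"
begin

text \<open>A monomial whose exponents are below \<open>2^m\<close> is a sequence of \<open>m\<close> subsets of the variables,
  one for each binary digit of the exponents; its weight vector consists of the sizes of these
  subsets. Order the monomials of a given weight vector lexicographically.

  Upper bounds: a hit polynomial whose terms besides \<open>x\<close> have smaller weight vector or
  precede \<open>x\<close> makes \<open>x\<close> superfluous as a generator. Such a relation persists when \<open>x\<close> is
  extended by further digits at either end, so few relations, found by linear algebra, suffice to
  leave only as many irreducible monomials as the claimed dimension.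

  Lower bounds: a set \<open>S\<close> of monomials that meets every \<open>Sq^i a\<close> with \<open>i > 0\<close> in an even number
  of elements gives a functional \<open>f \<mapsto> |f \<inter> S| mod 2\<close> vanishing on the hit polynomials; it
  descends to the quotient if no element of \<open>S\<close> has a smaller weight vector. There are such sets
  with pairwise different largest elements of the given weight vector, as many as the claimed
  dimension. Up to permutations of the variables only a few of them are needed, and these
  are sparse.\<close>

subsection \<open>Spans over the field with two elements\<close>

text \<open>All four weight vectors have degree 24, and (4,4,3) > (4,4,1,1) > (4,2,4) > (4,2,2,1)
  are the four largest weights of that degree in five variables. A functional must vanish on every
  square and not only on squares inside P_5(\<omega>), because a hit polynomial in P_5(\<omega>) may
  be a sum of squares whose terms of larger weight cancel. Hence the monomials of larger weight in
  the annihilating sets; their weights are the preceding members of this chain. The two bounds are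
  found independently. Generators are monomials that lead no relation, functionals are indexed by
  their largest monomials; the two families differ in general and only their sizes have to meet.
  Dimension enters by counting alone: n polynomials have at most 2^n sums. Relations are handled
  among all monomials, because positivity is lost when digits are stripped off. Squares neither
  create nor remove a variable, so projecting a relation to the positive monomials of degree 24
  returns it to the quotient.\<close>

lemma padd_iff: "x \<in> padd f g \<longleftrightarrow> (x \<in> f) \<noteq> (x \<in> g)"
  by (auto simp: padd_def)

lemma padd_empty [simp]: "padd {} f = f" "padd f {} = f"
  by (auto simp: padd_iff)

lemma padd_assoc: "padd (padd f g) h = padd f (padd g h)"
  by (auto simp: set_eq_iff padd_iff)

lemma padd_commute: "padd f g = padd g f"
  by (auto simp: set_eq_iff padd_iff)

lemma padd_left_commute: "padd f (padd g h) = padd g (padd f h)"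
  by (auto simp: set_eq_iff padd_iff)

lemma padd_cancel [simp]: "padd f (padd f g) = g"
  by (auto simp: set_eq_iff padd_iff)

lemma finite_padd: "finite f \<Longrightarrow> finite g \<Longrightarrow> finite (padd f g)"
  by (simp add: padd_def)

lemma odd_card_padd:
  assumes "finite f" "finite g"
  shows "odd (card (padd f g)) \<longleftrightarrow> odd (card f) \<noteq> odd (card g)"
proof -
  have "card (padd f g) = card (f - g) + card (g - f)"
    unfolding padd_def using assms by (intro card_Un_disjoint) auto
  moreover have "card f = card (f \<inter> g) + card (f - g)"
    using assms card_Int_Diff by blast
  moreover have "card g = card (f \<inter> g) + card (g - f)"
    using assms card_Int_Diff[of g f] by (simp add: Int_commute)
  ultimately show ?thesis by presburger
qed

lemma f2span_superset: "s \<in> S \<Longrightarrow> s \<in> f2span S"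
  using f2span.add[OF f2span.zero] by force

lemma f2span_least:
  assumes "p \<in> f2span S" "{} \<in> C" "\<And>p q. p \<in> C \<Longrightarrow> q \<in> C \<Longrightarrow> padd p q \<in> C" "S \<subseteq> C"
  shows "p \<in> C"
  using assms(1) by induction (use assms in blast)+

lemma f2span_padd:
  assumes "p \<in> f2span S" "q \<in> f2span S"
  shows "padd p q \<in> f2span S"
  using assms(2)
proof induction
  case (add q s)
  then show ?case using f2span.add padd_assoc by metis
qed (simp add: assms)

lemma f2span_linear_image:
  assumes "p \<in> f2span S" "F {} = {}" "\<And>p q. F (padd p q) = padd (F p) (F q)"
    "\<And>s. s \<in> S \<Longrightarrow> F s \<in> f2span T"
  shows "F p \<in> f2span T"
  using assms(1)
  by induction (use assms(2-) f2span.zero f2span_padd in auto)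

lemma f2span_mono: "p \<in> f2span S \<Longrightarrow> S \<subseteq> f2span T \<Longrightarrow> p \<in> f2span T"
  using f2span_linear_image[of p S "\<lambda>p. p" T] by auto

lemma f2span_singletons:
  assumes "finite f" "\<And>x. x \<in> f \<Longrightarrow> {x} \<in> f2span S"
  shows "f \<in> f2span S"
  using assms
proof (induction f rule: finite_induct)
  case (insert x f)
  then have "insert x f = padd f {x}"
    by (auto simp: padd_def)
  with insert show ?case by (auto intro: f2span_padd)
qed (simp add: f2span.zero)

subsection \<open>Steenrod squares of monomials\<close>

text \<open>x^m is a term of the total square of x^n. By the Cartan formula, a term of the total
  square of a monomial is one such step in each variable.\<close>

definition sqstep :: "nat \<Rightarrow> nat \<Rightarrow> bool" where
  "sqstep n m \<longleftrightarrow> n \<le> m \<and> odd (n choose (m - n))"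

lemma Sq_mono_iff_nth:
  "b \<in> Sq_mono i a \<longleftrightarrow>
    length b = length a \<and> (\<forall>j<length a. sqstep (a ! j) (b ! j)) \<and> sum_list b = sum_list a + i"
  by (simp add: Sq_mono_def sqstep_def)

lemma Sq_mono_iff: "b \<in> Sq_mono i a \<longleftrightarrow> list_all2 sqstep a b \<and> sum_list b = sum_list a + i"
  by (auto simp: Sq_mono_iff_nth list_all2_conv_all_nth)

lemma finite_Sq_mono: "finite (Sq_mono i a)"
proof (rule finite_subset)
  show "Sq_mono i a \<subseteq> {b. set b \<subseteq> {..sum_list a + i} \<and> length b = length a}"
    by (auto simp: Sq_mono_def dest: member_le_sum_list)
qed (simp add: finite_lists_length_eq)

text \<open>Lucas' theorem modulo 2 with the last binary digit split off. Pascal's rule, used twice,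
  gives C(n+2,q+2) = C(n,q+2) + 2 C(n,q+1) + C(n,q), and the middle term vanishes modulo 2.\<close>

lemma odd_choose_div2:
  "odd (n choose r) \<longleftrightarrow> (even r \<or> odd n) \<and> odd ((n div 2) choose (r div 2))"
proof (induction n arbitrary: r rule: induct_nat_012)
  case 0
  then show ?case by (cases "r < 2") (auto simp: less_2_cases_iff binomial_eq_0)
next
  case 1
  then show ?case by (cases "r < 2") (auto simp: less_2_cases_iff binomial_eq_0)
next
  case (ge2 n)
  consider "r = 0" | "r = 1" | q where "r = Suc (Suc q)"
    by (metis One_nat_def old.nat.exhaust)
  then show ?case
  proof cases
    case (3 q)
    have "odd (Suc (Suc n) choose Suc (Suc q)) \<longleftrightarrow> odd (n choose Suc (Suc q)) \<noteq> odd (n choose q)"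
      by auto
    also have "\<dots> \<longleftrightarrow> (even q \<or> odd n) \<and> odd ((Suc (Suc n) div 2) choose (Suc (Suc q) div 2))"
      using ge2.IH(1)[of q] ge2.IH(1)[of "Suc (Suc q)"] by auto
    finally show ?thesis using 3 by simp
  qed auto
qed

text \<open>Injectivity prevents new cancellations, so taking images commutes with
  \<open>padd\<close>. The predicate \<open>P\<close> retains the monomials on which
  \<open>g\<close> is injective, in the applications those with the right number of
  variables.\<close>

lemma f2span_inj_image:
  assumes "p \<in> f2span S" "inj_on g {b. P b}" "\<And>s. s \<in> S \<Longrightarrow> g ` {b \<in> s. P b} \<in> f2span T"
  shows "g ` {b \<in> p. P b} \<in> f2span T"
  using assms(1)
proof (rule f2span_linear_image)
  fix p q :: poly
  show "g ` {b \<in> padd p q. P b} = padd (g ` {b \<in> p. P b}) (g ` {b \<in> q. P b})"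
    using assms(2) by (auto simp: set_eq_iff padd_iff inj_on_def image_iff)
qed (use assms in auto)

lemma sqstep_le: "sqstep n m \<Longrightarrow> n \<le> m"
  by (simp add: sqstep_def)

text \<open>A last digit 0 never turns into 1: for an even upper number an odd binomial coefficient
  needs an even increment. Squares can therefore only lose lowest digits, and the first weight never
  grows.\<close>

lemma sqstep_bit_le:
  assumes "sqstep (e + 2 * n) m" "e \<le> 1"
  shows "m mod 2 \<le> e"
proof (cases "e = 0")
  case True
  then have "2 * n \<le> m" "even (m - 2 * n)"
    using assms odd_choose_div2[of "2 * n" "m - 2 * n"] by (auto simp: sqstep_def)
  then show ?thesis using True by (auto simp: even_iff_mod_2_eq_zero[symmetric] even_diff_nat)
qed (use assms in auto)

text \<open>One variable of the identity Sq^(2 i) (g^2) = (Sq^i g)^2: if the last digit is kept, the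
  increment is even and Lucas' theorem cancels that digit.\<close>

lemma sqstep_double:
  assumes "m mod 2 = e"
  shows "sqstep (e + 2 * n) m \<longleftrightarrow> sqstep n (m div 2)"
proof -
  define q where "q = m div 2"
  have e: "e < 2" and m: "m = e + 2 * q" using assms by (auto simp: q_def)
  have "(e + 2 * n) div 2 = n" using e by simp
  then have "odd ((e + 2 * n) choose (2 * (q - n))) \<longleftrightarrow> odd (n choose (q - n))"
    using odd_choose_div2[of "e + 2 * n" "2 * (q - n)"] by simp
  moreover have "m - (e + 2 * n) = 2 * (q - n)" "e + 2 * n \<le> m \<longleftrightarrow> n \<le> q"
    unfolding m by auto
  ultimately show ?thesis unfolding sqstep_def q_def[symmetric] by simp
qed

text \<open>By Lucas' theorem an \<open>r\<close> with at most \<open>s\<close> digits tests only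
  the last \<open>s\<close> digits of the upper number, and a multiple of \<open>2 ^ s\<close>
  leaves these alone.\<close>

lemma odd_choose_shift: "r < 2 ^ s \<Longrightarrow> odd ((n + 2 ^ s * z) choose r) \<longleftrightarrow> odd (n choose r)"
proof (induction s arbitrary: n r z)
  case (Suc s)
  have 1: "(n + 2 ^ Suc s * z) div 2 = n div 2 + 2 ^ s * z" "odd (n + 2 ^ Suc s * z) = odd n"
    by auto
  have "r div 2 < 2 ^ s" using Suc.prems by auto
  from Suc.IH[OF this] show ?case
    by (subst (1 2) odd_choose_div2) (simp only: 1)
qed simp

lemma sum_list_mono_nat:
  fixes x y :: "nat list"
  shows "list_all2 (\<le>) x y \<Longrightarrow> sum_list x \<le> sum_list y"
  by (induction rule: list_all2_induct) auto

lemma sum_list_less_nat: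
  fixes x y :: "nat list"
  shows "list_all2 (\<le>) x y \<Longrightarrow> x \<noteq> y \<Longrightarrow> sum_list x < sum_list y"
  by (induction rule: list_all2_induct) (use sum_list_mono_nat in fastforce)+

text \<open>When no exponent decreases, each one grows by at most the growth of the degree. For Sq^i
  with i < 2^s every increment is thus small enough for \<open>odd_choose_shift\<close>.\<close>

lemma nth_diff_le_sum_list:
  fixes x y :: "nat list"
  assumes "list_all2 (\<le>) x y" "j < length x"
  shows "y ! j - x ! j \<le> sum_list y - sum_list x"
  using assms
proof (induction arbitrary: j rule: list_all2_induct)
  case (Cons a xs b ys)
  have "sum_list xs \<le> sum_list ys" using Cons sum_list_mono_nat by blast
  with Cons show ?case by (cases j) fastforce+
qed simp

section \<open>Binary digits of exponents and weight vectors\<close>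

definition bits :: "mono \<Rightarrow> nat list" where "bits x = map (\<lambda>n. n mod 2) x"

definition halve :: "mono \<Rightarrow> mono" where "halve x = map (\<lambda>n. n div 2) x"

text \<open>The product of x with the 2^s-th power of z: the digits of z are added from position
  \<open>s\<close> on. In particular \<open>join e x\<close> is e times x^2, so there the first
  argument carries the low digits.\<close>

definition shift :: "nat \<Rightarrow> mono \<Rightarrow> mono \<Rightarrow> mono" where
  "shift s z x = map2 (\<lambda>z n. n + 2 ^ s * z) z x"

abbreviation join :: "nat list \<Rightarrow> mono \<Rightarrow> mono" where
  "join e x \<equiv> shift 1 x e"

lemma length_simps [simp]:
  "length (bits x) = length x" "length (halve x) = length x"
  "length (shift s z x) = min (length z) (length x)"
  by (simp_all add: bits_def halve_def shift_def)

lemma nth_shift [simp]: "j < length z \<Longrightarrow> j < length x \<Longrightarrow> shift s z x ! j = x ! j + 2 ^ s * z ! j"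
  by (simp add: shift_def)

lemma set_bits: "set (bits x) \<subseteq> {0, 1}"
  by (auto simp: bits_def)

lemma bits_join:
  assumes "set e \<subseteq> {0, 1}" "length x = length e"
  shows "bits (join e x) = e"
proof (rule nth_equalityI)
  fix j assume "j < length (bits (join e x))"
  then have "e ! j \<in> {0, 1}" "j < length e" using assms nth_mem by fastforce+
  then show "bits (join e x) ! j = e ! j" using assms by (auto simp: bits_def)
qed (use assms in simp)

lemma halve_join:
  assumes "set e \<subseteq> {0, 1}" "length x = length e"
  shows "halve (join e x) = x"
proof (rule nth_equalityI)
  fix j assume "j < length (halve (join e x))"
  then have "e ! j \<in> {0, 1}" "j < length e" using assms nth_mem by fastforce+
  then show "halve (join e x) ! j = x ! j" using assms by (auto simp: halve_def)
qed (use assms in simp)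

lemma join_bits_halve: "join (bits x) (halve x) = x"
  by (rule nth_equalityI) (auto simp: bits_def halve_def)

lemma sum_list_shift:
  "length z = length x \<Longrightarrow> sum_list (shift s z x) = sum_list x + 2 ^ s * sum_list z"
  unfolding shift_def by (induction z x rule: list_induct2) (auto simp: algebra_simps)

lemma sum_list_bits_halve: "sum_list x = sum_list (bits x) + 2 * sum_list (halve x)"
  using sum_list_shift[of "halve x" "bits x" 1] unfolding join_bits_halve by simp

lemma shift_inject:
  assumes "shift s z x = shift s z y" "length x = length z" "length y = length z"
  shows "x = y"
proof (rule nth_equalityI)
  fix j assume "j < length x"
  then show "x ! j = y ! j"
    using arg_cong[OF assms(1), of "\<lambda>c. c ! j"] assms(2,3) by simp
qed (use assms in simp)

lemma bits_shift: "length x = length z \<Longrightarrow> bits (shift (Suc s) z x) = bits x"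
  by (rule nth_equalityI) (simp_all add: bits_def mult.assoc)

lemma halve_shift: "length x = length z \<Longrightarrow> halve (shift (Suc s) z x) = shift s z (halve x)"
  by (rule nth_equalityI) (simp_all add: halve_def mult.assoc)

text \<open>Comparison of weight vectors unrolled digit by digit, so that it can be evaluated.
  Beyond the end of the list the reference weights are 0, which nothing undercuts; correspondingly
  \<open>exactly\<close> requires that no digits are left there.\<close>

fun lower :: "nat list \<Rightarrow> mono \<Rightarrow> bool" where
  "lower [] x = False"
| "lower (r # w) x = (sum_list (bits x) < r \<or> sum_list (bits x) = r \<and> lower w (halve x))"

fun exactly :: "nat list \<Rightarrow> mono \<Rightarrow> bool" where
  "exactly [] x = (sum_list x = 0)"
| "exactly (r # w) x = (sum_list (bits x) = r \<and> exactly w (halve x))"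

text \<open>The drop in weight happens among the first \<open>length w\<close> digits, which z does
  not touch.\<close>

lemma lower_shift:
  "length x = length z \<Longrightarrow> lower w x \<Longrightarrow> lower (w @ v) (shift (length w) z x)"
  by (induction w arbitrary: x) (auto simp: bits_shift halve_shift)

lemma exactly_shift:
  "length x = length z \<Longrightarrow> exactly w x \<Longrightarrow> exactly v z \<Longrightarrow> exactly (w @ v) (shift (length w) z x)"
proof (induction w arbitrary: x)
  case Nil
  then have "shift 0 z x = z"
    by (intro nth_equalityI) auto
  with Nil show ?case by simp
qed (auto simp: bits_shift halve_shift)

lemma omega_mono_0: "omega_mono x 0 = sum_list (bits x)"
  and omega_mono_Suc: "omega_mono x (Suc i) = omega_mono (halve x) i"
  by (auto simp: omega_mono_def sum_list_sum_nth alpha_def bits_def halve_def div_mult2_eq atLeast0LessThan)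

lemma wless_Suc:
  "wless u v \<longleftrightarrow> u 0 < v 0 \<or> u 0 = v 0 \<and> wless (\<lambda>i. u (Suc i)) (\<lambda>i. v (Suc i))"
proof
  assume "wless u v"
  then obtain i where i: "\<forall>j<i. u j = v j" "u i < v i" by (auto simp: wless_def)
  show "u 0 < v 0 \<or> u 0 = v 0 \<and> wless (\<lambda>i. u (Suc i)) (\<lambda>i. v (Suc i))"
  proof (cases i)
    case (Suc k)
    with i have "\<forall>j<k. u (Suc j) = v (Suc j)" "u (Suc k) < v (Suc k)" "u 0 = v 0" by auto
    then show ?thesis by (auto simp: wless_def)
  qed (use i in auto)
next
  assume "u 0 < v 0 \<or> u 0 = v 0 \<and> wless (\<lambda>i. u (Suc i)) (\<lambda>i. v (Suc i))"
  then show "wless u v"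
  proof
    assume "u 0 < v 0"
    then show ?thesis
      unfolding wless_def by (intro exI[of _ 0]) simp
  next
    assume "u 0 = v 0 \<and> wless (\<lambda>i. u (Suc i)) (\<lambda>i. v (Suc i))"
    then obtain i where "u 0 = v 0" "\<forall>j<i. u (Suc j) = v (Suc j)" "u (Suc i) < v (Suc i)"
      by (auto simp: wless_def)
    then show ?thesis
      unfolding wless_def by (intro exI[of _ "Suc i"]) (auto simp: less_Suc_eq_0_disj)
  qed
qed

lemma wv_simps: "wv [] = (\<lambda>i. 0)" "wv (r # w) 0 = r" "wv (r # w) (Suc i) = wv w i"
  by (auto simp: wv_def)

lemma lower_iff: "lower w x \<longleftrightarrow> wless (omega_mono x) (wv w)"
proof (induction w arbitrary: x)
  case Nil
  then show ?case by (simp add: wless_def wv_simps)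
next
  case (Cons r w)
  then show ?case by (subst wless_Suc) (simp add: omega_mono_0 omega_mono_Suc wv_simps)
qed

lemma omega_mono_eq_0: "omega_mono x = (\<lambda>i. 0) \<longleftrightarrow> sum_list x = 0"
proof
  assume *: "omega_mono x = (\<lambda>i. 0)"
  then show "sum_list x = 0"
  proof (induction "sum_list x" arbitrary: x rule: less_induct)
    case less
    have "omega_mono (halve x) = (\<lambda>i. 0)" "sum_list (bits x) = 0"
      using less.prems omega_mono_Suc[of x] omega_mono_0[of x] by (auto simp: fun_eq_iff)
    with less.hyps[of "halve x"] sum_list_bits_halve[of x] show ?case by fastforce
  qed
next
  assume "sum_list x = 0"
  then have "\<forall>j<length x. x ! j = 0" by (simp add: all_set_conv_all_nth)
  then show "omega_mono x = (\<lambda>i. 0)"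
    by (intro ext) (auto simp: omega_mono_def alpha_def)
qed

lemma exactly_iff: "exactly w x \<longleftrightarrow> omega_mono x = wv w"
proof (induction w arbitrary: x)
  case Nil
  then show ?case by (simp add: omega_mono_eq_0 wv_simps)
next
  case (Cons r w)
  have "omega_mono x = wv (r # w) \<longleftrightarrow>
      omega_mono x 0 = wv (r # w) 0 \<and> (\<forall>i. omega_mono x (Suc i) = wv (r # w) (Suc i))"
    unfolding fun_eq_iff by (metis not0_implies_Suc)
  also have "\<dots> \<longleftrightarrow> omega_mono x 0 = r \<and> omega_mono (halve x) = wv w"
    by (simp add: omega_mono_Suc wv_simps fun_eq_iff)
  finally have "omega_mono x = wv (r # w) \<longleftrightarrow> \<dots>" .
  with Cons show ?case by (simp add: omega_mono_0)
qed

lemma deg_w_Nil: "deg_w [] = 0"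
  by (simp add: deg_w_def)

lemma deg_w_Cons: "deg_w (r # w) = r + 2 * deg_w w"
  by (simp add: deg_w_def sum.lessThan_Suc_shift sum_distrib_left mult.assoc del: sum.lessThan_Suc)

lemma exactly_sum_list: "exactly w x \<Longrightarrow> sum_list x = deg_w w"
proof (induction w arbitrary: x)
  case (Cons r w)
  then show ?case using sum_list_bits_halve[of x] by (simp add: deg_w_Cons)
qed (simp add: deg_w_Nil)

subsection \<open>Hit polynomials modulo smaller weights\<close>

definition hitmod :: "nat \<Rightarrow> nat list \<Rightarrow> poly set" where
  "hitmod s w = f2span ({Sq_mono i a | i a. 0 < i \<and> i < 2 ^ s} \<union> {{b} | b. lower w b})"

lemma hitmod_zero: "{} \<in> hitmod s w"
  unfolding hitmod_def by (rule f2span.zero)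

lemma hitmod_Sq: "0 < i \<Longrightarrow> i < 2 ^ s \<Longrightarrow> Sq_mono i a \<in> hitmod s w"
  unfolding hitmod_def by (rule f2span_superset) blast

lemma hitmod_lower:
  assumes "finite f" "\<And>b. b \<in> f \<Longrightarrow> lower w b"
  shows "f \<in> hitmod s w"
  unfolding hitmod_def using assms(1)
  by (rule f2span_singletons) (rule f2span_superset, use assms(2) in blast)

lemma hitmod_padd: "f \<in> hitmod s w \<Longrightarrow> g \<in> hitmod s w \<Longrightarrow> padd f g \<in> hitmod s w"
  unfolding hitmod_def by (rule f2span_padd)

lemma hitmod_inj_image:
  assumes "f \<in> hitmod s w" "inj_on g {b. P b}"
    "\<And>i a. 0 < i \<Longrightarrow> i < 2 ^ s \<Longrightarrow> g ` {b \<in> Sq_mono i a. P b} \<in> hitmod t v"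
    "\<And>b. lower w b \<Longrightarrow> P b \<Longrightarrow> lower v (g b)"
  shows "g ` {b \<in> f. P b} \<in> hitmod t v"
  using assms(1) unfolding hitmod_def
proof (rule f2span_inj_image)
  fix h assume "h \<in> {Sq_mono i a |i a. 0 < i \<and> i < 2 ^ s} \<union> {{b} |b. lower w b}"
  then consider (Sq) i a where "h = Sq_mono i a" "0 < i" "i < 2 ^ s" | (lower) b where "h = {b}" "lower w b"
    by blast
  then have "g ` {b \<in> h. P b} \<in> hitmod t v"
  proof cases
    case (Sq i a)
    show ?thesis unfolding Sq(1) using Sq(2,3) by (rule assms(3))
  next
    case (lower b)
    then show ?thesis using assms(4) by (intro hitmod_lower) auto
  qed
  then show "g ` {b \<in> h. P b} \<in> f2span ({Sq_mono i a |i a. 0 < i \<and> i < 2 ^ t} \<union> {{b} |b. lower v b})"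
    unfolding hitmod_def .
qed (rule assms(2))

text \<open>By the Cartan formula, \<open>X * (Sq^i g)^2 = X * Sq^(2 i) (g^2)\<close> differs from \<open>Sq^(2 i) (X * g^2)\<close>
  by terms in which some variable of the squarefree monomial \<open>X\<close> got squared, and these have a
  smaller first weight.\<close>

lemma hitmod_join:
  assumes "f \<in> hitmod s w" "set e \<subseteq> {0, 1}"
  shows "join e ` {b \<in> f. length b = length e} \<in> hitmod (Suc s) (sum_list e # w)"
  using assms(1)
proof (rule hitmod_inj_image)
  show "inj_on (join e) {b. length b = length e}"
    by (rule inj_on_inverseI[where g = halve]) (rule halve_join[OF assms(2)], simp)
next
  fix b assume "lower w b" "length b = length e"
  then show "lower (sum_list e # w) (join e b)"
    by (simp add: bits_join halve_join assms(2) del: One_nat_def)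
next
  fix i :: nat and a assume i: "0 < i" "i < 2 ^ s"
  show "join e ` {b \<in> Sq_mono i a. length b = length e} \<in> hitmod (Suc s) (sum_list e # w)"
  proof (cases "length a = length e")
    case False
    then have "{b \<in> Sq_mono i a. length b = length e} = {}"
      by (auto simp: Sq_mono_iff_nth)
    then show ?thesis by (simp only: image_empty hitmod_zero)
  next
    case True
    define R where "R = {c \<in> Sq_mono (2 * i) (join e a). bits c \<noteq> e}"
    have e01: "e ! j \<le> 1" if "j < length e" for j
      using subsetD[OF assms(2) nth_mem[OF that]] by auto
    have Sq: "c \<in> Sq_mono (2 * i) (join e a) \<longleftrightarrow> halve c \<in> Sq_mono i a" if c: "bits c = e" for c
    proof -
      have len: "length c = length e" using arg_cong[OF c, of length] by simp
      have step: "sqstep (join e a ! j) (c ! j) \<longleftrightarrow> sqstep (a ! j) (halve c ! j)" if "j < length e" for j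
      proof -
        have "c ! j mod 2 = e ! j"
          using that len arg_cong[OF c, of "\<lambda>c. c ! j"] by (simp add: bits_def)
        then show ?thesis
          using sqstep_double[of "c ! j" "e ! j" "a ! j"] that True len by (simp add: halve_def)
      qed
      have "sum_list c = sum_list (join e a) + 2 * i \<longleftrightarrow> sum_list (halve c) = sum_list a + i"
        using sum_list_bits_halve[of c] True by (simp add: c sum_list_shift) arith
      moreover have "(\<forall>j<length (join e a). sqstep (join e a ! j) (c ! j)) \<longleftrightarrow>
          (\<forall>j<length a. sqstep (a ! j) (halve c ! j))"
        using step True by (simp del: One_nat_def nth_shift)
      ultimately show ?thesis
        unfolding Sq_mono_iff_nth using len True by (simp del: One_nat_def nth_shift)
    qed
    have "join e ` {b \<in> Sq_mono i a. length b = length e} = {c. bits c = e \<and> halve c \<in> Sq_mono i a}"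
    proof (intro set_eqI iffI)
      fix c assume "c \<in> {c. bits c = e \<and> halve c \<in> Sq_mono i a}"
      then have "c = join e (halve c)" "halve c \<in> {b \<in> Sq_mono i a. length b = length e}"
        using join_bits_halve[of c] by (auto simp: Sq_mono_iff_nth True)
      then show "c \<in> join e ` {b \<in> Sq_mono i a. length b = length e}" by blast
    next
      fix c assume "c \<in> join e ` {b \<in> Sq_mono i a. length b = length e}"
      then obtain b where "c = join e b" "b \<in> Sq_mono i a" "length b = length e" by blast
      then show "c \<in> {c. bits c = e \<and> halve c \<in> Sq_mono i a}"
        by (simp add: bits_join halve_join assms(2) del: One_nat_def)
    qed
    also have "\<dots> = padd (Sq_mono (2 * i) (join e a)) R"
    proof (rule set_eqI)
      fix c show "c \<in> {c. bits c = e \<and> halve c \<in> Sq_mono i a} \<longleftrightarrow> c \<in> padd (Sq_mono (2 * i) (join e a)) R"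
        by (cases "bits c = e") (simp_all add: padd_iff R_def Sq del: One_nat_def)
    qed
    also have "\<dots> \<in> hitmod (Suc s) (sum_list e # w)"
    proof (rule hitmod_padd)
      show "Sq_mono (2 * i) (join e a) \<in> hitmod (Suc s) (sum_list e # w)"
        using i by (intro hitmod_Sq) simp_all
      show "R \<in> hitmod (Suc s) (sum_list e # w)"
      proof (rule hitmod_lower)
        show "finite R" unfolding R_def using finite_Sq_mono by simp
        fix c assume "c \<in> R"
        then have c: "length c = length e" "\<forall>j<length e. sqstep (e ! j + 2 * a ! j) (c ! j)" "bits c \<noteq> e"
          using True by (auto simp: R_def Sq_mono_iff_nth)
        then have "list_all2 (\<le>) (bits c) e"
          using sqstep_bit_le e01 by (auto simp: list_all2_conv_all_nth bits_def)
        with c(3) have "sum_list (bits c) < sum_list e"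
          by (rule sum_list_less_nat[rotated])
        then show "lower (sum_list e # w) c" by simp
      qed
    qed
    finally show ?thesis .
  qed
qed

text \<open>The operation \<open>Sq^i\<close> with \<open>i < 2^s\<close> is linear over the \<open>2^s\<close>-th powers.\<close>

lemma hitmod_shift:
  assumes "f \<in> hitmod (length w) w"
  shows "shift (length w) z ` {b \<in> f. length b = length z} \<in> hitmod (length w) (w @ v)"
  using assms
proof (rule hitmod_inj_image)
  let ?s = "length w"
  show "inj_on (shift ?s z) {b. length b = length z}"
    using shift_inject by (auto simp: inj_on_def)
  fix i :: nat and a assume i: "0 < i" "i < 2 ^ ?s"
  have "shift ?s z ` {b \<in> Sq_mono i a. length b = length z} = Sq_mono i (shift ?s z a)"
    if a: "length a = length z"
  proof (intro set_eqI iffI)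
    fix c assume "c \<in> shift ?s z ` {b \<in> Sq_mono i a. length b = length z}"
    then obtain b where c: "c = shift ?s z b" and b: "list_all2 sqstep a b" "sum_list b = sum_list a + i"
      by (auto simp: Sq_mono_iff)
    have len: "length b = length z" using b(1) a by (auto dest: list_all2_lengthD)
    have ab: "list_all2 (\<le>) a b"
      using b(1) sqstep_le by (rule list_all2_mono)
    have "sqstep (shift ?s z a ! j) (c ! j)" if j: "j < length z" for j
    proof -
      have "b ! j - a ! j < 2 ^ ?s"
        using nth_diff_le_sum_list[OF ab, of j] j a b(2) i(2) by simp
      moreover have "sqstep (a ! j) (b ! j)" using b(1) j a by (simp add: list_all2_nthD)
      ultimately show ?thesis
        using odd_choose_shift[of "b ! j - a ! j" ?s "a ! j" "z ! j"] j a len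
        by (simp add: c sqstep_def)
    qed
    then show "c \<in> Sq_mono i (shift ?s z a)"
      using b(2) len a by (simp add: c Sq_mono_iff_nth sum_list_shift)
  next
    fix c assume "c \<in> Sq_mono i (shift ?s z a)"
    then have c: "length c = length z" "\<And>j. j < length z \<Longrightarrow> sqstep (a ! j + 2 ^ ?s * z ! j) (c ! j)"
      "list_all2 sqstep (shift ?s z a) c" "sum_list c = sum_list a + 2 ^ ?s * sum_list z + i"
      using a by (auto simp: Sq_mono_iff_nth sum_list_shift list_all2_conv_all_nth)
    \<comment> \<open>Truncated subtraction loses nothing: squares do not decrease exponents, so
      each exponent of c is at least 2^s times that of z.\<close>
    define b where "b = map2 (\<lambda>z n. n - 2 ^ ?s * z) z c"
    have len: "length b = length z" by (simp add: b_def c)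
    have nth: "b ! j + 2 ^ ?s * z ! j = c ! j" "b ! j = c ! j - 2 ^ ?s * z ! j" if "j < length z" for j
      using sqstep_le[OF c(2)[OF that]] that c(1) by (auto simp: b_def)
    have cb: "c = shift ?s z b"
      using nth len c(1) by (intro nth_equalityI) auto
    have ac: "list_all2 (\<le>) (shift ?s z a) c"
      using c(3) sqstep_le by (rule list_all2_mono)
    have "sqstep (a ! j) (b ! j)" if j: "j < length a" for j
    proof -
      have "c ! j - (a ! j + 2 ^ ?s * z ! j) < 2 ^ ?s"
        using nth_diff_le_sum_list[OF ac, of j] j c(4) i(2) a by (simp add: sum_list_shift)
      then have "b ! j - a ! j < 2 ^ ?s"
        using nth(2)[of j] j a by simp
      then show ?thesis
        using c(2)[of j] j a odd_choose_shift[of "b ! j - a ! j" ?s "a ! j" "z ! j"] nth(1)[of j, symmetric]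
        by (simp add: sqstep_def)
    qed
    moreover have "sum_list b = sum_list a + i"
      using c(4) len by (simp add: cb sum_list_shift)
    ultimately show "c \<in> shift ?s z ` {b \<in> Sq_mono i a. length b = length z}"
      using len a cb by (auto simp: Sq_mono_iff_nth)
  qed
  note eq = this
  show "shift ?s z ` {b \<in> Sq_mono i a. length b = length z} \<in> hitmod ?s (w @ v)"
  proof (cases "length a = length z")
    case True
    show ?thesis unfolding eq[OF True] using i by (rule hitmod_Sq)
  next
    case False
    then have "{b \<in> Sq_mono i a. length b = length z} = {}"
      by (auto simp: Sq_mono_iff_nth)
    then show ?thesis by (simp only: image_empty hitmod_zero)
  qed
next
  fix b assume "lower w b" "length b = length z"
  then show "lower (w @ v) (shift (length w) z b)"
    by (intro lower_shift)
qed

subsection \<open>Reducible monomials\<close>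

fun bitseq :: "nat \<Rightarrow> mono \<Rightarrow> nat list" where
  "bitseq 0 x = []"
| "bitseq (Suc s) x = bits x @ bitseq s (halve x)"

text \<open>The lowest digits of all variables are compared before the next digits.
  \<open>lex\<close> relates only lists of equal length, which makes the order well-founded.\<close>

definition below :: "nat \<Rightarrow> mono \<Rightarrow> mono \<Rightarrow> bool" where
  "below s x y \<longleftrightarrow> (bitseq s x, bitseq s y) \<in> lex less_than"

lemma wf_below: "wf {(x, y). below s x y}"
proof -
  have "wf (inv_image (lex less_than) (bitseq s))" by (intro wf_inv_image wf_lex) simp
  then show ?thesis by (simp add: inv_image_def below_def)
qed

lemma below_join:
  assumes "set e \<subseteq> {0, 1}" "length x = length e" "length y = length e" "below s x y"
  shows "below (Suc s) (join e x) (join e y)"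
  using assms by (simp add: below_def bits_join halve_join lex_append_leftI del: One_nat_def)

text \<open>\<open>exactly w x\<close> leaves no digit of x at position \<open>length w\<close> or
  above, so the addition in \<open>shift\<close> produces no carries and the digit lists are simply
  concatenated.\<close>

lemma bitseq_shift:
  "exactly w x \<Longrightarrow> length x = length z \<Longrightarrow>
    bitseq (length w + t) (shift (length w) z x) = bitseq (length w) x @ bitseq t z"
proof (induction w arbitrary: x)
  case Nil
  then have "shift 0 z x = z" by (intro nth_equalityI) auto
  then show ?case by simp
qed (simp add: bits_shift halve_shift)

lemma below_shift:
  assumes "exactly w x" "exactly w y" "length x = length z" "length y = length z"
    "below (length w) x y"
  shows "below (length w + t) (shift (length w) z x) (shift (length w) z y)"
  unfolding below_def bitseq_shift[OF assms(1,3)] bitseq_shift[OF assms(2,4)]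
  using assms(5) by (intro lex_append_rightI) (simp_all add: below_def)

text \<open>The range \<open>s\<close> of the squares is kept apart from the number of digits, since
  \<open>shift\<close> lengthens the weight vector without enlarging the squares, while
  \<open>join\<close> raises both. Terms of equal weight must precede x, so that rewriting
  terminates, and must have as many variables as x, so that they can be extended together with
  it.\<close>

definition reducible :: "nat \<Rightarrow> nat list \<Rightarrow> mono \<Rightarrow> bool" where
  "reducible s w x \<longleftrightarrow> exactly w x \<and> (\<exists>f\<in>hitmod s w. x \<in> f \<and>
     (\<forall>y\<in>f. y = x \<or> lower w y \<or> exactly w y \<and> length y = length x \<and> below (length w) y x))"

lemma reducibleI:
  assumes "exactly w x" "f \<in> hitmod s w" "x \<in> f"
    "\<And>y. y \<in> f \<Longrightarrow> y = x \<or> lower w y \<or> exactly w y \<and> length y = length x \<and> below (length w) y x"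
  shows "reducible s w x"
  unfolding reducible_def by (intro conjI bexI[of _ f] ballI) (fact assms)+

lemma reducibleE:
  assumes "reducible s w x"
  obtains f where "exactly w x" "f \<in> hitmod s w" "x \<in> f"
    "\<And>y. y \<in> f \<Longrightarrow> y = x \<or> lower w y \<or> exactly w y \<and> length y = length x \<and> below (length w) y x"
  using assms unfolding reducible_def by auto

lemma reducible_join:
  assumes "reducible s w x" "set e \<subseteq> {0, 1}" "length x = length e"
  shows "reducible (Suc s) (sum_list e # w) (join e x)"
  using assms(1)
proof (rule reducibleE)
  fix f assume f: "exactly w x" "f \<in> hitmod s w" "x \<in> f"
    "\<And>y. y \<in> f \<Longrightarrow> y = x \<or> lower w y \<or> exactly w y \<and> length y = length x \<and> below (length w) y x"
  show ?thesis
  proof (rule reducibleI)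
    show "join e ` {b \<in> f. length b = length e} \<in> hitmod (Suc s) (sum_list e # w)"
      using f(2) assms(2) by (rule hitmod_join)
    show "join e x \<in> join e ` {b \<in> f. length b = length e}"
      using f(3) assms(3) by blast
    show "exactly (sum_list e # w) (join e x)"
      using f(1) by (simp only: exactly.simps bits_join[OF assms(2,3)] halve_join[OF assms(2,3)])
    fix y assume "y \<in> join e ` {b \<in> f. length b = length e}"
    then obtain b where b: "y = join e b" "b \<in> f" "length b = length e" by blast
    have y: "bits y = e" "halve y = b" "length y = length e"
      unfolding b(1) using bits_join[OF assms(2) b(3)] halve_join[OF assms(2) b(3)] b(3) by simp_all
    from f(4)[OF b(2)]
    show "y = join e x \<or> lower (sum_list e # w) y \<or> exactly (sum_list e # w) y \<and>
      length y = length (join e x) \<and> below (length (sum_list e # w)) y (join e x)"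
    proof (elim disjE)
      assume "exactly w b \<and> length b = length x \<and> below (length w) b x"
      then show ?thesis
        using below_join[OF assms(2) b(3) assms(3), of "length w", folded b(1)] y assms(3)
        by (simp del: One_nat_def)
    next
      assume "lower w b"
      then show ?thesis using y by simp
    qed (simp add: b(1))
  qed
qed

text \<open>Linearity over powers needs squares below 2^(length w), so this extension is meant for
  the certificates themselves; \<open>reducible_join\<close> has no such restriction and can be
  iterated. Since z has weight exactly \<open>v\<close>, terms of weight \<open>w\<close> all
  acquire the weight \<open>w @ v\<close>.\<close>

lemma reducible_shift:
  assumes "reducible (length w) w x" "exactly v z" "length x = length z"
  shows "reducible (length w) (w @ v) (shift (length w) z x)"
  using assms(1)
proof (rule reducibleE)
  let ?s = "length w"
  fix f assume f: "exactly w x" "f \<in> hitmod ?s w" "x \<in> f"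
    "\<And>y. y \<in> f \<Longrightarrow> y = x \<or> lower w y \<or> exactly w y \<and> length y = length x \<and> below (length w) y x"
  show ?thesis
  proof (rule reducibleI)
    show "shift ?s z ` {b \<in> f. length b = length z} \<in> hitmod ?s (w @ v)"
      using f(2) by (rule hitmod_shift)
    show "shift ?s z x \<in> shift ?s z ` {b \<in> f. length b = length z}"
      using f(3) assms(3) by blast
    show "exactly (w @ v) (shift ?s z x)"
      using assms(3) f(1) assms(2) by (rule exactly_shift)
    fix y assume "y \<in> shift ?s z ` {b \<in> f. length b = length z}"
    then obtain b where b: "y = shift ?s z b" "b \<in> f" "length b = length z" by blast
    from f(4)[OF b(2)]
    show "y = shift ?s z x \<or> lower (w @ v) y \<or> exactly (w @ v) y \<and>
      length y = length (shift ?s z x) \<and> below (length (w @ v)) y (shift ?s z x)"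
    proof (elim disjE)
      assume "lower w b"
      then show ?thesis using lower_shift[OF b(3)] b(1) by blast
    next
      assume b': "exactly w b \<and> length b = length x \<and> below (length w) b x"
      then have "exactly (w @ v) y"
        unfolding b(1) using exactly_shift[OF b(3) _ assms(2)] by blast
      moreover have "below (length (w @ v)) y (shift ?s z x)"
        unfolding b(1) length_append using b' f(1) b(3) assms(3) by (intro below_shift) blast+
      moreover have "length y = length (shift ?s z x)"
        unfolding b(1) using b(3) assms(3) by simp
      ultimately show ?thesis by blast
    qed (simp add: b(1))
  qed
qed

subsection \<open>The quotient and its dimension\<close>

definition relations :: "nat \<Rightarrow> nat list \<Rightarrow> poly set" where
  "relations k w = psum (hit k \<inter> Pplus k \<inter> Pw k w) (Pplus k \<inter> Pw_minus k w)"

definition positive :: "nat \<Rightarrow> mono \<Rightarrow> bool" where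
  "positive k x \<longleftrightarrow> length x = k \<and> (\<forall>j<k. 0 < x ! j)"

lemma Pplus_iff: "f \<in> Pplus k \<longleftrightarrow> finite f \<and> (\<forall>x\<in>f. positive k x)"
  by (auto simp: Pplus_def Pk_def positive_def)

lemma Pplus_Pw_iff:
  "f \<in> Pplus k \<inter> Pw k w \<longleftrightarrow>
    finite f \<and> (\<forall>x\<in>f. positive k x \<and> sum_list x = deg_w w \<and> (lower w x \<or> exactly w x))"
  by (auto simp: Pplus_iff Pw_def Pk_def positive_def wle_def lower_iff exactly_iff)

lemma Pplus_Pw_minus_iff:
  "f \<in> Pplus k \<inter> Pw_minus k w \<longleftrightarrow>
    finite f \<and> (\<forall>x\<in>f. positive k x \<and> sum_list x = deg_w w \<and> lower w x)"
  by (auto simp: Pplus_iff Pw_minus_def Pk_def positive_def lower_iff)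

lemma Pplus_padd: "p \<in> Pplus k \<Longrightarrow> q \<in> Pplus k \<Longrightarrow> padd p q \<in> Pplus k"
  unfolding Pplus_iff by (auto simp: padd_def)

lemma Pplus_Pw_padd:
  "p \<in> Pplus k \<inter> Pw k w \<Longrightarrow> q \<in> Pplus k \<inter> Pw k w \<Longrightarrow> padd p q \<in> Pplus k \<inter> Pw k w"
  unfolding Pplus_Pw_iff by (auto simp: padd_def)

lemma Pplus_Pw_minus_padd:
  "p \<in> Pplus k \<inter> Pw_minus k w \<Longrightarrow> q \<in> Pplus k \<inter> Pw_minus k w \<Longrightarrow>
    padd p q \<in> Pplus k \<inter> Pw_minus k w"
  unfolding Pplus_Pw_minus_iff by (auto simp: padd_def)

lemma hit_padd: "p \<in> hit k \<Longrightarrow> q \<in> hit k \<Longrightarrow> padd p q \<in> hit k"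
  unfolding hit_def by (rule f2span_padd)

section \<open>Projecting relations to positive monomials\<close>

definition positive_part :: "nat \<Rightarrow> nat \<Rightarrow> poly \<Rightarrow> poly" where
  "positive_part k d f = {x \<in> f. positive k x \<and> sum_list x = d}"

lemma positive_part_padd:
  "positive_part k d (padd f g) = padd (positive_part k d f) (positive_part k d g)"
  by (auto simp: positive_part_def padd_iff)

text \<open>A square changes no exponent from zero to nonzero or back and raises the degree by i, so
  its terms are either all kept or all discarded.\<close>

lemma positive_part_Sq_mono:
  "positive_part k d (Sq_mono i a) = (if positive k a \<and> sum_list a + i = d then Sq_mono i a else {})"
proof -
  have pos: "0 < m \<longleftrightarrow> 0 < n" if "sqstep n m" for n m
    using that by (cases n; cases m) (auto simp: sqstep_def)
  have "positive k x \<longleftrightarrow> positive k a" if "x \<in> Sq_mono i a" for x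
  proof -
    have "length x = length a" "\<And>j. j < length a \<Longrightarrow> 0 < x ! j \<longleftrightarrow> 0 < a ! j"
      using that pos by (auto simp: Sq_mono_iff_nth)
    then show ?thesis by (auto simp: positive_def)
  qed
  moreover have "sum_list x = sum_list a + i" if "x \<in> Sq_mono i a" for x
    using that by (simp add: Sq_mono_iff_nth)
  ultimately show ?thesis
    unfolding positive_part_def by (simp split: if_split) blast
qed

text \<open>The projection is linear and sends each generator of \<open>hitmod\<close> to a
  generator of the same kind or to zero, so sums of generators split accordingly.\<close>

lemma positive_part_hitmod:
  assumes "f \<in> hitmod s w"
  shows "\<exists>h l. positive_part k (deg_w w) f = padd h l \<and> h \<in> hit k \<inter> Pplus k \<and>
    l \<in> Pplus k \<inter> Pw_minus k w"
proof -
  let ?d = "deg_w w"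
  let ?C = "{f. \<exists>h l. positive_part k ?d f = padd h l \<and> h \<in> hit k \<inter> Pplus k \<and>
    l \<in> Pplus k \<inter> Pw_minus k w}"
  have hit0: "{} \<in> hit k \<inter> Pplus k" by (simp add: hit_def f2span.zero Pplus_iff)
  have low0: "{} \<in> Pplus k \<inter> Pw_minus k w" by (subst Pplus_Pw_minus_iff) simp
  have "f \<in> ?C"
    using assms unfolding hitmod_def
  proof (rule f2span_least)
    have "positive_part k ?d {} = padd {} {}" by (simp add: positive_part_def)
    then show "{} \<in> ?C" using hit0 low0 by blast
  next
    fix p q assume "p \<in> ?C" "q \<in> ?C"
    then obtain h l h' l' where *: "positive_part k ?d p = padd h l" "positive_part k ?d q = padd h' l'"
      "h \<in> hit k \<inter> Pplus k" "l \<in> Pplus k \<inter> Pw_minus k w"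
      "h' \<in> hit k \<inter> Pplus k" "l' \<in> Pplus k \<inter> Pw_minus k w" by blast
    have "positive_part k ?d (padd p q) = padd (padd h h') (padd l l')"
      by (simp add: positive_part_padd * padd_assoc padd_left_commute)
    moreover have "padd h h' \<in> hit k \<inter> Pplus k"
      using *(3,5) by (simp add: hit_padd Pplus_padd)
    moreover have "padd l l' \<in> Pplus k \<inter> Pw_minus k w"
      using *(4,6) by (rule Pplus_Pw_minus_padd)
    ultimately show "padd p q \<in> ?C" by blast
  next
    show "{Sq_mono i a |i a. 0 < i \<and> i < 2 ^ s} \<union> {{b} |b. lower w b} \<subseteq> ?C"
    proof (intro Un_least subsetI)
      fix h assume "h \<in> {Sq_mono i a |i a. 0 < i \<and> i < 2 ^ s}"
      then obtain i a where h: "h = Sq_mono i a" "0 < i" by blast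
      have "positive_part k ?d h \<in> hit k \<inter> Pplus k"
      proof (cases "positive k a \<and> sum_list a + i = ?d")
        case True
        then have part: "positive_part k ?d h = Sq_mono i a" by (simp add: h positive_part_Sq_mono)
        have "\<forall>x\<in>positive_part k ?d h. positive k x" by (simp add: positive_part_def)
        moreover have "Sq_mono i a \<in> hit k"
          unfolding hit_def using True h(2) by (intro f2span_superset) (auto simp: positive_def)
        ultimately show ?thesis by (simp add: part Pplus_iff finite_Sq_mono)
      next
        case False
        then have "positive_part k ?d h = {}" by (simp only: h(1) positive_part_Sq_mono if_False)
        then show ?thesis using hit0 by simp
      qed
      moreover have "positive_part k ?d h = padd (positive_part k ?d h) {}" by simp
      ultimately show "h \<in> ?C" using low0 by blast
    next
      fix h assume "h \<in> {{b} |b. lower w b}"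
      then have "positive_part k ?d h \<in> Pplus k \<inter> Pw_minus k w"
        unfolding Pplus_Pw_minus_iff by (auto simp: positive_part_def)
      moreover have "positive_part k ?d h = padd {} (positive_part k ?d h)" by simp
      ultimately show "h \<in> ?C" using hit0 by blast
    qed
  qed
  then show ?thesis by blast
qed

lemma positive_part_relations:
  assumes "f \<in> hitmod s w" "\<And>x. x \<in> f \<Longrightarrow> lower w x \<or> exactly w x"
  shows "positive_part k (deg_w w) f \<in> relations k w"
proof -
  let ?g = "positive_part k (deg_w w) f"
  obtain h l where hl: "?g = padd h l" "h \<in> hit k \<inter> Pplus k" "l \<in> Pplus k \<inter> Pw_minus k w"
    using positive_part_hitmod[OF assms(1)] by blast
  have fin: "finite h" "finite l" using hl(2,3) by (auto simp: Pplus_iff)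
  have "finite ?g" unfolding hl(1) using fin by (rule finite_padd)
  then have "?g \<in> Pplus k \<inter> Pw k w"
    unfolding Pplus_Pw_iff using assms(2) by (auto simp: positive_part_def)
  moreover have "l \<in> Pplus k \<inter> Pw k w"
    using hl(3) unfolding Pplus_Pw_iff Pplus_Pw_minus_iff by blast
  \<comment> \<open>The quotient admits a hit polynomial only if it lies in P_k(\<omega>) itself.
    This one does, as the sum of two polynomials that do.\<close>
  moreover have "h = padd l ?g"
    unfolding hl(1) by (simp add: padd_commute[of h])
  ultimately have "h \<in> Pplus k \<inter> Pw k w"
    using Pplus_Pw_padd by metis
  with hl show ?thesis unfolding relations_def psum_def by blast
qed

lemma lower_relations:
  assumes "positive k x" "sum_list x = deg_w w" "lower w x"
  shows "{x} \<in> relations k w"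
proof -
  have "{x} \<in> Pplus k \<inter> Pw_minus k w" using assms unfolding Pplus_Pw_minus_iff by simp
  moreover have "{} \<in> hit k \<inter> Pplus k \<inter> Pw k w"
    using Pplus_Pw_iff[of "{}" k w] by (simp add: hit_def f2span.zero)
  moreover have "{x} = padd {} {x}" by simp
  ultimately show ?thesis unfolding relations_def psum_def by blast
qed

text \<open>Rewriting: modulo relations a reducible monomial is a sum of monomials of smaller
  weight, which are relations themselves, and of earlier monomials of the same weight. Well-founded
  induction on \<open>below\<close> ends in \<open>T\<close>.\<close>

lemma span_irreducible:
  assumes "\<And>x. positive k x \<Longrightarrow> exactly w x \<Longrightarrow> x \<in> T \<or> (\<exists>s. reducible s w x)"
  shows "Pplus k \<inter> Pw k w \<subseteq> f2span ((\<lambda>t. {t}) ` T \<union> relations k w)"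
proof
  let ?G = "(\<lambda>t. {t}) ` T \<union> relations k w"
  have low: "{x} \<in> f2span ?G" if "positive k x" "sum_list x = deg_w w" "lower w x" for x
    using lower_relations[OF that] by (intro f2span_superset) simp
  have top: "{x} \<in> f2span ?G" if "positive k x" "exactly w x" for x
    using wf_below[of "length w"] that
  proof (induction x rule: wf_induct_rule)
    case (less x)
    show ?case
    proof (cases "x \<in> T")
      case True
      then show ?thesis by (intro f2span_superset) simp
    next
      case False
      then obtain s f where f: "f \<in> hitmod s w" "x \<in> f"
        "\<And>y. y \<in> f \<Longrightarrow> y = x \<or> lower w y \<or> exactly w y \<and> length y = length x \<and> below (length w) y x"
        using assms[OF less.prems] unfolding reducible_def by blast
      define g where "g = positive_part k (deg_w w) f"
      have "g \<in> relations k w"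
        unfolding g_def using f less.prems by (intro positive_part_relations) blast+
      then have g: "g \<in> f2span ?G" by (intro f2span_superset) simp
      have "finite g"
        using \<open>g \<in> relations k w\<close> unfolding relations_def psum_def Pplus_iff
        by (auto simp: Pplus_iff intro: finite_padd)
      then have "finite (g - {x})" by simp
      then have "g - {x} \<in> f2span ?G"
      proof (rule f2span_singletons)
        fix y assume "y \<in> g - {x}"
        then have y: "y \<in> f" "y \<noteq> x" "positive k y" "sum_list y = deg_w w"
          by (auto simp: g_def positive_part_def)
        then show "{y} \<in> f2span ?G"
          using f(3)[of y] low less.IH[of y] by blast
      qed
      with g have "padd g (g - {x}) \<in> f2span ?G" by (rule f2span_padd)
      moreover have "x \<in> g"
        using f(2) less.prems exactly_sum_list by (simp add: g_def positive_part_def)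
      then have "padd g (g - {x}) = {x}" by (auto simp: padd_def)
      ultimately show ?thesis by simp
    qed
  qed
  fix f assume "f \<in> Pplus k \<inter> Pw k w"
  then have "finite f" "\<And>x. x \<in> f \<Longrightarrow> {x} \<in> f2span ?G"
    unfolding Pplus_Pw_iff using low top by blast+
  then show "f \<in> f2span ?G" by (rule f2span_singletons)
qed

section \<open>Lower bound for the size of spanning sets\<close>

lemma f2span_insert: "f2span (insert x X) \<subseteq> f2span X \<union> padd x ` f2span X"
proof
  fix p assume "p \<in> f2span (insert x X)"
  then show "p \<in> f2span X \<union> padd x ` f2span X"
  proof induction
    case (add p s)
    consider "p \<in> f2span X" "s = x" | "p \<in> f2span X" "s \<in> X"
      | q where "p = padd x q" "q \<in> f2span X" "s = x" | q where "p = padd x q" "q \<in> f2span X" "s \<in> X"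
      using add by blast
    then show ?case
    proof cases
      case 1
      then show ?thesis by (auto simp: padd_commute[of p])
    next
      case 3
      then show ?thesis by (simp add: padd_commute[of "padd x q"])
    qed (auto simp: padd_assoc intro: f2span.add)
  qed (simp add: f2span.zero)
qed

text \<open>This count takes the place of dimension theory. Each further generator at most doubles
  the span.\<close>

lemma card_f2span: "finite X \<Longrightarrow> finite (f2span X) \<and> card (f2span X) \<le> 2 ^ card X"
proof (induction X rule: finite_induct)
  case empty
  have "f2span {} \<subseteq> {{}}"
  proof
    fix p show "p \<in> f2span {} \<Longrightarrow> p \<in> {{}}" by (induction rule: f2span.induct) auto
  qed
  then show ?case using card_mono[of "{{}}" "f2span {}"] finite_subset[of "f2span {}" "{{}}"] by simp
next
  case (insert x X)
  let ?R = "f2span X \<union> padd x ` f2span X"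
  have fin: "finite ?R" using insert.IH by simp
  have "card (f2span (insert x X)) \<le> card ?R"
    using f2span_insert fin by (rule card_mono[rotated])
  also have "\<dots> \<le> card (f2span X) + card (padd x ` f2span X)" by (rule card_Un_le)
  also have "card (padd x ` f2span X) \<le> card (f2span X)" using insert.IH by (simp add: card_image_le)
  finally show ?case using insert finite_subset[OF f2span_insert fin] by simp
qed

text \<open>Evaluating on the functionals \<open>S t\<close> separates the subsets of \<open>T\<close>, so the \<open>2\<close>-power
  \<open>2 ^ card T\<close> is at most the number of combinations of any spanning set.\<close>

lemma card_le_spanning:
  assumes T: "finite T" "Pow T \<subseteq> V"
    and S: "\<And>t. t \<in> T \<Longrightarrow> t \<in> S t"
      "\<And>t x. t \<in> T \<Longrightarrow> x \<in> T \<Longrightarrow> x \<in> S t \<Longrightarrow> x = t \<or> below s x t"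
    and U: "\<And>u t. u \<in> U \<Longrightarrow> t \<in> T \<Longrightarrow> finite u \<and> even (card (u \<inter> S t))"
    and B: "finite B" "\<And>b. b \<in> B \<Longrightarrow> finite b" "V \<subseteq> f2span (B \<union> U)"
  shows "card T \<le> card B"
proof (cases "T = {}")
  case False
  then obtain t0 where t0: "t0 \<in> T" by blast
  define \<Phi> where "\<Phi> f = {t \<in> T. odd (card (f \<inter> S t))}" for f
  have \<Phi>_padd: "\<Phi> (padd f g) = padd (\<Phi> f) (\<Phi> g)" if "finite f" "finite g" for f g
  proof -
    have "padd f g \<inter> S t = padd (f \<inter> S t) (g \<inter> S t)" for t by (auto simp: padd_iff)
    then show ?thesis using that by (auto simp: \<Phi>_def padd_iff odd_card_padd)
  qed
  have span: "finite f \<and> \<Phi> f \<in> f2span (\<Phi> ` B)" if "f \<in> f2span (B \<union> U)" for f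
    using that
  proof induction
    case zero
    then show ?case by (simp add: \<Phi>_def f2span.zero)
  next
    case (add p u)
    show ?case
    proof (cases "u \<in> B")
      case True
      then have "\<Phi> (padd p u) = padd (\<Phi> p) (\<Phi> u)" "finite (padd p u)"
        using add.IH B(2) \<Phi>_padd finite_padd by blast+
      then show ?thesis using add.IH True f2span.add[of "\<Phi> p" _ "\<Phi> u"] by simp
    next
      case False
      with add.hyps have u: "u \<in> U" by blast
      then have "\<Phi> u = {}" "finite u" using U t0 by (auto simp: \<Phi>_def)
      then show ?thesis using add.IH \<Phi>_padd[of p u] finite_padd[of p u] by simp
    qed
  qed
  have "inj_on \<Phi> (Pow T)"
  proof (rule inj_onI, rule ccontr)
    fix X Y assume XY: "X \<in> Pow T" "Y \<in> Pow T" "\<Phi> X = \<Phi> Y" "X \<noteq> Y"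
    have fin: "finite X" "finite Y" using XY(1,2) T(1) by (auto intro: finite_subset)
    have empty: "\<Phi> (padd X Y) = {}" using XY(3) by (auto simp: \<Phi>_padd[OF fin] padd_iff)
    have "padd X Y \<noteq> {}" using XY(4) padd_cancel[of X Y] by force
    then obtain t0 where "t0 \<in> padd X Y" by blast
    \<comment> \<open>Triangularity: the other elements of \<open>T\<close> in \<open>S t\<close>
      are below t, so for a minimal t in the difference of X and Y the functional of t meets this
      difference in t alone and takes the value 1.\<close>
    from wf_below[of s] this obtain t where t: "t \<in> padd X Y"
      and min: "\<And>x. (x, t) \<in> {(x, y). below s x y} \<Longrightarrow> x \<notin> padd X Y"
      by (rule wfE_min) blast
    have sub: "padd X Y \<subseteq> T" using XY(1,2) by (auto simp: padd_def)
    have "x = t" if "x \<in> padd X Y" "x \<in> S t" for x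
      using S(2)[of t x] min[of x] that t sub by auto
    moreover have "t \<in> S t" using S(1) t sub by blast
    ultimately have "padd X Y \<inter> S t = {t}" using t by auto
    then have "t \<in> \<Phi> (padd X Y)" using t sub by (auto simp: \<Phi>_def)
    with empty show False by simp
  qed
  then have "2 ^ card T = card (\<Phi> ` Pow T)" using T(1) by (simp add: card_image card_Pow)
  also have "\<dots> \<le> card (f2span (\<Phi> ` B))"
  proof (rule card_mono)
    show "finite (f2span (\<Phi> ` B))" using B(1) card_f2span by blast
    show "\<Phi> ` Pow T \<subseteq> f2span (\<Phi> ` B)" using T(2) B(3) span by blast
  qed
  also have "\<dots> \<le> 2 ^ card (\<Phi> ` B)" using B(1) card_f2span by blast
  also have "\<dots> \<le> 2 ^ card B" using B(1) by (simp add: card_image_le)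
  finally show ?thesis by simp
qed simp

text \<open>For a finite S, the sum of the dual basis vectors of its elements is an element of the
  dual module killed by the dual action of every Sq^i with i > 0.\<close>

definition annihilating :: "poly \<Rightarrow> bool" where
  "annihilating S \<longleftrightarrow> (\<forall>i a. 0 < i \<longrightarrow> even (card (Sq_mono i a \<inter> S)))"

lemma annihilating_hit:
  assumes "annihilating S" "h \<in> hit k"
  shows "finite h \<and> even (card (h \<inter> S))"
  using assms(2) unfolding hit_def
proof induction
  case (add p s)
  have "padd p s \<inter> S = padd (p \<inter> S) (s \<inter> S)" by (auto simp: padd_iff)
  moreover have "finite s" "even (card (s \<inter> S))"
    using add.hyps(2) assms(1) finite_Sq_mono by (auto simp: annihilating_def)
  ultimately show ?case using add.IH odd_card_padd[of "p \<inter> S" "s \<inter> S"] by (simp add: finite_padd)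
qed simp

text \<open>The summand of smaller weight misses S altogether, so the parity is that of the hit
  summand.\<close>

lemma annihilating_relations:
  assumes "annihilating S" "\<And>x. x \<in> S \<Longrightarrow> \<not> lower w x" "u \<in> relations k w"
  shows "finite u \<and> even (card (u \<inter> S))"
proof -
  obtain h l where u: "u = padd h l" "h \<in> hit k" "l \<in> Pplus k \<inter> Pw_minus k w"
    using assms(3) by (auto simp: relations_def psum_def)
  have "l \<inter> S = {}" "finite l" using u(3) assms(2) unfolding Pplus_Pw_minus_iff by blast+
  moreover from this have "u \<inter> S = h \<inter> S" unfolding u(1) by (auto simp: padd_iff)
  ultimately show ?thesis
    using annihilating_hit[OF assms(1) u(2)] by (simp add: u(1) finite_padd)
qed

text \<open>\<open>T\<close> holds normal forms, to which all other monomials reduce;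
  \<open>T'\<close> holds the largest monomials of the functionals. The sets may differ. As
  \<open>quot_dim\<close> is a minimum over spanning sets, a spanning set from \<open>T\<close> has
  to be compared with an arbitrary one, and \<open>n\<close> is where both estimates meet.\<close>

lemma dim_QPplus_eqI:
  assumes upper: "finite T" "card T \<le> n" "\<And>t. t \<in> T \<Longrightarrow> positive k t \<and> exactly w t"
      "\<And>x. positive k x \<Longrightarrow> exactly w x \<Longrightarrow> x \<in> T \<or> (\<exists>s. reducible s w x)"
    and lower: "finite T'" "n \<le> card T'" "\<And>t. t \<in> T' \<Longrightarrow> positive k t \<and> exactly w t"
      "\<And>t. t \<in> T' \<Longrightarrow> \<exists>S. annihilating S \<and> t \<in> S \<and> (\<forall>x\<in>S. \<not> lower w x \<and> (x \<in> T' \<longrightarrow> x = t \<or> below s x t))"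
  shows "dim_QPplus k w = n"
proof -
  let ?V = "Pplus k \<inter> Pw k w"
  have bound: "n \<le> card B" if B: "finite B" "B \<subseteq> ?V" "?V \<subseteq> f2span (B \<union> relations k w)" for B
  proof -
    obtain S where S: "\<And>t. t \<in> T' \<Longrightarrow> annihilating (S t) \<and> t \<in> S t \<and>
        (\<forall>x\<in>S t. \<not> lower w x \<and> (x \<in> T' \<longrightarrow> x = t \<or> below s x t))"
      using lower(4) by metis
    have "Pow T' \<subseteq> ?V"
    proof
      fix X assume "X \<in> Pow T'"
      then have "finite X" "\<And>x. x \<in> X \<Longrightarrow> positive k x \<and> exactly w x"
        using lower(1,3) finite_subset by auto
      then show "X \<in> ?V" unfolding Pplus_Pw_iff using exactly_sum_list by blast
    qed
    moreover have "\<And>b. b \<in> B \<Longrightarrow> finite b" using B(2) by (auto simp: Pplus_iff)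
    moreover have "finite u \<and> even (card (u \<inter> S t))" if "u \<in> relations k w" "t \<in> T'" for u t
      using annihilating_relations[of "S t" w u k] S that by blast
    ultimately have "card T' \<le> card B"
      using card_le_spanning[of T' ?V S s "relations k w" B] S B(1,3) lower(1) by blast
    with lower(2) show ?thesis by simp
  qed
  let ?B = "(\<lambda>t. {t}) ` T"
  have "?B \<subseteq> ?V"
  proof
    fix b assume "b \<in> ?B"
    then obtain t where "b = {t}" "positive k t" "exactly w t" using upper(3) by blast
    then show "b \<in> ?V" unfolding Pplus_Pw_iff using exactly_sum_list by simp
  qed
  moreover have span: "?V \<subseteq> f2span (?B \<union> relations k w)"
    using upper(4) by (rule span_irreducible)
  \<comment> \<open>The lower bound applies to this spanning set as well and rules out fewer than
    \<open>n\<close> elements.\<close>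
  moreover have "card ?B = n"
    using bound[of ?B] calculation upper(1,2) card_image_le[of T "\<lambda>t. {t}"] by simp
  ultimately show ?thesis
    unfolding dim_QPplus_def quot_dim_def relations_def[symmetric]
    using bound upper(1) by (intro Least_equality) (blast intro: finite_imageI)+
qed

subsection \<open>Checkable certificates\<close>

text \<open>The Cartan formula distributes i over the variables; \<open>r\<close> is the share of
  the first one.\<close>

fun sqs :: "mono \<Rightarrow> nat \<Rightarrow> mono list" where
  "sqs [] i = (if i = 0 then [[]] else [])"
| "sqs (n # a) i =
    concat (map (\<lambda>r. if odd (n choose r) then map ((#) (n + r)) (sqs a (i - r)) else []) [0..<Suc i])"

lemma set_sqs: "set (sqs a i) = Sq_mono i a"
proof (induction a arbitrary: i)
  case (Cons n a)
  show ?case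
  proof (intro set_eqI iffI)
    fix b assume "b \<in> set (sqs (n # a) i)"
    then obtain r c where "r \<le> i" "odd (n choose r)" "b = (n + r) # c" "c \<in> Sq_mono (i - r) a"
      by (auto simp: Cons.IH split: if_splits)
    then show "b \<in> Sq_mono i (n # a)" by (auto simp: Sq_mono_iff sqstep_def)
  next
    fix b assume "b \<in> Sq_mono i (n # a)"
    then obtain m c where b: "b = m # c" "sqstep n m" "list_all2 sqstep a c" "m + sum_list c = n + sum_list a + i"
      by (auto simp: Sq_mono_iff list_all2_Cons1)
    have "sum_list a \<le> sum_list c"
      using list_all2_mono[OF b(3), of "(\<le>)"] sqstep_le sum_list_mono_nat by blast
    then have "m = n + (m - n)" "m - n \<le> i" "odd (n choose (m - n))" "c \<in> Sq_mono (i - (m - n)) a"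
      using b by (auto simp: Sq_mono_iff sqstep_def)
    then show "b \<in> set (sqs (n # a) i)"
      unfolding b(1) by (auto simp: Cons.IH less_Suc_eq_le intro!: bexI[of _ "m - n"])
  qed
qed (auto simp: Sq_mono_iff)

lemma distinct_sqs: "distinct (sqs a i)"
proof (induction a arbitrary: i)
  case (Cons n a)
  have "distinct (concat (map (\<lambda>r. if odd (n choose r) then map ((#) (n + r)) (sqs a (i - r)) else []) rs))"
    if "distinct rs" for rs
    using that
  proof (induction rs)
    case (Cons r rs)
    then show ?case
      using \<open>\<And>i. distinct (sqs a i)\<close> by (auto simp: distinct_map split: if_splits)
  qed simp
  then show ?case by (simp del: upt_Suc)
qed simp

fun even_count :: "'a \<Rightarrow> 'a list \<Rightarrow> bool" where
  "even_count y [] = True"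
| "even_count y (z # zs) = (if z = y then \<not> even_count y zs else even_count y zs)"

lemma even_count_append: "even_count y (xs @ zs) \<longleftrightarrow> (even_count y xs \<longleftrightarrow> even_count y zs)"
  by (induction xs) auto

lemma even_count_distinct: "distinct xs \<Longrightarrow> even_count y xs \<longleftrightarrow> y \<notin> set xs"
  by (induction xs) auto

text \<open>No list \<open>sqs a i\<close> repeats a monomial, so the parity of the occurrences in
  the concatenation is the coefficient in the sum of the squares.\<close>

lemma odd_count_sum_hitmod:
  assumes "\<And>i a. (i, a) \<in> set gs \<Longrightarrow> 0 < i \<and> i < 2 ^ s"
  shows "{y. \<not> even_count y (concat (map (\<lambda>(i, a). sqs a i) gs))} \<in> hitmod s w"
  using assms
proof (induction gs)
  case (Cons g gs)
  obtain i a where g: "g = (i, a)" by (cases g)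
  let ?L = "concat (map (\<lambda>(i, a). sqs a i) gs)"
  have "{y. \<not> even_count y (sqs a i @ ?L)} = padd (Sq_mono i a) {y. \<not> even_count y ?L}"
    by (auto simp: padd_iff even_count_append even_count_distinct distinct_sqs set_sqs)
  moreover have "Sq_mono i a \<in> hitmod s w" using Cons.prems[of i a] by (intro hitmod_Sq) (auto simp: g)
  moreover have "{y. \<not> even_count y ?L} \<in> hitmod s w" using Cons by auto
  ultimately show ?case by (simp add: g hitmod_padd)
qed (simp add: hitmod_zero)

fun list_less :: "nat list \<Rightarrow> nat list \<Rightarrow> bool" where
  "list_less (a # x) (b # y) = (if a = b then list_less x y else a < b)"
| "list_less _ _ = False"

text \<open>\<open>below\<close> in evaluable form: the comparison stops at the first block of
  digits that differs, and the length of the weight list says how many blocks there are.\<close>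

fun weight_less :: "nat list \<Rightarrow> mono \<Rightarrow> mono \<Rightarrow> bool" where
  "weight_less [] x y = False"
| "weight_less (r # w) x y =
    (if bits x = bits y then weight_less w (halve x) (halve y) else list_less (bits x) (bits y))"

lemma list_less_lex: "list_less x y \<Longrightarrow> length x = length y \<Longrightarrow> (x, y) \<in> lex less_than"
  by (induction x y rule: list_less.induct) (auto split: if_splits)

lemma length_bitseq: "length (bitseq s x) = s * length x"
  by (induction s arbitrary: x) simp_all

lemma weight_less_below: "weight_less w x y \<Longrightarrow> length x = length y \<Longrightarrow> below (length w) x y"
proof (induction w x y rule: weight_less.induct)
  case (2 r w x y)
  show ?case
  proof (cases "bits x = bits y")
    case True
    with 2 show ?thesis by (simp add: below_def lex_append_leftI)
  next
    case False
    with 2 have "(bits x, bits y) \<in> lex less_than" by (intro list_less_lex) simp_all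
    then show ?thesis
      using 2(3) by (simp add: below_def lex_append_rightI length_bitseq)
  qed
qed simp

text \<open>The squares listed in \<open>gs\<close> add up to a relation with largest monomial x.
  Counting parities is the expensive test; placed last, it is reached only by terms that have to
  cancel.\<close>

definition certifies :: "nat list \<Rightarrow> mono \<Rightarrow> (nat \<times> mono) list \<Rightarrow> bool" where
  "certifies w x gs \<longleftrightarrow> length x = 5 \<and> exactly w x \<and>
    list_all (\<lambda>(i, a). 0 < i \<and> i < 2 ^ length w \<and> length a = 5) gs \<and>
    (let L = concat (map (\<lambda>(i, a). sqs a i) gs) in \<not> even_count x L \<and>
      list_all (\<lambda>y. lower w y \<or> y = x \<or> exactly w y \<and> weight_less w y x \<or> even_count y L) L)"

lemma even_count_notin: "y \<notin> set xs \<Longrightarrow> even_count y xs"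
  by (induction xs) auto

lemma certifies_reducible:
  assumes "certifies w x gs"
  shows "reducible (length w) w x"
proof -
  define L where "L = concat (map (\<lambda>(i, a). sqs a i) gs)"
  have gs: "0 < i \<and> i < 2 ^ length w \<and> length a = 5" if "(i, a) \<in> set gs" for i a
    using assms that by (auto simp: certifies_def list_all_iff)
  have x: "length x = 5" "exactly w x" "\<not> even_count x L"
    using assms by (simp_all add: certifies_def L_def Let_def)
  have L: "lower w y \<or> y = x \<or> exactly w y \<and> weight_less w y x \<or> even_count y L" if "y \<in> set L" for y
    using assms that unfolding certifies_def L_def[symmetric] Let_def list_all_iff by blast
  have len: "length y = 5" if "y \<in> set L" for y
    using that gs by (auto simp: L_def set_sqs Sq_mono_iff_nth)
  show ?thesis
  proof (rule reducibleI)
    show "{y. \<not> even_count y L} \<in> hitmod (length w) w"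
      unfolding L_def using gs by (intro odd_count_sum_hitmod) blast
    fix y assume "y \<in> {y. \<not> even_count y L}"
    then have y: "y \<in> set L" "\<not> even_count y L" using even_count_notin[of y L] by auto
    then show "y = x \<or> lower w y \<or> exactly w y \<and> length y = length x \<and> below (length w) y x"
      using L[OF y(1)] len[OF y(1)] x(1) weight_less_below[of w y x] by auto
  qed (use x in simp_all)
qed

section \<open>Enumerating the irreducible monomials\<close>

fun masks :: "nat \<Rightarrow> nat \<Rightarrow> nat list list" where
  "masks 0 r = (if r = 0 then [[]] else [])"
| "masks (Suc k) r = map ((#) 0) (masks k r) @ (if r = 0 then [] else map ((#) 1) (masks k (r - 1)))"

lemma in_masks: "set e \<subseteq> {0, 1} \<Longrightarrow> e \<in> set (masks (length e) (sum_list e))"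
  by (induction e) auto

definition low_part :: "nat \<Rightarrow> mono \<Rightarrow> mono" where "low_part s x = map (\<lambda>n. n mod 2 ^ s) x"

definition high_part :: "nat \<Rightarrow> mono \<Rightarrow> mono" where "high_part s x = map (\<lambda>n. n div 2 ^ s) x"

lemma shift_low_high: "shift s (high_part s x) (low_part s x) = x"
  by (rule nth_equalityI) (simp_all add: low_part_def high_part_def)

lemma exactly_high_part: "exactly (u @ v) x \<Longrightarrow> exactly v (high_part (length u) x)"
proof (induction u arbitrary: x)
  case (Cons r u)
  have "high_part (length (r # u)) x = high_part (length u) (halve x)"
    by (simp add: high_part_def halve_def div_mult2_eq)
  with Cons show ?case by simp
qed (simp add: high_part_def)

type_synonym rule_set = "(nat list \<times> mono list) list"

fun is_prefix :: "'a list \<Rightarrow> 'a list \<Rightarrow> bool" where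
  "is_prefix [] ys = True"
| "is_prefix (x # xs) [] = False"
| "is_prefix (x # xs) (y # ys) = (x = y \<and> is_prefix xs ys)"

lemma is_prefix_iff: "is_prefix xs ys \<longleftrightarrow> (\<exists>zs. ys = xs @ zs)"
  by (induction xs ys rule: is_prefix.induct) auto

text \<open>Monomials grow from the highest digit downwards. Only irreducible monomials are
  extended, because a reducible \<open>halve x\<close> makes x reducible; afterwards the rules whose
  weight is a prefix of the current one are matched against the lowest digits. Zero exponents are
  kept, as the higher digits of a positive monomial may vanish.\<close>

fun irreducibles :: "rule_set \<Rightarrow> nat list \<Rightarrow> mono list" where
  "irreducibles R [] = [[0, 0, 0, 0, 0]]"
| "irreducibles R (r # w) =
    (let Q = filter (\<lambda>(u, L). is_prefix u (r # w)) R in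
      filter (\<lambda>x. list_all (\<lambda>(u, L). low_part (length u) x \<notin> set L) Q)
        (concat (map (\<lambda>e. map (join e) (irreducibles R w)) (masks 5 r))))"

text \<open>There are two reasons for discarding x, one for each direction of extension: a reducible
  \<open>halve x\<close> is treated by \<open>reducible_join\<close>, a rule that matches the low
  digits by \<open>reducible_shift\<close> with the high digits of x as z.\<close>

lemma irreducibles_complete:
  assumes R: "\<And>u L l. (u, L) \<in> set R \<Longrightarrow> l \<in> set L \<Longrightarrow> reducible (length u) u l"
    and "exactly w x" "length x = 5"
  shows "x \<in> set (irreducibles R w) \<or> (\<exists>s. reducible s w x)"
  using assms(2,3)
proof (induction w arbitrary: x)
  case Nil
  then have "x = replicate 5 0"
    by (intro nth_equalityI) auto
  then show ?case by (simp add: numeral_eq_Suc)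
next
  case (Cons r w)
  let ?Q = "filter (\<lambda>(u, L). is_prefix u (r # w)) R"
  have x: "x = join (bits x) (halve x)" by (rule join_bits_halve[symmetric])
  have e: "bits x \<in> set (masks 5 r)"
    using in_masks[OF set_bits, of x] Cons.prems by simp
  from Cons.IH[of "halve x"] Cons.prems
  consider "halve x \<in> set (irreducibles R w)" | s where "reducible s w (halve x)" by auto
  then show ?case
  proof cases
    case 1
    show ?thesis
    proof (cases "list_all (\<lambda>(u, L). low_part (length u) x \<notin> set L) ?Q")
      case True
      have "x \<in> set (concat (map (\<lambda>e. map (join e) (irreducibles R w)) (masks 5 r)))"
        using x e 1 by auto
      with True show ?thesis by (simp only: irreducibles.simps Let_def set_filter) simp
    next
      case False
      then obtain u L v where u: "(u, L) \<in> set R" "r # w = u @ v" "low_part (length u) x \<in> set L"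
        by (auto simp: list_all_iff is_prefix_iff)
      have "exactly v (high_part (length u) x)"
        using Cons.prems(1) unfolding u(2) by (rule exactly_high_part)
      then have "reducible (length u) (r # w) x"
        using reducible_shift[OF R[OF u(1,3)], of v "high_part (length u) x"]
        unfolding u(2) shift_low_high by (simp add: low_part_def high_part_def)
      then show ?thesis by blast
    qed
  next
    case (2 s)
    have "reducible (Suc s) (sum_list (bits x) # w) (join (bits x) (halve x))"
      using 2 set_bits by (rule reducible_join) simp
    with x Cons.prems(1) show ?thesis by auto
  qed
qed

subsection \<open>Permuting the variables\<close>

definition permute :: "nat list \<Rightarrow> mono \<Rightarrow> mono" where "permute p a = map ((!) a) p"

text \<open>A form that can be evaluated on literals: five entries that include five different
  values leave no room for a repetition.\<close>

definition is_perm :: "nat list \<Rightarrow> bool" where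
  "is_perm p \<longleftrightarrow> length p = 5 \<and> 0 \<in> set p \<and> 1 \<in> set p \<and> 2 \<in> set p \<and> 3 \<in> set p \<and> 4 \<in> set p"

lemma is_perm_set: "is_perm p \<Longrightarrow> set p = {0..<5}"
  and is_perm_distinct: "is_perm p \<Longrightarrow> distinct p"
proof -
  assume p: "is_perm p"
  have "{0..<5} = {0, 1, 2, 3, 4 :: nat}" by auto
  then have "{0..<5} \<subseteq> set p" using p by (simp add: is_perm_def)
  moreover have "card (set p) \<le> 5" using p card_length[of p] by (simp add: is_perm_def)
  ultimately show eq: "set p = {0..<5}" by (metis List.finite_set card_atLeastLessThan card_seteq diff_zero)
  then show "distinct p" using p by (intro card_distinct) (simp add: is_perm_def)
qed

lemma mset_permute: "is_perm p \<Longrightarrow> length a = 5 \<Longrightarrow> mset (permute p a) = mset a"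
proof -
  assume p: "is_perm p" and a: "length a = 5"
  have "mset p = mset [0..<5]"
    using is_perm_set[OF p] mset_set_set[OF is_perm_distinct[OF p]] by simp
  then have "mset (permute p a) = mset (map ((!) a) [0..<5])" by (simp add: permute_def)
  moreover have "map ((!) a) [0..<5] = a" using map_nth[of a] a by simp
  ultimately show ?thesis by (simp only:)
qed

text \<open>Every weight is a sum over the variables and hence depends only on the multiset of
  exponents.\<close>

lemma weight_mset:
  "mset x = mset y \<Longrightarrow> (exactly w x \<longleftrightarrow> exactly w y) \<and> (lower w x \<longleftrightarrow> lower w y)"
proof (induction w arbitrary: x y)
  case Nil
  then have "sum_list x = sum_list y" by (metis sum_mset_sum_list)
  then show ?case by simp
next
  case (Cons r w)
  have "mset (bits x) = mset (bits y)" using Cons.prems by (simp add: bits_def)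
  then have "sum_list (bits x) = sum_list (bits y)" by (metis sum_mset_sum_list)
  moreover have "mset (halve x) = mset (halve y)" using Cons.prems by (simp add: halve_def)
  ultimately show ?case using Cons.IH[of "halve x" "halve y"] by simp
qed

text \<open>Annihilation is tested on all monomials, so each of them has to be pulled back along the
  permutation.\<close>

lemma permute_surj:
  assumes "is_perm p" "length c = 5"
  obtains a where "length a = 5" "c = permute p a"
proof
  note p = is_perm_set[OF assms(1)] is_perm_distinct[OF assms(1)]
  have len: "length p = 5" using assms(1) by (simp add: is_perm_def)
  define q where "q j = (THE i. i < 5 \<and> p ! i = j)" for j
  have q: "q (p ! i) = i" if "i < 5" for i
    unfolding q_def
  proof (rule the_equality)
    fix k assume "k < 5 \<and> p ! k = p ! i"
    then show "k = i" using nth_eq_iff_index_eq[OF p(2), of k i] that len by simp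
  qed (use that in simp)
  show "length (map (\<lambda>j. c ! q j) [0..<5]) = 5" by simp
  show "c = permute p (map (\<lambda>j. c ! q j) [0..<5])"
  proof (rule nth_equalityI)
    fix i assume "i < length c"
    then have i: "i < 5" using assms(2) by simp
    then have "p ! i < 5" using p(1) nth_mem[of i p] len by simp
    then show "c ! i = permute p (map (\<lambda>j. c ! q j) [0..<5]) ! i"
      using q[OF i] i len by (simp add: permute_def)
  qed (simp add: permute_def assms(2) len)
qed

lemma permute_inj: "is_perm p \<Longrightarrow> inj_on (permute p) {a. length a = 5}"
proof (intro inj_onI nth_equalityI)
  fix a b j assume *: "is_perm p" "permute p a = permute p b" "a \<in> {a. length a = 5}" "b \<in> {a. length a = 5}" "j < length a"
  then have "j \<in> set p" using is_perm_set by simp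
  with *(2) show "a ! j = b ! j" by (simp add: permute_def)
qed simp

lemma permute_Sq_mono:
  assumes "is_perm p" "length a = 5" "length b = 5"
  shows "permute p b \<in> Sq_mono i (permute p a) \<longleftrightarrow> b \<in> Sq_mono i a"
proof -
  have "list_all2 sqstep (permute p a) (permute p b) \<longleftrightarrow> (\<forall>j\<in>set p. sqstep (a ! j) (b ! j))"
    by (simp add: permute_def list_all2_map1 list_all2_map2 list_all2_same)
  also have "\<dots> \<longleftrightarrow> list_all2 sqstep a b"
    using is_perm_set[OF assms(1)] assms(2,3) by (auto simp: list_all2_conv_all_nth)
  finally have "list_all2 sqstep (permute p a) (permute p b) \<longleftrightarrow> list_all2 sqstep a b" .
  moreover have "sum_list (permute p x) = sum_list x" if "length x = 5" for x
    using mset_permute[OF assms(1) that] by (metis sum_mset_sum_list)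
  ultimately show ?thesis using assms by (simp add: Sq_mono_iff)
qed

text \<open>Squares commute with permutations of the variables. The order on monomials is not
  invariant, so the largest element of a permuted set has to be determined afresh.\<close>

lemma annihilating_permute:
  assumes "annihilating S" "is_perm p" "\<And>x. x \<in> S \<Longrightarrow> length x = 5"
  shows "annihilating (permute p ` S)"
  unfolding annihilating_def
proof (intro allI impI)
  fix i :: nat and c assume i: "0 < i"
  show "even (card (Sq_mono i c \<inter> permute p ` S))"
  proof (cases "length c = 5")
    case True
    with assms(2) obtain a where a: "length a = 5" "c = permute p a" by (rule permute_surj)
    have "Sq_mono i c \<inter> permute p ` S = permute p ` (Sq_mono i a \<inter> S)"
      unfolding a(2) using permute_Sq_mono[OF assms(2) a(1)] assms(3) by auto
    moreover have "inj_on (permute p) (Sq_mono i a \<inter> S)"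
      by (rule inj_on_subset[OF permute_inj[OF assms(2)]]) (use assms(3) in auto)
    ultimately show ?thesis
      using assms(1) i by (simp add: card_image annihilating_def)
  next
    case False
    have "length (permute p x) = 5" for x using assms(2) by (simp add: permute_def is_perm_def)
    with False have "Sq_mono i c \<inter> permute p ` S = {}" by (auto simp: Sq_mono_iff_nth)
    then show ?thesis by simp
  qed
qed

subsection \<open>Checking annihilating sets\<close>

definition tails :: "(nat \<Rightarrow> bool) \<Rightarrow> mono list \<Rightarrow> mono list" where
  "tails P bs = map tl (filter (\<lambda>b. P (hd b)) bs)"

text \<open>\<open>dual_even k E L\<close> runs through all monomials \<open>a\<close> in \<open>k\<close> variables with exponents below
  \<open>16\<close>, one variable at a time: \<open>L\<close> holds the remainders of those elements of a set whose first
  exponents are reached from, but not equal to, those of \<open>a\<close>, and \<open>E\<close> the ones where they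
  are still equal.\<close>

fun dual_even :: "nat \<Rightarrow> mono list \<Rightarrow> mono list \<Rightarrow> bool" where
  "dual_even 0 E L = even (length L)"
| "dual_even (Suc k) E L = (if E = [] \<and> L = [] then True else
    list_all (\<lambda>v. dual_even k (tails (\<lambda>n. n = v) E)
      (tails (\<lambda>n. n \<noteq> v \<and> sqstep v n) E @ tails (sqstep v) L)) [0..<16])"

lemma length_filter_tails:
  "length (filter Q (tails P bs)) = length (filter (\<lambda>b. P (hd b) \<and> Q (tl b)) bs)"
  unfolding tails_def by (induction bs) auto

lemma length_filter_disj:
  "\<forall>x\<in>set xs. \<not> (P x \<and> Q x) \<Longrightarrow>
    length (filter (\<lambda>x. P x \<or> Q x) xs) = length (filter P xs) + length (filter Q xs)"
  by (induction xs) auto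

text \<open>For a given a, only the branch of its own exponents is followed. What remains in
  \<open>E\<close> at the end is a itself, which belongs to Sq^0 and is not counted. An exponent of
  a from 16 on reaches no element at all, so testing values below 16 is enough.\<close>

lemma dual_even_correct:
  assumes "dual_even k E L" "\<forall>b\<in>set E \<union> set L. length b = k \<and> (\<forall>n\<in>set b. n < 16)" "length a = k"
  shows "even (length (filter (\<lambda>b. list_all2 sqstep a b \<and> a \<noteq> b) E) +
    length (filter (list_all2 sqstep a) L))"
  using assms
proof (induction k arbitrary: E L a)
  case 0
  then show ?case by (auto simp: filter_empty_conv filter_True)
next
  case (Suc k)
  show ?case
  proof (cases "E = [] \<and> L = []")
    case ne: False
    obtain v a' where a: "a = v # a'" "length a' = k" using Suc.prems(3) by (cases a) auto
    have len: "b = hd b # tl b" "hd b < 16" "length (tl b) = k" "\<forall>n\<in>set (tl b). n < 16"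
      if "b \<in> set E \<union> set L" for b
    proof -
      have "length b = Suc k" "\<forall>n\<in>set b. n < 16" using Suc.prems(2) that by blast+
      then show "b = hd b # tl b" "hd b < 16" "length (tl b) = k" "\<forall>n\<in>set (tl b). n < 16"
        by (cases b; simp)+
    qed
    have cons: "list_all2 sqstep a b \<longleftrightarrow> sqstep v (hd b) \<and> list_all2 sqstep a' (tl b)"
      "a = b \<longleftrightarrow> hd b = v \<and> a' = tl b" if "b \<in> set E \<union> set L" for b
      using len(1)[OF that] a(1) by (cases b; auto)+
    have refl: "sqstep v v" by (simp add: sqstep_def)
    let ?E = "tails (\<lambda>n. n = v) E"
    let ?L = "tails (\<lambda>n. n \<noteq> v \<and> sqstep v n) E @ tails (sqstep v) L"
    have "filter (\<lambda>b. list_all2 sqstep a b \<and> a \<noteq> b) E =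
        filter (\<lambda>b. (hd b = v \<and> list_all2 sqstep a' (tl b) \<and> a' \<noteq> tl b) \<or>
          ((hd b \<noteq> v \<and> sqstep v (hd b)) \<and> list_all2 sqstep a' (tl b))) E"
    proof (rule filter_cong)
      fix b assume b: "b \<in> set E"
      show "(list_all2 sqstep a b \<and> a \<noteq> b) \<longleftrightarrow> ((hd b = v \<and> list_all2 sqstep a' (tl b) \<and> a' \<noteq> tl b) \<or>
          ((hd b \<noteq> v \<and> sqstep v (hd b)) \<and> list_all2 sqstep a' (tl b)))"
        unfolding cons[OF UnI1[OF b]] using refl by blast
    qed simp
    moreover have "filter (list_all2 sqstep a) L = filter (\<lambda>b. sqstep v (hd b) \<and> list_all2 sqstep a' (tl b)) L"
      by (rule filter_cong) (simp_all only: cons(1)[OF UnI2])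
    ultimately have eq: "length (filter (\<lambda>b. list_all2 sqstep a b \<and> a \<noteq> b) E) +
        length (filter (list_all2 sqstep a) L) =
        length (filter (\<lambda>b. list_all2 sqstep a' b \<and> a' \<noteq> b) ?E) + length (filter (list_all2 sqstep a') ?L)"
      by (simp add: length_filter_tails length_filter_disj)
    show ?thesis
    proof (cases "v < 16")
      case True
      have "v \<in> set [0..<16]" using True by (simp only: set_upt atLeastLessThan_iff) simp
      then have "dual_even k ?E ?L"
        using Suc.prems(1) ne by (simp only: dual_even.simps if_False list_all_iff)
      moreover have "\<forall>b\<in>set ?E \<union> set ?L. length b = k \<and> (\<forall>n\<in>set b. n < 16)"
        using len(3,4) by (auto simp: tails_def simp del: length_tl)
      ultimately show ?thesis unfolding eq using a(2) by (rule Suc.IH)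
    next
      case False
      have "\<not> list_all2 sqstep a b" if "b \<in> set E \<union> set L" for b
        using cons(1)[OF that] len(2)[OF that] False sqstep_le[of v "hd b"] by linarith
      then have "filter (\<lambda>b. list_all2 sqstep a b \<and> a \<noteq> b) E = []" "filter (list_all2 sqstep a) L = []"
        by (auto simp: filter_empty_conv)
      then show ?thesis by simp
    qed
  qed auto
qed

text \<open>Since \<open>S\<close> is homogeneous of degree \<open>d\<close>, the monomial a
  determines the only i that matters, and Sq^i a meets \<open>S\<close> in the elements other than a
  that are reached from a. One parity for each a therefore covers all squares.\<close>

lemma dual_even_annihilating:
  assumes "dual_even 5 S []" "distinct S"
    "\<And>x. x \<in> set S \<Longrightarrow> length x = 5 \<and> (\<forall>n\<in>set x. n < 16) \<and> sum_list x = d"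
  shows "annihilating (set S)"
  unfolding annihilating_def
proof (intro allI impI)
  fix i :: nat and a assume i: "0 < i"
  show "even (card (Sq_mono i a \<inter> set S))"
  proof (cases "length a = 5 \<and> sum_list a + i = d")
    case True
    let ?F = "filter (\<lambda>b. list_all2 sqstep a b \<and> a \<noteq> b) S"
    have "b \<in> Sq_mono i a \<longleftrightarrow> list_all2 sqstep a b \<and> a \<noteq> b" if b: "b \<in> set S" for b
    proof -
      have "sum_list b = sum_list a + i" using assms(3)[OF b] True by simp
      with i show ?thesis by (auto simp: Sq_mono_iff)
    qed
    then have "Sq_mono i a \<inter> set S = set ?F" by auto
    then have card: "card (Sq_mono i a \<inter> set S) = length ?F"
      using distinct_card[of ?F] assms(2) by simp
    have "\<forall>b\<in>set S \<union> set []. length b = 5 \<and> (\<forall>n\<in>set b. n < 16)"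
      by (simp add: assms(3))
    from dual_even_correct[OF assms(1) this, of a] True have "even (length ?F)" by simp
    then show ?thesis unfolding card .
  next
    case False
    have "Sq_mono i a \<inter> set S = {}"
    proof (rule ccontr)
      assume "Sq_mono i a \<inter> set S \<noteq> {}"
      then obtain b where "b \<in> set S" "length b = length a" "sum_list b = sum_list a + i"
        by (auto simp: Sq_mono_iff_nth)
      with assms(3)[of b] False show False by simp
    qed
    then show ?thesis by simp
  qed
qed

subsection \<open>Dimensions from certificates\<close>

text \<open>Every weight list here is a block of consecutive entries of one of the four weight
  vectors. Most rules with two digits are a single Sq^1; thus Sq^1 (x_1 x_2 x_3 x_4 x_5) has the
  largest term x_1 x_2 x_3 x_4 x_5^2. The rules with three digits for (4,4,1), (2,2,1) and (4,4,3)
  rest on the identity Sq^3 (x^3 y) + Sq^2 (x^3 y^2) + Sq^1 (x^3 y^3) = x^6 y + x^4 y^3.\<close>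

definition rules :: "(nat list \<times> (mono \<times> (nat \<times> mono) list) list) list" where
  "rules = [
  ([4, 4],
   [([1, 2, 3, 3, 3], [(1, [1, 1, 3, 3, 3])]), ([1, 3, 2, 3, 3], [(1, [1, 3, 1, 3, 3])]),
    ([1, 3, 3, 2, 3], [(1, [1, 3, 3, 1, 3])]), ([1, 3, 3, 3, 2], [(1, [1, 3, 3, 3, 1])]),
    ([3, 1, 2, 3, 3], [(1, [3, 1, 1, 3, 3])]), ([3, 1, 3, 2, 3], [(1, [3, 1, 3, 1, 3])]),
    ([3, 1, 3, 3, 2], [(1, [3, 1, 3, 3, 1])]), ([3, 3, 1, 2, 3], [(1, [3, 3, 1, 1, 3])]),
    ([3, 3, 1, 3, 2], [(1, [3, 3, 1, 3, 1])]), ([3, 3, 3, 1, 2], [(1, [3, 3, 3, 1, 1])])]),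
  ([4, 3],
   [([1, 1, 2, 3, 3], [(1, [1, 1, 1, 3, 3])]), ([1, 1, 3, 2, 3], [(1, [1, 1, 3, 1, 3])]),
    ([1, 1, 3, 3, 2], [(1, [1, 1, 3, 3, 1])]), ([1, 3, 1, 2, 3], [(1, [1, 3, 1, 1, 3])]),
    ([1, 3, 1, 3, 2], [(1, [1, 3, 1, 3, 1])]), ([1, 3, 3, 1, 2], [(1, [1, 3, 3, 1, 1])]),
    ([3, 1, 1, 2, 3], [(1, [3, 1, 1, 1, 3])]), ([3, 1, 1, 3, 2], [(1, [3, 1, 1, 3, 1])]),
    ([3, 1, 3, 1, 2], [(1, [3, 1, 3, 1, 1])]), ([3, 3, 1, 1, 2], [(1, [3, 3, 1, 1, 1])])]),
  ([4, 2],
   [([1, 1, 1, 2, 3], [(1, [1, 1, 1, 1, 3])]), ([1, 1, 1, 3, 2], [(1, [1, 1, 1, 3, 1])]),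
    ([1, 1, 3, 1, 2], [(1, [1, 1, 3, 1, 1])]), ([1, 3, 1, 1, 2], [(1, [1, 3, 1, 1, 1])]),
    ([3, 1, 1, 1, 2], [(1, [3, 1, 1, 1, 1])])]),
  ([4, 1],
   [([1, 1, 1, 1, 2], [(1, [1, 1, 1, 1, 1])])]),
  ([2, 2],
   [([0, 0, 1, 2, 3], [(1, [0, 0, 1, 1, 3])]), ([0, 0, 1, 3, 2], [(1, [0, 0, 1, 3, 1])]),
    ([0, 0, 3, 1, 2], [(1, [0, 0, 3, 1, 1])]), ([0, 1, 0, 2, 3], [(1, [0, 1, 0, 1, 3])]),
    ([0, 1, 0, 3, 2], [(1, [0, 1, 0, 3, 1])]), ([0, 1, 1, 2, 2], [(1, [0, 1, 1, 1, 2])]),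
    ([0, 1, 2, 0, 3], [(1, [0, 1, 1, 0, 3])]), ([0, 1, 2, 1, 2], [(1, [0, 1, 2, 1, 1])]),
    ([0, 1, 2, 2, 1], [(1, [0, 1, 1, 1, 2]), (2, [0, 1, 1, 1, 1])]),
    ([0, 1, 2, 3, 0], [(1, [0, 1, 1, 3, 0])]), ([0, 1, 3, 0, 2], [(1, [0, 1, 3, 0, 1])]),
    ([0, 1, 3, 2, 0], [(1, [0, 1, 3, 1, 0])]), ([0, 2, 1, 1, 2], [(1, [0, 2, 1, 1, 1])]),
    ([0, 3, 0, 1, 2], [(1, [0, 3, 0, 1, 1])]), ([0, 3, 1, 0, 2], [(1, [0, 3, 1, 0, 1])]),
    ([0, 3, 1, 2, 0], [(1, [0, 3, 1, 1, 0])]), ([1, 0, 0, 2, 3], [(1, [1, 0, 0, 1, 3])]),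
    ([1, 0, 0, 3, 2], [(1, [1, 0, 0, 3, 1])]), ([1, 0, 1, 2, 2], [(1, [1, 0, 1, 1, 2])]),
    ([1, 0, 2, 0, 3], [(1, [1, 0, 1, 0, 3])]), ([1, 0, 2, 1, 2], [(1, [1, 0, 2, 1, 1])]),
    ([1, 0, 2, 2, 1], [(1, [1, 0, 1, 1, 2]), (2, [1, 0, 1, 1, 1])]),
    ([1, 0, 2, 3, 0], [(1, [1, 0, 1, 3, 0])]), ([1, 0, 3, 0, 2], [(1, [1, 0, 3, 0, 1])]),
    ([1, 0, 3, 2, 0], [(1, [1, 0, 3, 1, 0])]), ([1, 1, 0, 2, 2], [(1, [1, 1, 0, 1, 2])]),
    ([1, 1, 2, 0, 2], [(1, [1, 1, 1, 0, 2])]), ([1, 1, 2, 2, 0], [(1, [1, 1, 1, 2, 0])]),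
    ([1, 2, 0, 0, 3], [(1, [1, 1, 0, 0, 3])]), ([1, 2, 0, 1, 2], [(1, [1, 2, 0, 1, 1])]),
    ([1, 2, 0, 2, 1], [(1, [1, 1, 0, 1, 2]), (2, [1, 1, 0, 1, 1])]),
    ([1, 2, 0, 3, 0], [(1, [1, 1, 0, 3, 0])]), ([1, 2, 1, 0, 2], [(1, [1, 2, 1, 0, 1])]),
    ([1, 2, 1, 2, 0], [(1, [1, 2, 1, 1, 0])]),
    ([1, 2, 2, 0, 1], [(1, [1, 1, 1, 0, 2]), (2, [1, 1, 1, 0, 1])]),
    ([1, 2, 2, 1, 0], [(1, [1, 1, 1, 2, 0]), (2, [1, 1, 1, 1, 0])]),
    ([1, 2, 3, 0, 0], [(1, [1, 1, 3, 0, 0])]), ([1, 3, 0, 0, 2], [(1, [1, 3, 0, 0, 1])]),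
    ([1, 3, 0, 2, 0], [(1, [1, 3, 0, 1, 0])]), ([1, 3, 2, 0, 0], [(1, [1, 3, 1, 0, 0])]),
    ([2, 0, 1, 1, 2], [(1, [2, 0, 1, 1, 1])]), ([2, 1, 0, 1, 2], [(1, [2, 1, 0, 1, 1])]),
    ([2, 1, 1, 0, 2], [(1, [2, 1, 1, 0, 1])]), ([2, 1, 1, 2, 0], [(1, [2, 1, 1, 1, 0])]),
    ([3, 0, 0, 1, 2], [(1, [3, 0, 0, 1, 1])]), ([3, 0, 1, 0, 2], [(1, [3, 0, 1, 0, 1])]),
    ([3, 0, 1, 2, 0], [(1, [3, 0, 1, 1, 0])]), ([3, 1, 0, 0, 2], [(1, [3, 1, 0, 0, 1])]),
    ([3, 1, 0, 2, 0], [(1, [3, 1, 0, 1, 0])]), ([3, 1, 2, 0, 0], [(1, [3, 1, 1, 0, 0])])]),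
  ([2, 1],
   [([0, 0, 1, 1, 2], [(1, [0, 0, 1, 1, 1])]), ([0, 1, 0, 1, 2], [(1, [0, 1, 0, 1, 1])]),
    ([0, 1, 1, 0, 2], [(1, [0, 1, 1, 0, 1])]), ([0, 1, 1, 2, 0], [(1, [0, 1, 1, 1, 0])]),
    ([1, 0, 0, 1, 2], [(1, [1, 0, 0, 1, 1])]), ([1, 0, 1, 0, 2], [(1, [1, 0, 1, 0, 1])]),
    ([1, 0, 1, 2, 0], [(1, [1, 0, 1, 1, 0])]), ([1, 1, 0, 0, 2], [(1, [1, 1, 0, 0, 1])]),
    ([1, 1, 0, 2, 0], [(1, [1, 1, 0, 1, 0])]), ([1, 1, 2, 0, 0], [(1, [1, 1, 1, 0, 0])])]),
  ([2, 4],
   [([0, 2, 2, 3, 3], [(1, [0, 1, 2, 3, 3])]), ([0, 2, 3, 2, 3], [(1, [0, 1, 3, 2, 3])]),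
    ([0, 2, 3, 3, 2], [(1, [0, 1, 3, 3, 2])]), ([0, 3, 2, 2, 3], [(1, [0, 3, 1, 2, 3])]),
    ([0, 3, 2, 3, 2], [(1, [0, 3, 1, 3, 2])]), ([0, 3, 3, 2, 2], [(1, [0, 3, 3, 1, 2])]),
    ([1, 2, 2, 2, 3], [(1, [1, 1, 2, 2, 3])]), ([1, 2, 2, 3, 2], [(1, [1, 1, 2, 3, 2])]),
    ([1, 2, 3, 2, 2], [(1, [1, 1, 3, 2, 2])]), ([1, 3, 2, 2, 2], [(1, [1, 3, 1, 2, 2])]),
    ([2, 0, 2, 3, 3], [(1, [1, 0, 2, 3, 3])]), ([2, 0, 3, 2, 3], [(1, [1, 0, 3, 2, 3])]),
    ([2, 0, 3, 3, 2], [(1, [1, 0, 3, 3, 2])]), ([2, 1, 2, 2, 3], [(1, [2, 1, 2, 1, 3])]),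
    ([2, 1, 2, 3, 2], [(1, [2, 1, 1, 3, 2])]), ([2, 1, 3, 2, 2], [(1, [2, 1, 3, 2, 1])]),
    ([2, 2, 0, 3, 3], [(1, [1, 2, 0, 3, 3])]), ([2, 2, 1, 2, 3], [(1, [2, 2, 1, 1, 3])]),
    ([2, 2, 1, 3, 2], [(1, [2, 2, 1, 3, 1])]), ([2, 2, 3, 0, 3], [(1, [1, 2, 3, 0, 3])]),
    ([2, 2, 3, 1, 2], [(1, [2, 2, 3, 1, 1])]), ([2, 2, 3, 3, 0], [(1, [1, 2, 3, 3, 0])]),
    ([2, 3, 0, 2, 3], [(1, [1, 3, 0, 2, 3])]), ([2, 3, 0, 3, 2], [(1, [1, 3, 0, 3, 2])]),
    ([2, 3, 1, 2, 2], [(1, [2, 3, 1, 1, 2])]), ([2, 3, 2, 0, 3], [(1, [1, 3, 2, 0, 3])]),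
    ([2, 3, 2, 1, 2], [(1, [2, 3, 2, 1, 1])]), ([2, 3, 2, 3, 0], [(1, [1, 3, 2, 3, 0])]),
    ([2, 3, 3, 0, 2], [(1, [1, 3, 3, 0, 2])]), ([2, 3, 3, 2, 0], [(1, [1, 3, 3, 2, 0])]),
    ([3, 0, 2, 2, 3], [(1, [3, 0, 1, 2, 3])]), ([3, 0, 2, 3, 2], [(1, [3, 0, 1, 3, 2])]),
    ([3, 0, 3, 2, 2], [(1, [3, 0, 3, 1, 2])]), ([3, 1, 2, 2, 2], [(1, [3, 1, 1, 2, 2])]),
    ([3, 2, 0, 2, 3], [(1, [3, 1, 0, 2, 3])]), ([3, 2, 0, 3, 2], [(1, [3, 1, 0, 3, 2])]),
    ([3, 2, 1, 2, 2], [(1, [3, 2, 1, 1, 2])]), ([3, 2, 2, 0, 3], [(1, [3, 1, 2, 0, 3])]),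
    ([3, 2, 2, 1, 2], [(1, [3, 2, 2, 1, 1])]), ([3, 2, 2, 3, 0], [(1, [3, 1, 2, 3, 0])]),
    ([3, 2, 3, 0, 2], [(1, [3, 1, 3, 0, 2])]), ([3, 2, 3, 2, 0], [(1, [3, 1, 3, 2, 0])]),
    ([3, 3, 0, 2, 2], [(1, [3, 3, 0, 1, 2])]), ([3, 3, 2, 0, 2], [(1, [3, 3, 1, 0, 2])]),
    ([3, 3, 2, 2, 0], [(1, [3, 3, 1, 2, 0])])]),
  ([1, 1],
   [([0, 0, 0, 1, 2], [(1, [0, 0, 0, 1, 1])]), ([0, 0, 1, 0, 2], [(1, [0, 0, 1, 0, 1])]),
    ([0, 0, 1, 2, 0], [(1, [0, 0, 1, 1, 0])]), ([0, 1, 0, 0, 2], [(1, [0, 1, 0, 0, 1])]),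
    ([0, 1, 0, 2, 0], [(1, [0, 1, 0, 1, 0])]), ([0, 1, 2, 0, 0], [(1, [0, 1, 1, 0, 0])]),
    ([1, 0, 0, 0, 2], [(1, [1, 0, 0, 0, 1])]), ([1, 0, 0, 2, 0], [(1, [1, 0, 0, 1, 0])]),
    ([1, 0, 2, 0, 0], [(1, [1, 0, 1, 0, 0])]), ([1, 2, 0, 0, 0], [(1, [1, 1, 0, 0, 0])])]),
  ([4, 4, 1],
   [([3, 3, 3, 6, 1], [(3, [3, 3, 3, 3, 1]), (1, [3, 3, 3, 3, 3]), (2, [3, 3, 3, 3, 2])])]),
  ([2, 2, 1],
   [([0, 0, 3, 6, 1], [(2, [0, 0, 3, 3, 2]), (3, [0, 0, 3, 3, 1]), (1, [0, 0, 3, 3, 3])]),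
    ([0, 3, 0, 6, 1], [(3, [0, 3, 0, 3, 1]), (2, [0, 3, 0, 3, 2]), (1, [0, 3, 0, 3, 3])]),
    ([0, 3, 6, 0, 1], [(3, [0, 3, 3, 0, 1]), (2, [0, 3, 3, 0, 2]), (1, [0, 3, 3, 0, 3])]),
    ([0, 3, 6, 1, 0], [(3, [0, 3, 3, 1, 0]), (1, [0, 3, 3, 3, 0]), (2, [0, 3, 3, 2, 0])]),
    ([3, 0, 0, 6, 1], [(1, [3, 0, 0, 3, 3]), (2, [3, 0, 0, 3, 2]), (3, [3, 0, 0, 3, 1])]),
    ([3, 0, 6, 0, 1], [(1, [3, 0, 3, 0, 3]), (3, [3, 0, 3, 0, 1]), (2, [3, 0, 3, 0, 2])]),
    ([3, 0, 6, 1, 0], [(3, [3, 0, 3, 1, 0]), (2, [3, 0, 3, 2, 0]), (1, [3, 0, 3, 3, 0])]),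
    ([3, 6, 0, 0, 1], [(1, [3, 3, 0, 0, 3]), (2, [3, 3, 0, 0, 2]), (3, [3, 3, 0, 0, 1])]),
    ([3, 6, 0, 1, 0], [(2, [3, 3, 0, 2, 0]), (3, [3, 3, 0, 1, 0]), (1, [3, 3, 0, 3, 0])]),
    ([3, 6, 1, 0, 0], [(3, [3, 3, 1, 0, 0]), (2, [3, 3, 2, 0, 0]), (1, [3, 3, 3, 0, 0])])]),
  ([4, 4, 3],
   [([3, 6, 1, 7, 7], [(3, [3, 3, 1, 7, 7]), (2, [3, 3, 2, 7, 7]), (1, [3, 3, 3, 7, 7])]),
    ([3, 6, 7, 1, 7], [(1, [3, 3, 7, 3, 7]), (3, [3, 3, 7, 1, 7]), (2, [3, 3, 7, 2, 7])]),
    ([3, 6, 7, 7, 1], [(2, [3, 3, 7, 7, 2]), (1, [3, 3, 7, 7, 3]), (3, [3, 3, 7, 7, 1])]),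
    ([3, 7, 6, 1, 7], [(2, [3, 7, 3, 2, 7]), (3, [3, 7, 3, 1, 7]), (1, [3, 7, 3, 3, 7])]),
    ([3, 7, 6, 7, 1], [(1, [3, 7, 3, 7, 3]), (3, [3, 7, 3, 7, 1]), (2, [3, 7, 3, 7, 2])]),
    ([3, 7, 7, 6, 1], [(2, [3, 7, 7, 3, 2]), (3, [3, 7, 7, 3, 1]), (1, [3, 7, 7, 3, 3])]),
    ([7, 3, 6, 1, 7], [(3, [7, 3, 3, 1, 7]), (1, [7, 3, 3, 3, 7]), (2, [7, 3, 3, 2, 7])]),
    ([7, 3, 6, 7, 1], [(2, [7, 3, 3, 7, 2]), (3, [7, 3, 3, 7, 1]), (1, [7, 3, 3, 7, 3])]),
    ([7, 3, 7, 6, 1], [(1, [7, 3, 7, 3, 3]), (3, [7, 3, 7, 3, 1]), (2, [7, 3, 7, 3, 2])]),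
    ([7, 7, 3, 6, 1], [(1, [7, 7, 3, 3, 3]), (3, [7, 7, 3, 3, 1]), (2, [7, 7, 3, 3, 2])])]),
  ([4, 2, 4],
   [([4, 5, 5, 3, 7], [(2, [1, 3, 5, 6, 7]), (2, [1, 3, 6, 5, 7]), (2, [1, 6, 3, 5, 7]), (2, [2, 5, 5, 3, 7]), (1, [1, 5, 5, 5, 7])]),
    ([4, 5, 5, 7, 3], [(2, [1, 3, 5, 7, 6]), (2, [1, 3, 6, 7, 5]), (2, [1, 6, 3, 7, 5]), (2, [2, 5, 5, 7, 3]), (1, [1, 5, 5, 7, 5])]),
    ([4, 5, 7, 5, 3], [(2, [1, 3, 7, 5, 6]), (2, [1, 3, 7, 6, 5]), (2, [1, 6, 7, 3, 5]), (2, [2, 5, 7, 5, 3]), (1, [1, 5, 7, 5, 5])]),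
    ([4, 7, 5, 5, 3], [(2, [1, 7, 3, 5, 6]), (2, [1, 7, 3, 6, 5]), (2, [1, 7, 6, 3, 5]), (2, [2, 7, 5, 5, 3]), (1, [1, 7, 5, 5, 5])]),
    ([5, 4, 5, 3, 7], [(2, [5, 1, 6, 3, 7]), (2, [5, 1, 3, 6, 7]), (2, [5, 2, 5, 3, 7]), (3, [5, 1, 3, 5, 7])]),
    ([5, 4, 5, 7, 3], [(2, [5, 1, 3, 7, 6]), (2, [5, 1, 6, 7, 3]), (2, [5, 2, 5, 7, 3]), (1, [5, 1, 5, 7, 5])]),
    ([5, 4, 7, 5, 3], [(2, [5, 1, 7, 6, 3]), (2, [3, 1, 7, 5, 6]), (2, [5, 2, 7, 5, 3]), (3, [5, 1, 7, 5, 3])]),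
    ([5, 5, 4, 3, 7], [(2, [5, 3, 1, 6, 7]), (2, [5, 5, 2, 3, 7]), (1, [5, 5, 1, 5, 7])]),
    ([5, 5, 4, 7, 3], [(2, [5, 3, 1, 7, 6]), (3, [5, 5, 1, 7, 3]), (2, [5, 5, 2, 7, 3])]),
    ([5, 5, 6, 5, 3], [(2, [3, 5, 3, 5, 6]), (2, [3, 5, 3, 6, 5]), (2, [3, 5, 6, 5, 3]), (1, [3, 5, 5, 5, 5]), (1, [5, 5, 3, 5, 5])]),
    ([5, 5, 7, 4, 3], [(2, [5, 5, 7, 2, 3]), (2, [5, 3, 7, 1, 6]), (3, [3, 5, 7, 1, 5])]),
    ([5, 6, 5, 5, 3], [(2, [5, 6, 3, 3, 5]), (1, [5, 9, 3, 3, 3]), (4, [6, 5, 3, 3, 3]), (1, [9, 5, 3, 3, 3]), (4, [5, 6, 3, 3, 3])]),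
    ([5, 7, 4, 5, 3], [(2, [3, 7, 1, 5, 6]), (2, [3, 7, 1, 6, 5]), (2, [5, 7, 2, 5, 3]), (3, [5, 7, 1, 5, 3])]),
    ([5, 7, 5, 4, 3], [(2, [5, 7, 3, 1, 6]), (2, [5, 7, 5, 2, 3]), (3, [5, 7, 5, 1, 3])]),
    ([7, 4, 5, 5, 3], [(2, [7, 1, 3, 5, 6]), (2, [7, 1, 3, 6, 5]), (2, [7, 1, 6, 3, 5]), (2, [7, 2, 5, 5, 3]), (1, [7, 1, 5, 5, 5])]),
    ([7, 5, 4, 5, 3], [(2, [7, 5, 2, 5, 3]), (2, [7, 5, 1, 3, 6]), (3, [7, 5, 1, 3, 5]), (2, [7, 3, 1, 6, 5])]),
    ([7, 5, 5, 4, 3], [(2, [7, 5, 3, 1, 6]), (2, [7, 5, 5, 2, 3]), (3, [7, 5, 5, 1, 3])])]),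
  ([4, 4, 1, 1],
   [([3, 3, 3, 12, 3], [(1, [3, 3, 3, 3, 11]), (4, [3, 3, 3, 6, 5]), (6, [3, 3, 3, 6, 3]), (7, [3, 3, 3, 3, 5]), (2, [3, 3, 3, 3, 10])])]),
  ([4, 2, 2, 1],
   [([1, 1, 7, 14, 1], [(3, [1, 1, 9, 7, 3]), (3, [1, 1, 7, 9, 3]), (6, [1, 1, 7, 7, 2]), (2, [1, 1, 7, 7, 6]), (7, [1, 1, 7, 7, 1]), (4, [1, 1, 7, 7, 4])]),
    ([1, 7, 1, 14, 1], [(3, [1, 11, 1, 7, 1]), (4, [1, 7, 1, 7, 4]), (3, [1, 7, 1, 7, 5]), (1, [1, 7, 1, 13, 1]), (2, [1, 7, 1, 7, 6]), (6, [1, 7, 1, 7, 2])]),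
    ([1, 7, 9, 6, 1], [(4, [1, 7, 7, 1, 4]), (4, [1, 7, 7, 4, 1]), (3, [1, 7, 7, 1, 5]), (2, [1, 7, 7, 6, 1]), (6, [1, 7, 7, 2, 1]), (7, [1, 7, 7, 1, 1]), (2, [1, 11, 7, 1, 2]), (2, [1, 7, 11, 1, 2]), (2, [1, 7, 7, 1, 6])]),
    ([7, 1, 1, 14, 1], [(4, [7, 1, 1, 7, 4]), (3, [7, 1, 1, 7, 5]), (6, [7, 1, 1, 7, 2]), (7, [7, 1, 1, 7, 1]), (2, [7, 1, 1, 7, 6])]),
    ([7, 1, 9, 6, 1], [(6, [7, 1, 7, 2, 1]), (1, [13, 1, 7, 1, 1]), (1, [7, 1, 13, 1, 1]), (6, [7, 1, 7, 1, 2]), (4, [7, 1, 7, 4, 1]), (2, [7, 1, 7, 6, 1]), (3, [7, 1, 7, 1, 5]), (4, [7, 1, 7, 1, 4]), (2, [7, 1, 7, 1, 6])]),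
    ([7, 9, 1, 6, 1], [(3, [7, 9, 1, 1, 3]), (3, [9, 7, 1, 1, 3]), (7, [7, 7, 1, 1, 1]), (4, [7, 7, 1, 1, 4]), (2, [7, 7, 1, 6, 1]), (6, [7, 7, 1, 1, 2]), (2, [7, 7, 1, 1, 6]), (4, [7, 7, 1, 4, 1]), (6, [7, 7, 1, 2, 1])])])]"

text \<open>The enumeration works with the leading monomials alone; the squares matter only when the
  rules are certified.\<close>

definition leads :: rule_set where "leads = map (\<lambda>(u, cs). (u, map fst cs)) rules"

section \<open>Leading monomials of the functionals\<close>

fun top_of :: "nat list \<Rightarrow> mono list \<Rightarrow> mono" where
  "top_of w [] = []"
| "top_of w [x] = x"
| "top_of w (x # y # xs) = top_of w ((if weight_less w x y then y else x) # xs)"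

lemma top_of_in: "T \<noteq> [] \<Longrightarrow> top_of w T \<in> set T"
proof (induction w T rule: top_of.induct)
  case (3 w x y xs)
  then have "top_of w ((if weight_less w x y then y else x) # xs) \<in>
      set ((if weight_less w x y then y else x) # xs)" by blast
  then show ?case by (auto split: if_splits)
qed auto

text \<open>An annihilating set is given by its elements \<open>E\<close> of weight \<open>w\<close> and its elements \<open>H\<close> of
  larger weight.\<close>

definition dual_set :: "nat list \<Rightarrow> nat list list \<Rightarrow> mono list \<times> mono list \<Rightarrow> bool" where
  "dual_set w ws = (\<lambda>(E, H). E \<noteq> [] \<and> distinct (E @ H) \<and> dual_even 5 (E @ H) [] \<and>
    list_all (\<lambda>x. length x = 5 \<and> list_all (\<lambda>n. n < 16) x) (E @ H) \<and>
    list_all (\<lambda>x. exactly w x \<and> list_all (\<lambda>n. n \<noteq> 0) x) E \<and>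
    list_all (\<lambda>x. \<not> exactly w x \<and> \<not> lower w x \<and> list_ex (\<lambda>v. exactly v x) ws) H)"

type_synonym functional = "(mono list \<times> mono list) \<times> nat list"

definition leading :: "nat list \<Rightarrow> functional \<Rightarrow> mono" where
  "leading w = (\<lambda>(S, p). top_of w (map (permute p) (fst S)))"

text \<open>Here \<open>u\<close> is the leading monomial of the preceding functional. A strictly
  ascending chain shows all leading monomials to be distinct with one comparison per functional
  instead of one per pair.\<close>

fun ascending :: "nat list \<Rightarrow> mono \<Rightarrow> functional list \<Rightarrow> bool" where
  "ascending w u [] = True"
| "ascending w u ((S, p) # fs) \<longleftrightarrow> is_perm p \<and>
    (let T = map (permute p) (fst S); t = top_of w T in
      weight_less w u t \<and> list_all (\<lambda>y. y = t \<or> weight_less w y t) T \<and> ascending w t fs)"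

lemma below_trans: "below s x y \<Longrightarrow> below s y z \<Longrightarrow> below s x z"
  unfolding below_def using lex_transI[of less_than] by (meson transD trans_less_than)

lemma below_irrefl: "\<not> below s x x"
  using wf_not_refl[OF wf_below, of x s] by simp

lemma ascending_dominates:
  assumes "ascending w u fs" "(S, p) \<in> set fs"
  shows "is_perm p" "y \<in> permute p ` set (fst S) \<Longrightarrow> y = leading w (S, p) \<or> weight_less w y (leading w (S, p))"
  using assms by (induction fs arbitrary: u) (auto simp: Let_def list_all_iff leading_def)

lemma ascending_distinct:
  assumes "ascending w u fs" "length u = 5" "\<And>S p. (S, p) \<in> set fs \<Longrightarrow> fst S \<noteq> []"
  shows "distinct (map (leading w) fs) \<and> (\<forall>t\<in>set (map (leading w) fs). below (length w) u t)"
  using assms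
proof (induction fs arbitrary: u)
  case (Cons f fs)
  obtain S p where f: "f = (S, p)" by (cases f)
  let ?t = "leading w f"
  have asc: "is_perm p" "weight_less w u ?t" "ascending w ?t fs"
    using Cons.prems(1) by (simp_all add: f leading_def Let_def)
  have "fst S \<noteq> []" using Cons.prems(3)[of S p] by (simp add: f)
  then have "?t \<in> permute p ` set (fst S)"
    using top_of_in[of "map (permute p) (fst S)" w] by (simp add: f leading_def)
  then have len: "length ?t = 5" using asc(1) by (auto simp: permute_def is_perm_def)
  have u: "below (length w) u ?t" using weight_less_below[OF asc(2)] len Cons.prems(2) by simp
  have IH: "distinct (map (leading w) fs) \<and> (\<forall>t\<in>set (map (leading w) fs). below (length w) ?t t)"
    using asc(3) len
  proof (rule Cons.IH)
    fix S p assume "(S, p) \<in> set fs"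
    then show "fst S \<noteq> []" using Cons.prems(3)[of S p] by simp
  qed
  then have "?t \<notin> set (map (leading w) fs)" using below_irrefl by blast
  with IH u show ?case using below_trans[OF u] by simp
qed simp

lemma positive_iff: "positive k x \<longleftrightarrow> length x = k \<and> (\<forall>n\<in>set x. n \<noteq> 0)"
  by (auto simp: positive_def in_set_conv_nth)

lemma lower_not_exactly: "lower w x \<Longrightarrow> \<not> exactly w x"
  by (auto simp: lower_iff exactly_iff wless_def)

text \<open>Weight and positivity depend only on the multiset of exponents and survive the
  permutation. The list \<open>ws\<close> pins down the degree of the elements of larger weight,
  since \<open>dual_even_annihilating\<close> asks for a homogeneous set.\<close>

lemma dual_set_functional:
  assumes "dual_set w ws (E, H)" "is_perm p" "\<And>v. v \<in> set ws \<Longrightarrow> deg_w v = deg_w w"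
    "\<And>y. y \<in> permute p ` set E \<Longrightarrow> y = t \<or> weight_less w y t" "t \<in> permute p ` set E"
  shows "positive 5 t \<and> exactly w t"
    "\<exists>S. annihilating S \<and> t \<in> S \<and> (\<forall>x\<in>S. \<not> lower w x \<and> (exactly w x \<longrightarrow> x = t \<or> below (length w) x t))"
proof -
  have ok: "distinct (E @ H)" "dual_even 5 (E @ H) []"
    "\<And>x. x \<in> set (E @ H) \<Longrightarrow> length x = 5 \<and> (\<forall>n\<in>set x. n < 16)"
    "\<And>x. x \<in> set E \<Longrightarrow> exactly w x \<and> (\<forall>n\<in>set x. n \<noteq> 0)"
    "\<And>x. x \<in> set H \<Longrightarrow> \<not> exactly w x \<and> \<not> lower w x \<and> (\<exists>v\<in>set ws. exactly v x)"
    using assms(1) unfolding dual_set_def by (simp_all add: list_all_iff list_ex_iff)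
  have sum: "sum_list x = deg_w w" if "x \<in> set (E @ H)" for x
    using that ok(4,5) exactly_sum_list assms(3) by (metis Un_iff set_append)
  have "annihilating (set (E @ H))"
    using ok(2,1) by (rule dual_even_annihilating) (use ok(3) sum in blast)
  then have ann: "annihilating (permute p ` set (E @ H))"
    using assms(2) by (rule annihilating_permute) (use ok(3) in blast)
  have inv: "exactly w (permute p x) \<longleftrightarrow> exactly w x" "lower w (permute p x) \<longleftrightarrow> lower w x"
    "set (permute p x) = set x" "length (permute p x) = 5"
    if "x \<in> set (E @ H)" for x
  proof -
    have "mset (permute p x) = mset x" using mset_permute[OF assms(2)] ok(3)[OF that] by blast
    then show "exactly w (permute p x) \<longleftrightarrow> exactly w x" "lower w (permute p x) \<longleftrightarrow> lower w x"
        "set (permute p x) = set x" "length (permute p x) = 5"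
      using weight_mset mset_eq_setD mset_eq_length ok(3)[OF that] by metis+
  qed
  obtain x where x: "x \<in> set E" "t = permute p x" using assms(5) by blast
  then show t: "positive 5 t \<and> exactly w t"
    using ok(4)[of x] inv[of x] by (simp add: positive_iff)
  have "\<not> lower w y \<and> (exactly w y \<longrightarrow> y = t \<or> below (length w) y t)" if "y \<in> permute p ` set (E @ H)" for y
  proof -
    from that obtain z where z: "z \<in> set (E @ H)" "y = permute p z" by blast
    show ?thesis
    proof (cases "z \<in> set E")
      case True
      then have "exactly w y" using ok(4) inv(1)[OF z(1)] z(2) by simp
      moreover have "y = t \<or> below (length w) y t"
        using assms(4)[of y] True z(2) weight_less_below[of w y t] inv(4)[OF z(1)] t
        by (auto simp: positive_def)
      ultimately show ?thesis using lower_not_exactly by blast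
    next
      case False
      then have "z \<in> set H" using z(1) by simp
      then show ?thesis using ok(5)[of z] inv(1,2)[OF z(1)] z(2) by simp
    qed
  qed
  moreover have "t \<in> permute p ` set (E @ H)" using x by auto
  ultimately show "\<exists>S. annihilating S \<and> t \<in> S \<and>
      (\<forall>x\<in>S. \<not> lower w x \<and> (exactly w x \<longrightarrow> x = t \<or> below (length w) x t))"
    using ann by blast
qed

lemma dim_QPplus_certified:
  assumes upper: "length (filter (list_all (\<lambda>n. n \<noteq> 0)) (irreducibles leads w)) \<le> n"
      "list_all (\<lambda>(u, cs). list_all (\<lambda>(x, gs). certifies u x gs) cs) rules"
    and lower: "list_all (\<lambda>(S, p). dual_set w ws S) fs" "ascending w [0, 0, 0, 0, 0] fs"
      "n \<le> length fs" "list_all (\<lambda>v. deg_w v = deg_w w) ws"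
  shows "dim_QPplus 5 w = n"
proof (rule dim_QPplus_eqI)
  let ?I = "filter (list_all (\<lambda>n. n \<noteq> 0)) (irreducibles leads w)"
  \<comment> \<open>The enumeration is known to be complete, not to be sound. The added conjuncts
    turn its members into admissible generators and can only lower their number.\<close>
  let ?T = "{x \<in> set ?I. positive 5 x \<and> exactly w x}"
  show "finite ?T" by simp
  have "card ?T \<le> card (set ?I)" by (intro card_mono) auto
  then show "card ?T \<le> n" using card_length[of ?I] upper(1) by linarith
  show "positive 5 t \<and> exactly w t" if "t \<in> ?T" for t using that by simp
  have "reducible (length u) u l" if "(u, L) \<in> set leads" "l \<in> set L" for u L l
    using that upper(2) certifies_reducible by (fastforce simp: leads_def list_all_iff)
  then have "x \<in> set (irreducibles leads w) \<or> (\<exists>s. reducible s w x)" if "positive 5 x" "exactly w x" for x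
    using that by (intro irreducibles_complete) (auto simp: positive_def)
  then show "x \<in> ?T \<or> (\<exists>s. reducible s w x)" if "positive 5 x" "exactly w x" for x
    using that by (auto simp: positive_iff list_all_iff)
next
  let ?T = "map (leading w) fs"
  have dual: "dual_set w ws S" if "(S, p) \<in> set fs" for S p
    using lower(1) that by (auto simp: list_all_iff)
  have top: "positive 5 t \<and> exactly w t" "\<exists>S. annihilating S \<and> t \<in> S \<and>
      (\<forall>x\<in>S. \<not> lower w x \<and> (exactly w x \<longrightarrow> x = t \<or> below (length w) x t))"
    if "t \<in> set ?T" for t
  proof -
    from that obtain E H p where f: "((E, H), p) \<in> set fs" "t = leading w ((E, H), p)"
      by auto
    have "E \<noteq> []" using dual[OF f(1)] by (simp add: dual_set_def)
    then have "t \<in> permute p ` set E"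
      using top_of_in[of "map (permute p) E" w] by (simp add: f(2) leading_def)
    moreover have "deg_w v = deg_w w" if "v \<in> set ws" for v
      using lower(4) that by (simp add: list_all_iff)
    ultimately show "positive 5 t \<and> exactly w t" "\<exists>S. annihilating S \<and> t \<in> S \<and>
        (\<forall>x\<in>S. \<not> lower w x \<and> (exactly w x \<longrightarrow> x = t \<or> below (length w) x t))"
      using dual_set_functional[OF dual[OF f(1)] ascending_dominates(1)[OF lower(2) f(1)], of t]
        ascending_dominates(2)[OF lower(2) f(1)] f(2) by simp_all
  qed
  have "fst S \<noteq> []" if "(S, p) \<in> set fs" for S p
    using dual[OF that] by (auto simp: dual_set_def)
  then have distinct: "distinct ?T"
    using ascending_distinct[OF lower(2)] by simp
  show "finite (set ?T)" by simp
  show "n \<le> card (set ?T)" using lower(3) distinct_card[OF distinct] by simp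
  show "positive 5 t \<and> exactly w t" if "t \<in> set ?T" for t
    using top(1)[OF that] .
  show "\<exists>S. annihilating S \<and> t \<in> S \<and>
      (\<forall>x\<in>S. \<not> lower w x \<and> (x \<in> set ?T \<longrightarrow> x = t \<or> below (length w) x t))"
    if "t \<in> set ?T" for t
    using top(2)[OF that] top(1) by blast
qed

subsection \<open>Evaluation of the certificates\<close>

text \<open>The certificates are evaluated by the simplifier. It would visit normal list cells and numerals
  again after every step; the trivial congruence rules below stop it from doing so. List cells
  produced by a computation are therefore written \<open>strict_Cons\<close>, whose arguments are normalised.\<close>

definition strict_Cons :: "'a \<Rightarrow> 'a list \<Rightarrow> 'a list" where "strict_Cons x xs = x # xs"

lemma eval_congs:
  "x # xs = x # xs"
  "(numeral k :: nat) = numeral k"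
  "P = P' \<Longrightarrow> (P \<and> Q) = (P' \<and> Q)"
  "P = P' \<Longrightarrow> (P \<or> Q) = (P' \<or> Q)"
  "xs = ys \<Longrightarrow> map f xs = map f ys"
  "xs = ys \<Longrightarrow> filter g xs = filter g ys"
  "xs = ys \<Longrightarrow> list_all g xs = list_all g ys"
  "xs = ys \<Longrightarrow> list_ex g xs = list_ex g ys"
  by simp_all

lemma eval_list:
  "map f [] = []" "map f (x # xs) = strict_Cons (f x) (map f xs)"
  "filter P [] = []" "filter P (x # xs) = (if P x then strict_Cons x (filter P xs) else filter P xs)"
  "list_all P [] = True" "list_all P (x # xs) = (P x \<and> list_all P xs)"
  "list_ex P [] = False" "list_ex P (x # xs) = (P x \<or> list_ex P xs)"
  "[] @ ys = ys" "(x # xs) @ ys = strict_Cons x (xs @ ys)"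
  "concat [] = []" "concat (xs # xss) = xs @ concat xss"
  "x \<in> set [] \<longleftrightarrow> False" "x \<in> set (y # ys) \<longleftrightarrow> x = y \<or> x \<in> set ys"
  "distinct [] = True" "distinct (x # xs) \<longleftrightarrow> (if x \<in> set xs then False else distinct xs)"
  "sum_list [] = (0 :: nat)" "sum_list (n # ns) = n + sum_list ns"
  "((x # xs) = (y # ys)) = (x = y \<and> xs = ys)" "((x # xs) = []) = False" "([] = (x # xs)) = False"
  by (simp_all add: strict_Cons_def)

lemma eval_length:
  "length [a, b] = 2" "length [a, b, c] = 3" "length [a, b, c, d] = 4" "length [a, b, c, d, e] = 5"
  by simp_all

lemma eval_weight:
  "bits [] = []" "bits (n # x) = strict_Cons (n mod 2) (bits x)"
  "halve [] = []" "halve (n # x) = strict_Cons (n div 2) (halve x)"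
  "shift s [] x = []" "shift s (m # z) (n # x) = strict_Cons (n + 2 ^ s * m) (shift s z x)"
  "low_part s [] = []" "low_part s (n # x) = strict_Cons (n mod 2 ^ s) (low_part s x)"
  "lower [] x = False"
  "lower (r # w) x = (let k = sum_list (bits x) in k < r \<or> k = r \<and> lower w (halve x))"
  "exactly [] [] = True" "exactly [] (n # x) = (n = 0 \<and> exactly [] x)"
  by (simp_all add: bits_def halve_def shift_def low_part_def strict_Cons_def Let_def)

text \<open>Lucas' theorem written out for lower numbers below 8, since the certificates use no
  square beyond Sq^7.\<close>

lemma eval_sqs:
  "sqs a 0 = [a]" "sqs [] 1 = []" "sqs [] (numeral k) = []"
  "even (n choose 0) = False"
  "even (n choose 1) = (n mod 2 = 0)"
  "even (n choose 2) = (n div 2 mod 2 = 0)"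
  "even (n choose 3) = (n mod 2 = 0 \<or> n div 2 mod 2 = 0)"
  "even (n choose 4) = (n div 2 div 2 mod 2 = 0)"
  "even (n choose 5) = (n mod 2 = 0 \<or> n div 2 div 2 mod 2 = 0)"
  "even (n choose 6) = (n div 2 mod 2 = 0 \<or> n div 2 div 2 mod 2 = 0)"
  "even (n choose 7) = (n mod 2 = 0 \<or> n div 2 mod 2 = 0 \<or> n div 2 div 2 mod 2 = 0)"
proof -
  show "sqs a 0 = [a]" by (induction a) simp_all
  have "even (n choose 1) = even n" "even (n choose 2) = even (n div 2)"
    "even (n choose 3) = (even n \<or> even (n div 2))" "even (n choose 4) = even (n div 2 div 2)"
    "even (n choose 5) = (even n \<or> even (n div 2 div 2))"
    "even (n choose 6) = (even (n div 2) \<or> even (n div 2 div 2))"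
    "even (n choose 7) = (even n \<or> even (n div 2) \<or> even (n div 2 div 2))"
    using odd_choose_div2[of n 1] odd_choose_div2[of n 2] odd_choose_div2[of n 3]
      odd_choose_div2[of n 4] odd_choose_div2[of n 5] odd_choose_div2[of n 6] odd_choose_div2[of n 7]
      odd_choose_div2[of "n div 2" 1] odd_choose_div2[of "n div 2" 2] odd_choose_div2[of "n div 2" 3]
    by (simp_all, blast+)
  then show "even (n choose 1) = (n mod 2 = 0)" "even (n choose 2) = (n div 2 mod 2 = 0)"
    "even (n choose 3) = (n mod 2 = 0 \<or> n div 2 mod 2 = 0)"
    "even (n choose 4) = (n div 2 div 2 mod 2 = 0)"
    "even (n choose 5) = (n mod 2 = 0 \<or> n div 2 div 2 mod 2 = 0)"
    "even (n choose 6) = (n div 2 mod 2 = 0 \<or> n div 2 div 2 mod 2 = 0)"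
    "even (n choose 7) = (n mod 2 = 0 \<or> n div 2 mod 2 = 0 \<or> n div 2 div 2 mod 2 = 0)"
    by (simp_all only: even_iff_mod_2_eq_zero[of n] even_iff_mod_2_eq_zero[of "n div 2"]
      even_iff_mod_2_eq_zero[of "n div 2 div 2"])
qed simp_all

lemma eval_dual:
  "tails P [] = []" "tails P ((n # x) # bs) = (if P n then strict_Cons x (tails P bs) else tails P bs)"
  "dual_even 0 E []" "dual_even 0 E [x] = False" "dual_even 0 E (x # y # xs) = dual_even 0 E xs"
  "[a, b, c, d, e] ! 0 = a" "[a, b, c, d, e] ! 1 = b" "[a, b, c, d, e] ! 2 = c"
  "[a, b, c, d, e] ! 3 = d" "[a, b, c, d, e] ! 4 = e"
  "top_of w [x] = x"
  "top_of w (x # y # xs) = top_of w (strict_Cons (if weight_less w x y then y else x) xs)"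
  by (simp_all add: tails_def strict_Cons_def)

lemma dual_even_5: "dual_even 5 = dual_even (Suc (Suc (Suc (Suc (Suc 0)))))"
  by (simp add: numeral_eq_Suc)

lemma masks_5:
  "masks 5 1 = [[0, 0, 0, 0, 1], [0, 0, 0, 1, 0], [0, 0, 1, 0, 0], [0, 1, 0, 0, 0], [1, 0, 0, 0, 0]]"
  "masks 5 2 = [[0, 0, 0, 1, 1], [0, 0, 1, 0, 1], [0, 0, 1, 1, 0], [0, 1, 0, 0, 1], [0, 1, 0, 1, 0],
    [0, 1, 1, 0, 0], [1, 0, 0, 0, 1], [1, 0, 0, 1, 0], [1, 0, 1, 0, 0], [1, 1, 0, 0, 0]]"
  "masks 5 3 = [[0, 0, 1, 1, 1], [0, 1, 0, 1, 1], [0, 1, 1, 0, 1], [0, 1, 1, 1, 0], [1, 0, 0, 1, 1],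
    [1, 0, 1, 0, 1], [1, 0, 1, 1, 0], [1, 1, 0, 0, 1], [1, 1, 0, 1, 0], [1, 1, 1, 0, 0]]"
  "masks 5 4 = [[0, 1, 1, 1, 1], [1, 0, 1, 1, 1], [1, 1, 0, 1, 1], [1, 1, 1, 0, 1], [1, 1, 1, 1, 0]]"
  by (simp_all add: numeral_eq_Suc)

lemma arithmetic_table:
  "(2 :: nat) ^ 2 = 4" "(2 :: nat) ^ 3 = 8" "(2 :: nat) ^ 4 = 16"
  "(0 :: nat) mod 2 = 0" "(1 :: nat) mod 2 = 1" "(2 :: nat) mod 2 = 0" "(3 :: nat) mod 2 = 1"
  "(4 :: nat) mod 2 = 0" "(5 :: nat) mod 2 = 1" "(6 :: nat) mod 2 = 0" "(7 :: nat) mod 2 = 1"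
  "(8 :: nat) mod 2 = 0" "(9 :: nat) mod 2 = 1" "(10 :: nat) mod 2 = 0" "(11 :: nat) mod 2 = 1"
  "(12 :: nat) mod 2 = 0" "(13 :: nat) mod 2 = 1" "(14 :: nat) mod 2 = 0" "(15 :: nat) mod 2 = 1"
  "(16 :: nat) mod 2 = 0" "(17 :: nat) mod 2 = 1" "(18 :: nat) mod 2 = 0" "(19 :: nat) mod 2 = 1"
  "(20 :: nat) mod 2 = 0" "(21 :: nat) mod 2 = 1" "(22 :: nat) mod 2 = 0" "(23 :: nat) mod 2 = 1"
  "(24 :: nat) mod 2 = 0"
  "(0 :: nat) div 2 = 0" "(1 :: nat) div 2 = 0" "(2 :: nat) div 2 = 1" "(3 :: nat) div 2 = 1"
  "(4 :: nat) div 2 = 2" "(5 :: nat) div 2 = 2" "(6 :: nat) div 2 = 3" "(7 :: nat) div 2 = 3"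
  "(8 :: nat) div 2 = 4" "(9 :: nat) div 2 = 4" "(10 :: nat) div 2 = 5" "(11 :: nat) div 2 = 5"
  "(12 :: nat) div 2 = 6" "(13 :: nat) div 2 = 6" "(14 :: nat) div 2 = 7" "(15 :: nat) div 2 = 7"
  "(16 :: nat) div 2 = 8" "(17 :: nat) div 2 = 8" "(18 :: nat) div 2 = 9" "(19 :: nat) div 2 = 9"
  "(20 :: nat) div 2 = 10" "(21 :: nat) div 2 = 10" "(22 :: nat) div 2 = 11"
  "(23 :: nat) div 2 = 11" "(24 :: nat) div 2 = 12"
  "(0 :: nat) mod 4 = 0" "(1 :: nat) mod 4 = 1" "(2 :: nat) mod 4 = 2" "(3 :: nat) mod 4 = 3"
  "(4 :: nat) mod 4 = 0" "(5 :: nat) mod 4 = 1" "(6 :: nat) mod 4 = 2" "(7 :: nat) mod 4 = 3"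
  "(8 :: nat) mod 4 = 0" "(9 :: nat) mod 4 = 1" "(10 :: nat) mod 4 = 2" "(11 :: nat) mod 4 = 3"
  "(12 :: nat) mod 4 = 0" "(13 :: nat) mod 4 = 1" "(14 :: nat) mod 4 = 2" "(15 :: nat) mod 4 = 3"
  "(0 :: nat) mod 8 = 0" "(1 :: nat) mod 8 = 1" "(2 :: nat) mod 8 = 2" "(3 :: nat) mod 8 = 3"
  "(4 :: nat) mod 8 = 4" "(5 :: nat) mod 8 = 5" "(6 :: nat) mod 8 = 6" "(7 :: nat) mod 8 = 7"
  "(8 :: nat) mod 8 = 0" "(9 :: nat) mod 8 = 1" "(10 :: nat) mod 8 = 2" "(11 :: nat) mod 8 = 3"
  "(12 :: nat) mod 8 = 4" "(13 :: nat) mod 8 = 5" "(14 :: nat) mod 8 = 6" "(15 :: nat) mod 8 = 7"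
  "(0 :: nat) mod 16 = 0" "(1 :: nat) mod 16 = 1" "(2 :: nat) mod 16 = 2" "(3 :: nat) mod 16 = 3"
  "(4 :: nat) mod 16 = 4" "(5 :: nat) mod 16 = 5" "(6 :: nat) mod 16 = 6" "(7 :: nat) mod 16 = 7"
  "(8 :: nat) mod 16 = 8" "(9 :: nat) mod 16 = 9" "(10 :: nat) mod 16 = 10"
  "(11 :: nat) mod 16 = 11" "(12 :: nat) mod 16 = 12" "(13 :: nat) mod 16 = 13"
  "(14 :: nat) mod 16 = 14" "(15 :: nat) mod 16 = 15"
  "(0 :: nat) + 2 ^ 1 * 0 = 0" "(0 :: nat) + 2 ^ 1 * 1 = 2" "(0 :: nat) + 2 ^ 1 * 2 = 4"
  "(0 :: nat) + 2 ^ 1 * 3 = 6" "(0 :: nat) + 2 ^ 1 * 4 = 8" "(0 :: nat) + 2 ^ 1 * 5 = 10"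
  "(0 :: nat) + 2 ^ 1 * 6 = 12" "(0 :: nat) + 2 ^ 1 * 7 = 14" "(1 :: nat) + 2 ^ 1 * 0 = 1"
  "(1 :: nat) + 2 ^ 1 * 1 = 3" "(1 :: nat) + 2 ^ 1 * 2 = 5" "(1 :: nat) + 2 ^ 1 * 3 = 7"
  "(1 :: nat) + 2 ^ 1 * 4 = 9" "(1 :: nat) + 2 ^ 1 * 5 = 11" "(1 :: nat) + 2 ^ 1 * 6 = 13"
  "(1 :: nat) + 2 ^ 1 * 7 = 15"
  "(0 :: nat) + 0 = 0" "(0 :: nat) + 1 = 1" "(0 :: nat) + 2 = 2" "(0 :: nat) + 3 = 3"
  "(0 :: nat) + 4 = 4" "(0 :: nat) + 5 = 5" "(0 :: nat) + 6 = 6" "(0 :: nat) + 7 = 7"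
  "(1 :: nat) + 0 = 1" "(1 :: nat) + 1 = 2" "(1 :: nat) + 2 = 3" "(1 :: nat) + 3 = 4"
  "(1 :: nat) + 4 = 5" "(1 :: nat) + 5 = 6" "(1 :: nat) + 6 = 7" "(1 :: nat) + 7 = 8"
  "(2 :: nat) + 0 = 2" "(2 :: nat) + 1 = 3" "(2 :: nat) + 2 = 4" "(2 :: nat) + 3 = 5"
  "(2 :: nat) + 4 = 6" "(2 :: nat) + 5 = 7" "(2 :: nat) + 6 = 8" "(2 :: nat) + 7 = 9"
  "(3 :: nat) + 0 = 3" "(3 :: nat) + 1 = 4" "(3 :: nat) + 2 = 5" "(3 :: nat) + 3 = 6"
  "(3 :: nat) + 4 = 7" "(3 :: nat) + 5 = 8" "(3 :: nat) + 6 = 9" "(3 :: nat) + 7 = 10"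
  "(4 :: nat) + 0 = 4" "(4 :: nat) + 1 = 5" "(4 :: nat) + 2 = 6" "(4 :: nat) + 3 = 7"
  "(4 :: nat) + 4 = 8" "(4 :: nat) + 5 = 9" "(4 :: nat) + 6 = 10" "(4 :: nat) + 7 = 11"
  "(5 :: nat) + 0 = 5" "(5 :: nat) + 1 = 6" "(5 :: nat) + 2 = 7" "(5 :: nat) + 3 = 8"
  "(5 :: nat) + 4 = 9" "(5 :: nat) + 5 = 10" "(5 :: nat) + 6 = 11" "(5 :: nat) + 7 = 12"
  "(6 :: nat) + 0 = 6" "(6 :: nat) + 1 = 7" "(6 :: nat) + 2 = 8" "(6 :: nat) + 3 = 9"
  "(6 :: nat) + 4 = 10" "(6 :: nat) + 5 = 11" "(6 :: nat) + 6 = 12" "(6 :: nat) + 7 = 13"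
  "(7 :: nat) + 0 = 7" "(7 :: nat) + 1 = 8" "(7 :: nat) + 2 = 9" "(7 :: nat) + 3 = 10"
  "(7 :: nat) + 4 = 11" "(7 :: nat) + 5 = 12" "(7 :: nat) + 6 = 13" "(7 :: nat) + 7 = 14"
  "(8 :: nat) + 0 = 8" "(8 :: nat) + 1 = 9" "(8 :: nat) + 2 = 10" "(8 :: nat) + 3 = 11"
  "(8 :: nat) + 4 = 12" "(8 :: nat) + 5 = 13" "(8 :: nat) + 6 = 14" "(8 :: nat) + 7 = 15"
  "(9 :: nat) + 0 = 9" "(9 :: nat) + 1 = 10" "(9 :: nat) + 2 = 11" "(9 :: nat) + 3 = 12"
  "(9 :: nat) + 4 = 13" "(9 :: nat) + 5 = 14" "(9 :: nat) + 6 = 15" "(9 :: nat) + 7 = 16"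
  "(10 :: nat) + 0 = 10" "(10 :: nat) + 1 = 11" "(10 :: nat) + 2 = 12" "(10 :: nat) + 3 = 13"
  "(10 :: nat) + 4 = 14" "(10 :: nat) + 5 = 15" "(10 :: nat) + 6 = 16" "(10 :: nat) + 7 = 17"
  "(11 :: nat) + 0 = 11" "(11 :: nat) + 1 = 12" "(11 :: nat) + 2 = 13" "(11 :: nat) + 3 = 14"
  "(11 :: nat) + 4 = 15" "(11 :: nat) + 5 = 16" "(11 :: nat) + 6 = 17" "(11 :: nat) + 7 = 18"
  "(12 :: nat) + 0 = 12" "(12 :: nat) + 1 = 13" "(12 :: nat) + 2 = 14" "(12 :: nat) + 3 = 15"
  "(12 :: nat) + 4 = 16" "(12 :: nat) + 5 = 17" "(12 :: nat) + 6 = 18" "(12 :: nat) + 7 = 19"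
  "(13 :: nat) + 0 = 13" "(13 :: nat) + 1 = 14" "(13 :: nat) + 2 = 15" "(13 :: nat) + 3 = 16"
  "(13 :: nat) + 4 = 17" "(13 :: nat) + 5 = 18" "(13 :: nat) + 6 = 19" "(13 :: nat) + 7 = 20"
  "(14 :: nat) + 0 = 14" "(14 :: nat) + 1 = 15" "(14 :: nat) + 2 = 16" "(14 :: nat) + 3 = 17"
  "(14 :: nat) + 4 = 18" "(14 :: nat) + 5 = 19" "(14 :: nat) + 6 = 20" "(14 :: nat) + 7 = 21"
  "(15 :: nat) + 0 = 15" "(15 :: nat) + 1 = 16" "(15 :: nat) + 2 = 17" "(15 :: nat) + 3 = 18"
  "(15 :: nat) + 4 = 19" "(15 :: nat) + 5 = 20" "(15 :: nat) + 6 = 21" "(15 :: nat) + 7 = 22"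
  "(0 :: nat) - 0 = 0" "(1 :: nat) - 0 = 1" "(1 :: nat) - 1 = 0" "(2 :: nat) - 0 = 2"
  "(2 :: nat) - 1 = 1" "(2 :: nat) - 2 = 0" "(3 :: nat) - 0 = 3" "(3 :: nat) - 1 = 2"
  "(3 :: nat) - 2 = 1" "(3 :: nat) - 3 = 0" "(4 :: nat) - 0 = 4" "(4 :: nat) - 1 = 3"
  "(4 :: nat) - 2 = 2" "(4 :: nat) - 3 = 1" "(4 :: nat) - 4 = 0" "(5 :: nat) - 0 = 5"
  "(5 :: nat) - 1 = 4" "(5 :: nat) - 2 = 3" "(5 :: nat) - 3 = 2" "(5 :: nat) - 4 = 1"
  "(5 :: nat) - 5 = 0" "(6 :: nat) - 0 = 6" "(6 :: nat) - 1 = 5" "(6 :: nat) - 2 = 4"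
  "(6 :: nat) - 3 = 3" "(6 :: nat) - 4 = 2" "(6 :: nat) - 5 = 1" "(6 :: nat) - 6 = 0"
  "(7 :: nat) - 0 = 7" "(7 :: nat) - 1 = 6" "(7 :: nat) - 2 = 5" "(7 :: nat) - 3 = 4"
  "(7 :: nat) - 4 = 3" "(7 :: nat) - 5 = 2" "(7 :: nat) - 6 = 1" "(7 :: nat) - 7 = 0"
  by simp_all

lemma upt_table:
  "[0..<Suc 1] = [0, 1]" "[0..<Suc 2] = [0, 1, 2]" "[0..<Suc 3] = [0, 1, 2, 3]"
  "[0..<Suc 4] = [0, 1, 2, 3, 4]" "[0..<Suc 5] = [0, 1, 2, 3, 4, 5]"
  "[0..<Suc 6] = [0, 1, 2, 3, 4, 5, 6]" "[0..<Suc 7] = [0, 1, 2, 3, 4, 5, 6, 7]"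
  "[0..<16] = [0, 1, 2, 3, 4, 5, 6, 7, 8, 9, 10, 11, 12, 13, 14, 15]"
  by (simp_all add: upt_rec)

text \<open>A power whose total square contains x^n has exponent at most n, so each row of the table
  below comes from a finite list.\<close>

lemma sqstep_eq_filter:
  "sqstep v n \<longleftrightarrow> v \<in> set (filter (\<lambda>v. odd (v choose (n - v))) [0..<Suc n])"
  by (auto simp: sqstep_def less_Suc_eq_le)

lemma sqstep_table:
  "sqstep v 0 \<longleftrightarrow> v = 0"
  "sqstep v 1 \<longleftrightarrow> v = 1"
  "sqstep v 2 \<longleftrightarrow> v = 1 \<or> v = 2"
  "sqstep v 3 \<longleftrightarrow> v = 3"
  "sqstep v 4 \<longleftrightarrow> v = 2 \<or> v = 3 \<or> v = 4"
  "sqstep v 5 \<longleftrightarrow> v = 3 \<or> v = 5"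
  "sqstep v 6 \<longleftrightarrow> v = 3 \<or> v = 5 \<or> v = 6"
  "sqstep v 7 \<longleftrightarrow> v = 7"
  "sqstep v 8 \<longleftrightarrow> v = 4 \<or> v = 6 \<or> v = 7 \<or> v = 8"
  "sqstep v 9 \<longleftrightarrow> v = 5 \<or> v = 7 \<or> v = 9"
  "sqstep v 10 \<longleftrightarrow> v = 5 \<or> v = 6 \<or> v = 7 \<or> v = 9 \<or> v = 10"
  "sqstep v 11 \<longleftrightarrow> v = 7 \<or> v = 11"
  "sqstep v 12 \<longleftrightarrow> v = 6 \<or> v = 7 \<or> v = 10 \<or> v = 11 \<or> v = 12"
  "sqstep v 13 \<longleftrightarrow> v = 7 \<or> v = 11 \<or> v = 13"
  "sqstep v 14 \<longleftrightarrow> v = 7 \<or> v = 11 \<or> v = 13 \<or> v = 14"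
  "sqstep v 15 \<longleftrightarrow> v = 15"
  by (simp_all add: sqstep_eq_filter upt_rec eval_sqs binomial_eq_0)
    (simp_all add: numeral_eq_Suc)

lemmas evaluate = eval_list eval_length eval_weight eval_sqs eval_dual masks_5 arithmetic_table
  upt_table sqstep_table strict_Cons_def Let_def prod.case if_True if_False simp_thms rel_simps
  less_irrefl sqs.simps(2) even_count.simps list_less.simps weight_less.simps exactly.simps(2)
  irreducibles.simps is_prefix.simps dual_even.simps(2) dual_even_5 ascending.simps fst_conv snd_conv permute_def is_perm_def

lemma rules_certified: "list_all (\<lambda>(u, cs). list_all (\<lambda>(x, gs). certifies u x gs) cs) rules"
  by (simp only: rules_def certifies_def evaluate cong: eval_congs if_weak_cong let_weak_cong)

text \<open>The bound is counted down along the list, \<open>Num.BitM k\<close> being the binary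
  predecessor of \<open>num.Bit0 k\<close>; no length is ever computed.\<close>

lemma eval_length_le:
  "length [] \<le> n" "length (x # xs) \<le> 1 \<longleftrightarrow> length xs \<le> 0" "length (x # xs) \<le> 0 \<longleftrightarrow> False"
  "length (x # xs) \<le> numeral (num.Bit0 k) \<longleftrightarrow> length xs \<le> numeral (Num.BitM k)"
  "length (x # xs) \<le> numeral (num.Bit1 k) \<longleftrightarrow> length xs \<le> numeral (num.Bit0 k)"
  by (simp_all add: numeral_eq_Suc)

lemma irreducibles_count:
  "length (filter (list_all (\<lambda>n. n \<noteq> 0)) (irreducibles leads [4, 4, 3])) \<le> 75"
  "length (filter (list_all (\<lambda>n. n \<noteq> 0)) (irreducibles leads [4, 4, 1, 1])) \<le> 145"
  "length (filter (list_all (\<lambda>n. n \<noteq> 0)) (irreducibles leads [4, 2, 4])) \<le> 1"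
  "length (filter (list_all (\<lambda>n. n \<noteq> 0)) (irreducibles leads [4, 2, 2, 1])) \<le> 390"
  \<comment> \<open>The congruence rule for numerals is omitted here, because counting down the
    bound rewrites inside \<open>numeral\<close>.\<close>
  by (simp_all only: leads_def rules_def eval_length_le Num.BitM.simps evaluate
      cong: eval_congs(1,3-) if_weak_cong let_weak_cong)

subsection \<open>The annihilating sets\<close>

definition dual_443_1 :: "mono list \<times> mono list" where
  "dual_443_1 =
    ([[7, 7, 7, 2, 1], [7, 7, 7, 1, 2]],
     [])"

definition dual_443_2 :: "mono list \<times> mono list" where
  "dual_443_2 =
    ([[7, 2, 5, 7, 3], [7, 2, 3, 7, 5], [7, 1, 6, 7, 3], [7, 1, 3, 7, 6]],
     [])"

text \<open>Variables 1 and 3 run through all pairs of positive exponents with sum 7. If both are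
  replaced by one variable t, the functional reads off the coefficient of t^7 beside the fixed
  powers. It vanishes on hit polynomials because an exponent 2^m - 1 is reached only from itself.
  The two exponents have complementary digits, so all terms share one weight. Sums 3 and 15 give
  \<open>dual_443_1\<close>, \<open>dual_4411_1\<close>, \<open>dual_4411_8\<close> and
  \<open>dual_4221_9\<close> in the same way.\<close>

definition dual_443_3 :: "mono list \<times> mono list" where
  "dual_443_3 =
    ([[6, 7, 1, 3, 7], [5, 7, 2, 3, 7], [4, 7, 3, 3, 7], [3, 7, 4, 3, 7], [2, 7, 5, 3, 7],
      [1, 7, 6, 3, 7]],
     [])"

definition dual_443_4 :: "mono list \<times> mono list" where
  "dual_443_4 =
    ([[3, 6, 5, 3, 7], [3, 6, 3, 5, 7], [3, 5, 6, 3, 7], [3, 5, 3, 6, 7], [3, 3, 6, 5, 7],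
      [3, 3, 5, 6, 7]],
     [])"

lemmas dual_443_defs =
  dual_443_1_def dual_443_2_def dual_443_3_def dual_443_4_def

text \<open>Four sets in 75 arrangements of the variables, sorted by leading monomial as
  \<open>ascending\<close> demands.\<close>

definition functionals_443 :: "functional list" where
  "functionals_443 =
    [(dual_443_1, [3, 4, 0, 1, 2]), (dual_443_3, [0, 2, 3, 1, 4]), (dual_443_3, [0, 2, 1, 3, 4]),
     (dual_443_3, [0, 2, 1, 4, 3]), (dual_443_2, [1, 2, 4, 0, 3]), (dual_443_1, [3, 0, 4, 1, 2]),
     (dual_443_2, [2, 1, 4, 0, 3]), (dual_443_2, [2, 4, 1, 0, 3]), (dual_443_4, [1, 2, 3, 0, 4]),
     (dual_443_4, [1, 2, 3, 4, 0]), (dual_443_1, [0, 3, 4, 1, 2]), (dual_443_3, [0, 3, 2, 1, 4]),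
     (dual_443_3, [0, 1, 2, 3, 4]), (dual_443_3, [0, 1, 2, 4, 3]), (dual_443_3, [1, 0, 2, 3, 4]),
     (dual_443_3, [1, 0, 2, 4, 3]), (dual_443_2, [1, 2, 0, 4, 3]), (dual_443_2, [1, 0, 2, 4, 3]),
     (dual_443_1, [3, 0, 1, 4, 2]), (dual_443_2, [2, 1, 0, 4, 3]), (dual_443_4, [1, 2, 0, 3, 4]),
     (dual_443_2, [2, 4, 0, 1, 3]), (dual_443_4, [1, 2, 4, 3, 0]), (dual_443_2, [0, 1, 2, 4, 3]),
     (dual_443_1, [0, 3, 1, 4, 2]), (dual_443_4, [0, 1, 2, 3, 4]), (dual_443_2, [2, 0, 1, 4, 3]),
     (dual_443_2, [2, 0, 4, 1, 3]), (dual_443_4, [1, 4, 2, 3, 0]), (dual_443_2, [0, 2, 1, 4, 3]),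
     (dual_443_2, [0, 2, 4, 1, 3]), (dual_443_4, [4, 1, 2, 3, 0]), (dual_443_1, [0, 1, 3, 4, 2]),
     (dual_443_3, [0, 3, 1, 2, 4]), (dual_443_3, [0, 1, 3, 2, 4]), (dual_443_3, [0, 1, 4, 2, 3]),
     (dual_443_3, [1, 0, 3, 2, 4]), (dual_443_3, [1, 0, 4, 2, 3]), (dual_443_3, [1, 4, 0, 2, 3]),
     (dual_443_2, [1, 2, 0, 3, 4]), (dual_443_2, [1, 0, 2, 3, 4]), (dual_443_2, [1, 0, 3, 2, 4]),
     (dual_443_1, [3, 0, 1, 2, 4]), (dual_443_2, [2, 1, 0, 3, 4]), (dual_443_4, [1, 2, 0, 4, 3]),
     (dual_443_4, [1, 2, 4, 0, 3]), (dual_443_2, [2, 4, 0, 3, 1]), (dual_443_2, [0, 1, 2, 3, 4]),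
     (dual_443_2, [0, 1, 3, 2, 4]), (dual_443_1, [0, 3, 1, 2, 4]), (dual_443_4, [0, 1, 2, 4, 3]),
     (dual_443_2, [2, 0, 1, 3, 4]), (dual_443_4, [1, 4, 2, 0, 3]), (dual_443_2, [2, 0, 4, 3, 1]),
     (dual_443_2, [0, 2, 1, 3, 4]), (dual_443_4, [4, 1, 2, 0, 3]), (dual_443_2, [0, 2, 4, 3, 1]),
     (dual_443_2, [0, 3, 1, 2, 4]), (dual_443_1, [0, 1, 3, 2, 4]), (dual_443_4, [0, 1, 4, 2, 3]),
     (dual_443_4, [0, 4, 1, 2, 3]), (dual_443_2, [2, 0, 3, 1, 4]), (dual_443_2, [2, 0, 3, 4, 1]),
     (dual_443_4, [4, 0, 1, 2, 3]), (dual_443_2, [0, 2, 3, 1, 4]), (dual_443_2, [0, 2, 3, 4, 1]),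
     (dual_443_2, [0, 3, 2, 1, 4]), (dual_443_2, [0, 3, 2, 4, 1]), (dual_443_1, [0, 1, 2, 3, 4]),
     (dual_443_3, [0, 3, 1, 4, 2]), (dual_443_3, [0, 1, 3, 4, 2]), (dual_443_3, [0, 1, 4, 3, 2]),
     (dual_443_3, [1, 0, 3, 4, 2]), (dual_443_3, [1, 0, 4, 3, 2]), (dual_443_3, [1, 4, 0, 3, 2])]"

section \<open>Functionals for the weight (4,4,1,1)\<close>

definition dual_4411_1 :: "mono list \<times> mono list" where
  "dual_4411_1 =
    ([[2, 3, 15, 1, 3], [1, 3, 15, 2, 3]],
     [])"

definition dual_4411_2 :: "mono list \<times> mono list" where
  "dual_4411_2 =
    ([[3, 11, 2, 1, 7], [3, 11, 1, 2, 7], [3, 7, 2, 1, 11], [3, 7, 1, 2, 11]],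
     [])"

definition dual_4411_3 :: "mono list \<times> mono list" where
  "dual_4411_3 =
    ([[14, 3, 3, 3, 1], [13, 3, 3, 3, 2], [11, 6, 3, 3, 1], [11, 5, 3, 3, 2], [7, 10, 3, 3, 1],
      [7, 9, 3, 3, 2]],
     [[7, 7, 3, 6, 1], [7, 7, 3, 5, 2]])"

definition dual_4411_4 :: "mono list \<times> mono list" where
  "dual_4411_4 =
    ([[11, 6, 1, 3, 3], [11, 5, 2, 3, 3], [11, 3, 2, 5, 3], [11, 3, 1, 6, 3], [7, 10, 1, 3, 3],
      [7, 9, 2, 3, 3], [7, 3, 2, 9, 3], [7, 3, 1, 10, 3]],
     [[7, 7, 2, 5, 3], [7, 7, 1, 6, 3], [7, 6, 1, 7, 3], [7, 5, 2, 7, 3]])"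

definition dual_4411_5 :: "mono list \<times> mono list" where
  "dual_4411_5 =
    ([[11, 3, 6, 3, 1], [11, 3, 5, 3, 2], [11, 3, 4, 3, 3], [11, 3, 3, 3, 4], [11, 3, 2, 3, 5],
      [11, 3, 1, 3, 6], [7, 3, 10, 3, 1], [7, 3, 9, 3, 2], [7, 3, 8, 3, 3], [7, 3, 3, 3, 8],
      [7, 3, 2, 3, 9], [7, 3, 1, 3, 10]],
     [[7, 3, 7, 3, 4], [7, 3, 6, 3, 5], [7, 3, 5, 3, 6], [7, 3, 4, 3, 7]])"

definition dual_4411_6 :: "mono list \<times> mono list" where
  "dual_4411_6 =
    ([[10, 3, 5, 3, 3], [10, 3, 3, 5, 3], [9, 3, 6, 3, 3], [9, 3, 3, 6, 3], [6, 3, 9, 3, 3],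
      [6, 3, 3, 9, 3], [5, 3, 10, 3, 3], [5, 3, 3, 10, 3], [3, 3, 10, 5, 3], [3, 3, 9, 6, 3],
      [3, 3, 6, 9, 3], [3, 3, 5, 10, 3]],
     [[7, 3, 6, 5, 3], [7, 3, 5, 6, 3], [6, 3, 7, 5, 3], [6, 3, 5, 7, 3], [5, 3, 7, 6, 3],
      [5, 3, 6, 7, 3]])"

definition dual_4411_7 :: "mono list \<times> mono list" where
  "dual_4411_7 =
    ([[14, 3, 1, 3, 3], [13, 3, 2, 3, 3], [12, 3, 3, 3, 3], [11, 3, 4, 3, 3], [10, 3, 5, 3, 3],
      [9, 3, 6, 3, 3], [7, 3, 8, 3, 3], [6, 3, 9, 3, 3], [5, 3, 10, 3, 3], [3, 8, 7, 3, 3],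
      [3, 4, 11, 3, 3], [3, 3, 12, 3, 3], [3, 2, 13, 3, 3], [3, 1, 14, 3, 3]],
     [[7, 6, 7, 1, 3], [7, 5, 7, 2, 3], [7, 3, 7, 4, 3], [6, 5, 7, 3, 3], [5, 6, 7, 3, 3],
      [3, 7, 7, 6, 1], [3, 7, 7, 5, 2], [3, 7, 7, 3, 4]])"

definition dual_4411_8 :: "mono list \<times> mono list" where
  "dual_4411_8 =
    ([[3, 14, 3, 3, 1], [3, 13, 3, 3, 2], [3, 12, 3, 3, 3], [3, 11, 3, 3, 4], [3, 10, 3, 3, 5],
      [3, 9, 3, 3, 6], [3, 8, 3, 3, 7], [3, 7, 3, 3, 8], [3, 6, 3, 3, 9], [3, 5, 3, 3, 10],
      [3, 4, 3, 3, 11], [3, 3, 3, 3, 12], [3, 2, 3, 3, 13], [3, 1, 3, 3, 14]],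
     [])"

lemmas dual_4411_defs =
  dual_4411_1_def dual_4411_2_def dual_4411_3_def dual_4411_4_def dual_4411_5_def dual_4411_6_def
  dual_4411_7_def dual_4411_8_def

definition functionals_4411 :: "functional list" where
  "functionals_4411 =
    [(dual_4411_1, [0, 3, 1, 4, 2]), (dual_4411_2, [2, 3, 0, 1, 4]), (dual_4411_1, [0, 3, 1, 2, 4]),
     (dual_4411_2, [2, 3, 1, 0, 4]), (dual_4411_2, [2, 3, 1, 4, 0]), (dual_4411_1, [0, 3, 2, 1, 4]),
     (dual_4411_5, [2, 4, 1, 3, 0]), (dual_4411_5, [2, 4, 1, 0, 3]), (dual_4411_5, [2, 4, 0, 1, 3]),
     (dual_4411_8, [1, 4, 0, 2, 3]), (dual_4411_1, [0, 1, 3, 4, 2]), (dual_4411_2, [2, 0, 3, 1, 4]),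
     (dual_4411_1, [0, 1, 3, 2, 4]), (dual_4411_4, [2, 1, 3, 4, 0]), (dual_4411_4, [2, 1, 3, 0, 4]),
     (dual_4411_3, [4, 1, 0, 2, 3]), (dual_4411_2, [2, 1, 3, 0, 4]), (dual_4411_2, [2, 1, 3, 4, 0]),
     (dual_4411_3, [4, 0, 1, 2, 3]), (dual_4411_1, [0, 2, 3, 1, 4]), (dual_4411_1, [1, 0, 3, 4, 2]),
     (dual_4411_2, [0, 2, 3, 1, 4]), (dual_4411_1, [1, 0, 3, 2, 4]), (dual_4411_4, [1, 2, 3, 4, 0]),
     (dual_4411_4, [1, 2, 3, 0, 4]), (dual_4411_3, [1, 4, 0, 2, 3]), (dual_4411_4, [1, 3, 2, 4, 0]),
     (dual_4411_4, [1, 3, 2, 0, 4]), (dual_4411_6, [0, 2, 3, 1, 4]), (dual_4411_3, [1, 0, 4, 2, 3]),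
     (dual_4411_2, [1, 2, 3, 0, 4]), (dual_4411_2, [1, 2, 3, 4, 0]), (dual_4411_3, [0, 4, 1, 2, 3]),
     (dual_4411_3, [0, 1, 4, 2, 3]), (dual_4411_1, [2, 0, 3, 1, 4]), (dual_4411_5, [1, 2, 4, 3, 0]),
     (dual_4411_5, [1, 2, 4, 0, 3]), (dual_4411_7, [1, 2, 0, 3, 4]), (dual_4411_5, [2, 0, 4, 1, 3]),
     (dual_4411_5, [0, 2, 4, 1, 3]), (dual_4411_1, [0, 1, 4, 3, 2]), (dual_4411_4, [2, 1, 4, 3, 0]),
     (dual_4411_3, [4, 1, 2, 0, 3]), (dual_4411_2, [2, 0, 1, 3, 4]), (dual_4411_3, [4, 2, 0, 1, 3]),
     (dual_4411_1, [0, 1, 2, 3, 4]), (dual_4411_2, [2, 1, 0, 3, 4]), (dual_4411_3, [4, 0, 2, 1, 3]),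
     (dual_4411_2, [2, 1, 4, 3, 0]), (dual_4411_1, [0, 2, 1, 3, 4]), (dual_4411_1, [1, 0, 4, 3, 2]),
     (dual_4411_4, [1, 2, 4, 3, 0]), (dual_4411_3, [1, 4, 2, 0, 3]), (dual_4411_2, [0, 2, 1, 3, 4]),
     (dual_4411_3, [2, 4, 0, 1, 3]), (dual_4411_1, [1, 0, 2, 3, 4]), (dual_4411_4, [1, 3, 4, 2, 0]),
     (dual_4411_6, [0, 2, 1, 3, 4]), (dual_4411_4, [1, 3, 0, 2, 4]), (dual_4411_3, [1, 0, 2, 4, 3]),
     (dual_4411_2, [1, 2, 0, 3, 4]), (dual_4411_3, [0, 4, 2, 1, 3]), (dual_4411_2, [1, 2, 4, 3, 0]),
     (dual_4411_3, [0, 1, 2, 4, 3]), (dual_4411_1, [2, 0, 1, 3, 4]), (dual_4411_1, [1, 4, 0, 3, 2]),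
     (dual_4411_4, [1, 4, 2, 3, 0]), (dual_4411_3, [1, 2, 4, 0, 3]), (dual_4411_4, [1, 4, 3, 2, 0]),
     (dual_4411_6, [0, 1, 2, 3, 4]), (dual_4411_3, [1, 2, 0, 4, 3]), (dual_4411_2, [0, 1, 2, 3, 4]),
     (dual_4411_3, [2, 0, 4, 1, 3]), (dual_4411_3, [2, 0, 1, 4, 3]), (dual_4411_1, [1, 2, 0, 3, 4]),
     (dual_4411_2, [1, 0, 2, 3, 4]), (dual_4411_3, [0, 2, 4, 1, 3]), (dual_4411_3, [0, 2, 1, 4, 3]),
     (dual_4411_2, [1, 4, 2, 3, 0]), (dual_4411_1, [2, 1, 0, 3, 4]), (dual_4411_5, [1, 2, 3, 4, 0]),
     (dual_4411_7, [1, 2, 3, 0, 4]), (dual_4411_5, [1, 2, 0, 4, 3]), (dual_4411_5, [1, 0, 2, 4, 3]),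
     (dual_4411_5, [0, 1, 2, 4, 3]), (dual_4411_3, [4, 1, 2, 3, 0]), (dual_4411_3, [4, 2, 3, 0, 1]),
     (dual_4411_1, [0, 1, 4, 2, 3]), (dual_4411_3, [4, 2, 0, 3, 1]), (dual_4411_2, [2, 0, 1, 4, 3]),
     (dual_4411_1, [0, 1, 2, 4, 3]), (dual_4411_3, [4, 0, 2, 3, 1]), (dual_4411_2, [2, 1, 0, 4, 3]),
     (dual_4411_2, [2, 1, 4, 0, 3]), (dual_4411_1, [0, 2, 1, 4, 3]), (dual_4411_3, [1, 4, 2, 3, 0]),
     (dual_4411_3, [2, 4, 3, 0, 1]), (dual_4411_1, [1, 0, 4, 2, 3]), (dual_4411_3, [2, 4, 0, 3, 1]),
     (dual_4411_2, [0, 2, 1, 4, 3]), (dual_4411_1, [1, 0, 2, 4, 3]), (dual_4411_6, [0, 2, 1, 4, 3]),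
     (dual_4411_4, [1, 3, 4, 0, 2]), (dual_4411_4, [1, 3, 0, 4, 2]), (dual_4411_3, [1, 0, 2, 3, 4]),
     (dual_4411_3, [0, 4, 2, 3, 1]), (dual_4411_2, [1, 2, 0, 4, 3]), (dual_4411_2, [1, 2, 4, 0, 3]),
     (dual_4411_3, [0, 1, 2, 3, 4]), (dual_4411_1, [2, 0, 1, 4, 3]), (dual_4411_3, [1, 2, 4, 3, 0]),
     (dual_4411_3, [2, 3, 4, 0, 1]), (dual_4411_1, [1, 4, 0, 2, 3]), (dual_4411_6, [0, 1, 2, 4, 3]),
     (dual_4411_4, [1, 4, 3, 0, 2]), (dual_4411_3, [1, 2, 0, 3, 4]), (dual_4411_3, [2, 0, 4, 3, 1]),
     (dual_4411_2, [0, 1, 2, 4, 3]), (dual_4411_3, [2, 0, 1, 3, 4]), (dual_4411_1, [1, 2, 0, 4, 3]),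
     (dual_4411_3, [0, 2, 4, 3, 1]), (dual_4411_2, [1, 0, 2, 4, 3]), (dual_4411_3, [0, 2, 1, 3, 4]),
     (dual_4411_2, [1, 4, 2, 0, 3]), (dual_4411_1, [2, 1, 0, 4, 3]), (dual_4411_3, [1, 2, 3, 4, 0]),
     (dual_4411_6, [0, 1, 4, 2, 3]), (dual_4411_3, [1, 2, 3, 0, 4]), (dual_4411_3, [2, 3, 0, 4, 1]),
     (dual_4411_3, [2, 3, 0, 1, 4]), (dual_4411_1, [1, 4, 2, 0, 3]), (dual_4411_3, [2, 0, 3, 4, 1]),
     (dual_4411_3, [2, 0, 3, 1, 4]), (dual_4411_2, [0, 1, 4, 2, 3]), (dual_4411_1, [1, 2, 4, 0, 3]),
     (dual_4411_3, [0, 2, 3, 4, 1]), (dual_4411_3, [0, 2, 3, 1, 4]), (dual_4411_2, [1, 0, 4, 2, 3]),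
     (dual_4411_2, [1, 4, 0, 2, 3]), (dual_4411_1, [2, 1, 4, 0, 3]), (dual_4411_7, [1, 2, 3, 4, 0]),
     (dual_4411_5, [1, 2, 3, 0, 4]), (dual_4411_5, [1, 2, 0, 3, 4]), (dual_4411_5, [1, 0, 2, 3, 4]),
     (dual_4411_5, [0, 1, 2, 3, 4])]"

section \<open>The functional for the weight (4,2,4)\<close>

definition dual_424_1 :: "mono list \<times> mono list" where
  "dual_424_1 =
    ([[6, 5, 5, 5, 3], [6, 5, 5, 3, 5], [6, 5, 3, 5, 5], [6, 3, 5, 5, 5], [5, 6, 5, 5, 3],
      [5, 6, 5, 3, 5], [5, 6, 3, 5, 5], [5, 5, 6, 5, 3], [5, 5, 6, 3, 5], [5, 5, 5, 6, 3],
      [5, 5, 5, 3, 6], [5, 5, 3, 6, 5], [5, 5, 3, 5, 6], [5, 3, 6, 5, 5], [5, 3, 5, 6, 5],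
      [5, 3, 5, 5, 6], [3, 6, 5, 5, 5], [3, 5, 6, 5, 5], [3, 5, 5, 6, 5], [3, 5, 5, 5, 6]],
     [[6, 7, 3, 3, 5], [6, 3, 7, 5, 3], [6, 3, 5, 3, 7], [6, 3, 3, 7, 5], [5, 7, 3, 3, 6],
      [5, 3, 7, 6, 3], [5, 3, 6, 3, 7], [5, 3, 3, 7, 6], [3, 7, 6, 5, 3], [3, 7, 5, 6, 3],
      [6, 9, 3, 3, 3], [6, 3, 9, 3, 3], [6, 3, 3, 9, 3], [6, 3, 3, 3, 9], [5, 10, 3, 3, 3],
      [5, 3, 10, 3, 3], [5, 3, 3, 10, 3], [5, 3, 3, 3, 10], [3, 10, 5, 3, 3], [3, 10, 3, 5, 3],
      [3, 10, 3, 3, 5], [3, 9, 6, 3, 3], [3, 9, 3, 6, 3], [3, 9, 3, 3, 6], [3, 3, 10, 5, 3],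
      [3, 3, 9, 6, 3], [3, 3, 6, 3, 9], [3, 3, 5, 3, 10], [3, 3, 3, 10, 5], [3, 3, 3, 9, 6]])"

lemmas dual_424_defs =
  dual_424_1_def

text \<open>The terms of weight (4,2,4) are all 20 arrangements of the exponents 6, 5, 5, 5, 3. The
  largest is \<open>[3, 5, 5, 5, 6]\<close>, which is reducible: halved it is
  \<open>[1, 2, 2, 2, 3]\<close>, a rule for (2,4). So leading monomials of functionals and
  irreducible monomials do differ.\<close>

definition functionals_424 :: "functional list" where
  "functionals_424 =
    [(dual_424_1, [0, 1, 2, 3, 4])]"

section \<open>Functionals for the weight (4,2,2,1)\<close>

definition dual_4221_1 :: "mono list \<times> mono list" where
  "dual_4221_1 =
    ([[4, 15, 1, 1, 3], [2, 15, 1, 1, 5], [1, 15, 1, 1, 6]],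
     [[3, 15, 2, 1, 3]])"

definition dual_4221_2 :: "mono list \<times> mono list" where
  "dual_4221_2 =
    ([[4, 15, 1, 3, 1], [2, 15, 1, 5, 1], [1, 15, 1, 5, 2], [1, 15, 1, 3, 4]],
     [[3, 15, 1, 3, 2], [2, 15, 1, 3, 3]])"

definition dual_4221_3 :: "mono list \<times> mono list" where
  "dual_4221_3 =
    ([[14, 7, 1, 1, 1], [13, 7, 1, 2, 1], [11, 7, 1, 4, 1], [7, 14, 1, 1, 1], [7, 13, 1, 2, 1],
      [7, 11, 1, 4, 1]],
     [[11, 7, 2, 3, 1], [7, 11, 2, 3, 1]])"

definition dual_4221_4 :: "mono list \<times> mono list" where
  "dual_4221_4 =
    ([[5, 3, 1, 14, 1], [3, 5, 1, 14, 1], [5, 3, 1, 13, 2], [5, 3, 1, 11, 4], [5, 3, 1, 7, 8],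
      [3, 5, 1, 13, 2], [3, 5, 1, 11, 4], [3, 5, 1, 7, 8]],
     [[6, 3, 5, 7, 3], [6, 3, 3, 7, 5], [5, 6, 3, 7, 3], [5, 3, 6, 7, 3], [5, 3, 2, 7, 7],
      [3, 6, 3, 7, 5], [3, 6, 1, 7, 7], [3, 4, 7, 7, 3], [3, 2, 7, 7, 5], [3, 1, 7, 7, 6],
      [5, 3, 2, 11, 3], [3, 5, 2, 11, 3], [3, 3, 8, 7, 3], [3, 3, 2, 7, 9], [3, 3, 1, 7, 10],
      [5, 5, 4, 7, 3], [5, 5, 2, 7, 5], [5, 5, 1, 7, 6], [5, 3, 4, 7, 5], [3, 5, 4, 7, 5]])"

definition dual_4221_5 :: "mono list \<times> mono list" where
  "dual_4221_5 =
    ([[4, 11, 7, 1, 1], [4, 7, 11, 1, 1], [2, 13, 7, 1, 1], [2, 7, 13, 1, 1], [1, 13, 7, 1, 2],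
      [1, 11, 7, 1, 4], [1, 7, 13, 1, 2], [1, 7, 11, 1, 4]],
     [[3, 11, 7, 2, 1], [3, 7, 11, 2, 1], [1, 11, 7, 2, 3], [1, 7, 11, 2, 3]])"

definition dual_4221_6 :: "mono list \<times> mono list" where
  "dual_4221_6 =
    ([[14, 1, 1, 5, 3], [14, 1, 1, 3, 5], [13, 1, 4, 3, 3], [13, 1, 2, 5, 3], [13, 1, 1, 3, 6],
      [11, 1, 4, 3, 5], [11, 1, 2, 5, 5], [11, 1, 1, 5, 6], [7, 1, 4, 3, 9], [7, 1, 2, 5, 9],
      [7, 1, 1, 5, 10], [7, 1, 1, 3, 12]],
     [[7, 1, 3, 6, 7], [14, 1, 3, 3, 3], [11, 1, 3, 3, 6], [7, 1, 3, 3, 10], [7, 1, 2, 3, 11],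
      [7, 1, 4, 5, 7]])"

definition dual_4221_7 :: "mono list \<times> mono list" where
  "dual_4221_7 =
    ([[14, 1, 1, 1, 7], [13, 1, 6, 1, 3], [13, 1, 5, 2, 3], [13, 1, 3, 4, 3], [13, 1, 2, 1, 7],
      [11, 1, 6, 1, 5], [11, 1, 5, 2, 5], [11, 1, 4, 1, 7], [11, 1, 3, 4, 5], [7, 1, 8, 1, 7],
      [7, 1, 6, 1, 9], [7, 1, 5, 2, 9], [7, 1, 3, 4, 9]],
     [[7, 1, 7, 2, 7], [7, 1, 6, 3, 7], [14, 1, 3, 3, 3], [11, 1, 3, 3, 6], [11, 1, 3, 2, 7],
      [7, 1, 3, 3, 10], [7, 1, 5, 4, 7]])"

definition dual_4221_8 :: "mono list \<times> mono list" where
  "dual_4221_8 =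
    ([[13, 3, 1, 6, 1], [11, 5, 1, 6, 1], [7, 5, 1, 10, 1], [7, 3, 1, 12, 1], [13, 3, 1, 5, 2],
      [13, 3, 1, 3, 4], [11, 5, 1, 5, 2], [7, 5, 1, 9, 2], [11, 5, 1, 3, 4], [7, 5, 1, 3, 8],
      [7, 3, 1, 9, 4], [7, 3, 1, 5, 8]],
     [[7, 6, 1, 3, 7], [7, 5, 3, 6, 3], [7, 5, 3, 3, 6], [7, 5, 2, 7, 3], [7, 3, 7, 4, 3],
      [7, 3, 7, 2, 5], [7, 3, 7, 1, 6], [7, 3, 6, 3, 5], [7, 3, 5, 3, 6], [7, 3, 3, 6, 5],
      [7, 3, 2, 5, 7], [13, 3, 2, 3, 3], [11, 5, 2, 3, 3], [7, 3, 8, 3, 3], [7, 3, 2, 9, 3],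
      [7, 3, 2, 3, 9], [7, 3, 1, 11, 2], [7, 3, 1, 3, 10], [7, 5, 4, 5, 3], [7, 5, 4, 3, 5],
      [7, 5, 2, 5, 5], [7, 5, 1, 7, 4], [7, 5, 1, 5, 6], [7, 3, 4, 5, 5]])"

definition dual_4221_9 :: "mono list \<times> mono list" where
  "dual_4221_9 =
    ([[14, 7, 1, 1, 1], [13, 7, 1, 2, 1], [12, 7, 1, 3, 1], [11, 7, 1, 4, 1], [10, 7, 1, 5, 1],
      [9, 7, 1, 6, 1], [8, 7, 1, 7, 1], [7, 7, 1, 8, 1], [6, 7, 1, 9, 1], [5, 7, 1, 10, 1],
      [4, 7, 1, 11, 1], [3, 7, 1, 12, 1], [2, 7, 1, 13, 1], [1, 7, 1, 14, 1]],
     [])"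

definition dual_4221_10 :: "mono list \<times> mono list" where
  "dual_4221_10 =
    ([[13, 1, 6, 1, 3], [13, 1, 5, 2, 3], [13, 1, 3, 4, 3], [11, 1, 6, 1, 5], [11, 1, 5, 2, 5],
      [11, 1, 3, 4, 5], [9, 1, 6, 1, 7], [9, 1, 5, 2, 7], [9, 1, 3, 4, 7], [7, 1, 6, 1, 9],
      [7, 1, 5, 2, 9], [7, 1, 3, 4, 9], [5, 1, 6, 1, 11], [5, 1, 5, 2, 11], [5, 1, 3, 4, 11],
      [3, 1, 6, 1, 13], [3, 1, 5, 2, 13], [3, 1, 3, 4, 13]],
     [[14, 1, 3, 3, 3], [11, 1, 3, 3, 6], [10, 1, 3, 3, 7], [7, 1, 3, 3, 10], [6, 1, 3, 3, 11],
      [3, 1, 3, 3, 14]])"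

definition dual_4221_11 :: "mono list \<times> mono list" where
  "dual_4221_11 =
    ([[1, 6, 9, 3, 5], [1, 10, 5, 3, 5], [1, 6, 9, 5, 3], [1, 10, 5, 5, 3], [1, 12, 3, 3, 5],
      [1, 12, 3, 5, 3], [2, 5, 9, 3, 5], [2, 9, 5, 3, 5], [2, 5, 9, 5, 3], [2, 9, 5, 5, 3],
      [4, 3, 9, 3, 5], [8, 3, 5, 3, 5], [4, 3, 9, 5, 3], [8, 3, 5, 5, 3], [4, 9, 3, 3, 5],
      [8, 5, 3, 3, 5], [4, 9, 3, 5, 3], [8, 5, 3, 5, 3]],
     [[7, 5, 3, 6, 3], [7, 5, 3, 3, 6], [7, 3, 6, 5, 3], [7, 3, 6, 3, 5], [7, 3, 3, 6, 5],
      [7, 3, 3, 5, 6], [6, 7, 3, 3, 5], [6, 3, 7, 5, 3], [5, 7, 3, 3, 6], [5, 3, 7, 6, 3],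
      [3, 7, 6, 5, 3], [3, 7, 5, 3, 6], [3, 3, 7, 6, 5], [2, 7, 7, 5, 3], [1, 7, 7, 6, 3],
      [6, 9, 3, 3, 3], [6, 3, 9, 3, 3], [5, 10, 3, 3, 3], [5, 3, 10, 3, 3], [4, 3, 11, 3, 3],
      [3, 10, 5, 3, 3], [3, 10, 3, 5, 3], [3, 10, 3, 3, 5], [3, 9, 6, 3, 3], [3, 3, 12, 3, 3],
      [3, 3, 10, 5, 3], [3, 3, 10, 3, 5], [2, 11, 3, 5, 3], [2, 11, 3, 3, 5], [2, 9, 7, 3, 3],
      [2, 3, 13, 3, 3], [1, 10, 7, 3, 3], [1, 3, 14, 3, 3], [6, 5, 3, 5, 5], [6, 3, 5, 5, 5],
      [5, 6, 5, 5, 3], [5, 6, 5, 3, 5], [5, 6, 3, 5, 5], [5, 5, 6, 5, 3], [5, 5, 6, 3, 5],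
      [5, 3, 6, 5, 5], [4, 7, 5, 5, 3], [4, 7, 5, 3, 5], [4, 3, 7, 5, 5], [3, 6, 5, 5, 5],
      [3, 5, 6, 5, 5], [2, 5, 7, 5, 5], [1, 6, 7, 5, 5]])"

definition dual_4221_12 :: "mono list \<times> mono list" where
  "dual_4221_12 =
    ([[13, 1, 2, 5, 3], [13, 1, 2, 3, 5], [11, 1, 4, 5, 3], [7, 1, 4, 9, 3], [11, 1, 4, 3, 5],
      [7, 1, 4, 3, 9], [7, 1, 2, 9, 5], [7, 1, 2, 5, 9], [13, 1, 1, 6, 3], [7, 1, 1, 12, 3],
      [11, 1, 1, 6, 5], [7, 1, 1, 10, 5], [13, 1, 1, 3, 6], [11, 1, 1, 5, 6], [7, 1, 1, 5, 10],
      [7, 1, 1, 3, 12]],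
     [[7, 2, 3, 7, 5], [7, 2, 3, 5, 7], [11, 2, 3, 5, 3], [11, 2, 3, 3, 5], [7, 2, 3, 9, 3],
      [7, 2, 3, 3, 9], [7, 1, 2, 11, 3], [7, 1, 2, 3, 11], [7, 1, 4, 7, 5], [7, 1, 4, 5, 7]])"

definition dual_4221_13 :: "mono list \<times> mono list" where
  "dual_4221_13 =
    ([[1, 1, 8, 7, 7], [1, 1, 6, 13, 3], [1, 1, 6, 11, 5], [1, 1, 6, 7, 9], [1, 1, 5, 14, 3],
      [1, 1, 5, 11, 6], [1, 1, 5, 7, 10], [1, 1, 4, 7, 11], [1, 1, 3, 14, 5], [1, 1, 3, 13, 6],
      [1, 1, 3, 7, 12], [1, 1, 2, 7, 13], [1, 1, 1, 7, 14]],
     [[1, 2, 7, 7, 7]])"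

definition dual_4221_14 :: "mono list \<times> mono list" where
  "dual_4221_14 =
    ([[3, 4, 1, 9, 7], [3, 8, 1, 5, 7], [5, 2, 1, 9, 7], [1, 6, 1, 9, 7], [9, 2, 1, 5, 7],
      [1, 10, 1, 5, 7], [1, 2, 1, 13, 7], [5, 8, 1, 3, 7], [9, 4, 1, 3, 7], [1, 12, 1, 3, 7],
      [1, 4, 1, 11, 7], [1, 8, 1, 7, 7], [6, 1, 1, 9, 7], [2, 5, 1, 9, 7], [10, 1, 1, 5, 7],
      [2, 9, 1, 5, 7], [2, 1, 1, 13, 7], [4, 3, 1, 9, 7], [8, 3, 1, 5, 7], [12, 1, 1, 3, 7],
      [4, 9, 1, 3, 7], [4, 1, 1, 11, 7], [8, 5, 1, 3, 7], [8, 1, 1, 7, 7]],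
     [[7, 6, 1, 3, 7], [7, 1, 2, 7, 7], [6, 7, 1, 3, 7], [5, 3, 2, 7, 7], [3, 5, 2, 7, 7],
      [1, 7, 2, 7, 7], [11, 2, 1, 3, 7], [10, 3, 1, 3, 7], [3, 10, 1, 3, 7], [3, 2, 1, 11, 7],
      [2, 11, 1, 3, 7], [2, 3, 1, 11, 7], [7, 4, 1, 5, 7], [6, 5, 1, 5, 7], [5, 6, 1, 5, 7],
      [5, 4, 1, 7, 7], [4, 7, 1, 5, 7], [4, 5, 1, 7, 7]])"

definition dual_4221_15 :: "mono list \<times> mono list" where
  "dual_4221_15 =
    ([[5, 3, 1, 12, 3], [5, 3, 1, 10, 5], [5, 3, 1, 6, 9], [5, 3, 1, 14, 1], [3, 5, 1, 12, 3],
      [3, 5, 1, 10, 5], [3, 5, 1, 6, 9], [3, 5, 1, 14, 1], [5, 3, 1, 9, 6], [5, 3, 1, 5, 10],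
      [5, 3, 1, 13, 2], [5, 3, 1, 3, 12], [5, 3, 1, 11, 4], [5, 3, 1, 7, 8], [3, 5, 1, 9, 6],
      [3, 5, 1, 5, 10], [3, 5, 1, 13, 2], [3, 5, 1, 3, 12], [3, 5, 1, 11, 4], [3, 5, 1, 7, 8]],
     [[6, 3, 7, 1, 7], [5, 6, 3, 3, 7], [5, 3, 7, 2, 7], [5, 3, 3, 6, 7], [5, 3, 2, 7, 7],
      [3, 6, 5, 3, 7], [3, 6, 1, 7, 7], [3, 5, 6, 3, 7], [3, 5, 3, 6, 7], [3, 3, 7, 4, 7],
      [5, 3, 2, 3, 11], [3, 5, 2, 3, 11], [3, 3, 8, 3, 7], [3, 3, 2, 9, 7], [3, 3, 1, 10, 7],
      [5, 5, 4, 3, 7], [5, 5, 2, 5, 7], [5, 5, 1, 6, 7], [5, 3, 4, 5, 7], [3, 5, 4, 5, 7]])"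

definition dual_4221_16 :: "mono list \<times> mono list" where
  "dual_4221_16 =
    ([[5, 1, 10, 5, 3], [5, 1, 6, 9, 3], [5, 1, 10, 3, 5], [5, 1, 6, 3, 9], [3, 1, 12, 5, 3],
      [3, 1, 12, 3, 5], [3, 1, 6, 9, 5], [3, 1, 6, 5, 9], [5, 1, 9, 6, 3], [5, 1, 5, 10, 3],
      [5, 1, 3, 10, 5], [5, 1, 3, 6, 9], [3, 1, 5, 12, 3], [3, 1, 9, 6, 5], [3, 1, 5, 6, 9],
      [3, 1, 3, 12, 5], [5, 1, 9, 3, 6], [5, 1, 5, 3, 10], [5, 1, 3, 9, 6], [5, 1, 3, 5, 10],
      [3, 1, 9, 5, 6], [3, 1, 5, 9, 6], [3, 1, 5, 3, 12], [3, 1, 3, 5, 12]],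
     [[3, 1, 11, 6, 3], [3, 1, 11, 3, 6], [3, 1, 6, 11, 3], [3, 1, 6, 3, 11], [3, 1, 3, 11, 6],
      [3, 1, 3, 6, 11], [5, 1, 7, 6, 5], [5, 1, 7, 5, 6], [5, 1, 6, 7, 5], [5, 1, 6, 5, 7],
      [5, 1, 5, 7, 6], [5, 1, 5, 6, 7]])"

definition dual_4221_17 :: "mono list \<times> mono list" where
  "dual_4221_17 =
    ([[3, 5, 6, 1, 9], [3, 5, 10, 1, 5], [3, 5, 12, 1, 3], [5, 3, 6, 1, 9], [5, 3, 10, 1, 5],
      [5, 3, 12, 1, 3], [3, 6, 5, 1, 9], [3, 6, 9, 1, 5], [5, 6, 3, 1, 9], [9, 6, 3, 1, 5],
      [5, 6, 9, 1, 3], [9, 6, 5, 1, 3], [6, 3, 5, 1, 9], [6, 3, 9, 1, 5], [6, 5, 3, 1, 9],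
      [10, 5, 3, 1, 5], [6, 5, 9, 1, 3], [10, 5, 5, 1, 3], [12, 3, 3, 1, 5], [12, 3, 5, 1, 3]],
     [[7, 6, 7, 1, 3], [7, 6, 3, 5, 3], [7, 6, 3, 3, 5], [7, 5, 7, 2, 3], [7, 5, 6, 3, 3],
      [7, 5, 3, 6, 3], [7, 3, 6, 7, 1], [7, 3, 6, 3, 5], [7, 3, 5, 7, 2], [7, 3, 3, 7, 4],
      [6, 5, 3, 3, 7], [6, 3, 5, 3, 7], [4, 3, 3, 7, 7], [3, 6, 7, 1, 7], [3, 6, 5, 3, 7],
      [3, 6, 3, 5, 7], [3, 5, 7, 2, 7], [3, 5, 3, 6, 7], [2, 5, 3, 7, 7], [1, 6, 3, 7, 7],
      [11, 6, 3, 1, 3], [11, 5, 3, 2, 3], [11, 3, 6, 1, 3], [11, 3, 3, 2, 5], [7, 3, 10, 1, 3],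
      [7, 3, 9, 2, 3], [7, 3, 3, 8, 3], [6, 3, 11, 1, 3], [6, 3, 3, 1, 11], [5, 3, 3, 2, 11],
      [3, 6, 11, 1, 3], [3, 6, 3, 1, 11], [3, 5, 3, 2, 11], [3, 3, 10, 1, 7], [3, 3, 9, 2, 7],
      [3, 3, 3, 8, 7], [7, 6, 5, 1, 5], [7, 5, 5, 4, 3], [7, 5, 5, 2, 5], [7, 5, 3, 4, 5],
      [7, 3, 5, 4, 5], [6, 5, 7, 1, 5], [6, 5, 5, 1, 7], [5, 6, 7, 1, 5], [5, 6, 5, 1, 7],
      [5, 5, 6, 1, 7], [5, 5, 5, 2, 7], [5, 5, 3, 4, 7], [5, 3, 5, 4, 7], [3, 5, 5, 4, 7]])"

definition dual_4221_18 :: "mono list \<times> mono list" where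
  "dual_4221_18 =
    ([[5, 9, 2, 5, 3], [5, 5, 2, 9, 3], [5, 9, 2, 3, 5], [5, 5, 2, 3, 9], [5, 3, 2, 9, 5],
      [5, 3, 2, 5, 9], [3, 9, 4, 5, 3], [3, 5, 4, 9, 3], [3, 9, 4, 3, 5], [3, 5, 4, 3, 9],
      [3, 3, 4, 9, 5], [3, 3, 4, 5, 9], [5, 9, 1, 6, 3], [5, 5, 1, 10, 3], [5, 3, 1, 12, 3],
      [3, 9, 1, 6, 5], [3, 5, 1, 10, 5], [3, 3, 1, 12, 5], [5, 9, 1, 3, 6], [5, 5, 1, 3, 10],
      [5, 3, 1, 9, 6], [5, 3, 1, 5, 10], [3, 9, 1, 5, 6], [3, 5, 1, 9, 6], [3, 5, 1, 3, 12],
      [3, 3, 1, 5, 12]],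
     [[6, 5, 3, 3, 7], [6, 3, 5, 7, 3], [6, 3, 3, 7, 5], [6, 3, 3, 5, 7], [6, 1, 7, 7, 3],
      [5, 7, 3, 6, 3], [5, 7, 3, 3, 6], [5, 3, 6, 7, 3], [5, 3, 3, 7, 6], [5, 2, 7, 7, 3],
      [3, 7, 7, 3, 4], [3, 7, 6, 5, 3], [3, 7, 5, 6, 3], [3, 6, 3, 7, 5], [3, 4, 7, 7, 3],
      [5, 3, 2, 11, 3], [3, 14, 1, 3, 3], [3, 13, 2, 3, 3], [3, 12, 3, 3, 3], [3, 11, 4, 3, 3],
      [3, 11, 2, 5, 3], [3, 11, 2, 3, 5], [3, 11, 1, 6, 3], [3, 11, 1, 3, 6], [3, 10, 7, 3, 1],
      [3, 10, 3, 5, 3], [3, 9, 7, 3, 2], [3, 9, 3, 3, 6], [3, 7, 8, 3, 3], [3, 6, 11, 3, 1],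
      [3, 6, 3, 9, 3], [3, 5, 11, 3, 2], [3, 5, 3, 3, 10], [3, 5, 2, 3, 11], [3, 3, 14, 3, 1],
      [3, 3, 13, 3, 2], [3, 3, 8, 7, 3], [3, 3, 3, 9, 6], [3, 3, 3, 5, 10], [3, 3, 2, 13, 3],
      [3, 3, 2, 5, 11], [3, 3, 1, 14, 3], [3, 3, 1, 11, 6], [5, 7, 4, 5, 3], [5, 7, 4, 3, 5],
      [5, 7, 1, 6, 5], [5, 7, 1, 5, 6], [5, 5, 4, 3, 7], [5, 5, 2, 7, 5], [5, 5, 1, 7, 6],
      [5, 3, 4, 5, 7], [3, 5, 4, 7, 5]])"

definition dual_4221_19 :: "mono list \<times> mono list" where
  "dual_4221_19 =
    ([[1, 1, 14, 5, 3], [1, 1, 14, 3, 5], [1, 1, 13, 6, 3], [1, 1, 13, 3, 6], [1, 1, 12, 3, 7],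
      [1, 1, 11, 6, 5], [1, 1, 11, 5, 6], [1, 1, 10, 5, 7], [1, 1, 9, 6, 7], [1, 1, 7, 6, 9],
      [1, 1, 7, 5, 10], [1, 1, 7, 3, 12], [1, 1, 6, 5, 11], [1, 1, 6, 3, 13], [1, 1, 5, 6, 11],
      [1, 1, 5, 3, 14], [1, 1, 3, 6, 13], [1, 1, 3, 5, 14]],
     [[2, 1, 11, 3, 7], [2, 1, 7, 3, 11]])"

definition dual_4221_20 :: "mono list \<times> mono list" where
  "dual_4221_20 =
    ([[1, 2, 13, 3, 5], [1, 2, 13, 5, 3], [1, 4, 11, 3, 5], [1, 8, 7, 3, 5], [1, 4, 11, 5, 3],
      [1, 8, 7, 5, 3], [2, 1, 13, 3, 5], [2, 1, 13, 5, 3], [4, 1, 11, 3, 5], [8, 1, 7, 3, 5],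
      [4, 1, 11, 5, 3], [8, 1, 7, 5, 3]],
     [[7, 1, 7, 6, 3], [7, 1, 7, 3, 6], [5, 3, 7, 6, 3], [5, 3, 7, 3, 6], [3, 5, 7, 6, 3],
      [3, 5, 7, 3, 6], [1, 7, 7, 6, 3], [1, 7, 7, 3, 6], [6, 1, 11, 3, 3], [5, 2, 11, 3, 3],
      [4, 3, 11, 3, 3], [3, 4, 11, 3, 3], [3, 2, 11, 5, 3], [3, 2, 11, 3, 5], [2, 5, 11, 3, 3],
      [2, 3, 11, 5, 3], [2, 3, 11, 3, 5], [1, 6, 11, 3, 3], [6, 1, 7, 5, 5], [5, 4, 7, 5, 3],
      [5, 4, 7, 3, 5], [5, 2, 7, 5, 5], [4, 5, 7, 5, 3], [4, 5, 7, 3, 5], [4, 3, 7, 5, 5],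
      [3, 4, 7, 5, 5], [2, 5, 7, 5, 5], [1, 6, 7, 5, 5]])"

definition dual_4221_21 :: "mono list \<times> mono list" where
  "dual_4221_21 =
    ([[5, 11, 5, 2, 1], [5, 7, 9, 2, 1], [5, 11, 3, 4, 1], [5, 7, 3, 8, 1], [3, 13, 5, 2, 1],
      [3, 13, 3, 4, 1], [3, 7, 9, 4, 1], [3, 7, 5, 8, 1], [5, 11, 5, 1, 2], [5, 7, 9, 1, 2],
      [5, 11, 3, 1, 4], [5, 7, 3, 1, 8], [3, 13, 5, 1, 2], [3, 13, 3, 1, 4], [3, 7, 9, 1, 4],
      [3, 7, 5, 1, 8]],
     [[6, 7, 3, 7, 1], [6, 7, 3, 5, 3], [6, 7, 3, 3, 5], [5, 7, 7, 3, 2], [5, 7, 7, 2, 3],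
      [5, 7, 3, 2, 7], [3, 7, 6, 7, 1], [3, 7, 6, 5, 3], [3, 7, 6, 3, 5], [3, 7, 5, 2, 7],
      [5, 11, 3, 3, 2], [5, 11, 3, 2, 3], [3, 13, 3, 3, 2], [3, 13, 3, 2, 3], [3, 11, 3, 6, 1],
      [3, 11, 3, 5, 2], [3, 11, 3, 4, 3], [3, 11, 3, 3, 4], [3, 11, 3, 2, 5], [3, 11, 3, 1, 6],
      [3, 7, 11, 2, 1], [3, 7, 11, 1, 2], [3, 7, 9, 3, 2], [3, 7, 9, 2, 3], [5, 7, 7, 4, 1],
      [5, 7, 7, 1, 4], [5, 7, 5, 6, 1], [5, 7, 5, 5, 2], [5, 7, 5, 4, 3], [5, 7, 5, 3, 4],
      [5, 7, 5, 2, 5], [5, 7, 5, 1, 6], [5, 7, 3, 5, 4], [5, 7, 3, 4, 5], [3, 7, 5, 5, 4],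
      [3, 7, 5, 4, 5]])"

definition dual_4221_22 :: "mono list \<times> mono list" where
  "dual_4221_22 =
    ([[7, 9, 5, 2, 1], [7, 5, 9, 2, 1], [7, 9, 3, 4, 1], [7, 5, 3, 8, 1], [7, 3, 9, 4, 1],
      [7, 3, 5, 8, 1], [7, 9, 5, 1, 2], [7, 5, 9, 1, 2], [7, 9, 3, 1, 4], [7, 5, 3, 1, 8],
      [7, 3, 9, 1, 4], [7, 3, 5, 1, 8]],
     [[7, 7, 5, 3, 2], [7, 7, 5, 2, 3], [7, 6, 3, 1, 7], [7, 5, 7, 3, 2], [7, 5, 7, 2, 3],
      [7, 5, 3, 7, 2], [7, 5, 3, 6, 3], [7, 5, 3, 3, 6], [7, 3, 6, 7, 1], [7, 3, 6, 5, 3],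
      [7, 3, 6, 3, 5], [7, 3, 6, 1, 7], [7, 3, 3, 7, 4], [7, 3, 3, 4, 7], [14, 3, 3, 3, 1],
      [13, 3, 3, 3, 2], [11, 7, 3, 2, 1], [11, 7, 3, 1, 2], [11, 3, 7, 2, 1], [11, 3, 7, 1, 2],
      [11, 3, 3, 6, 1], [11, 3, 3, 5, 2], [7, 9, 3, 3, 2], [7, 9, 3, 2, 3], [7, 3, 9, 3, 2],
      [7, 3, 9, 2, 3], [7, 3, 3, 8, 3], [7, 3, 3, 3, 8], [7, 3, 3, 2, 9], [7, 3, 3, 1, 10],
      [7, 7, 5, 4, 1], [7, 7, 5, 1, 4], [7, 5, 7, 4, 1], [7, 5, 7, 1, 4], [7, 5, 5, 6, 1],
      [7, 5, 5, 5, 2], [7, 5, 5, 4, 3], [7, 5, 5, 3, 4], [7, 5, 5, 2, 5], [7, 5, 5, 1, 6],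
      [7, 5, 3, 5, 4], [7, 5, 3, 4, 5], [7, 3, 5, 5, 4], [7, 3, 5, 4, 5]])"

definition dual_4221_23 :: "mono list \<times> mono list" where
  "dual_4221_23 =
    ([[1, 1, 6, 9, 7], [1, 1, 10, 5, 7], [1, 1, 2, 13, 7], [1, 1, 12, 3, 7], [1, 1, 4, 11, 7],
      [1, 1, 8, 7, 7], [1, 6, 1, 7, 9], [1, 6, 1, 11, 5], [1, 6, 1, 13, 3], [1, 2, 1, 13, 7],
      [1, 4, 1, 11, 7], [1, 8, 1, 7, 7], [2, 5, 1, 7, 9], [2, 5, 1, 11, 5], [2, 5, 1, 13, 3],
      [2, 1, 5, 9, 7], [2, 1, 9, 5, 7], [4, 3, 1, 7, 9], [4, 3, 1, 11, 5], [4, 3, 1, 13, 3],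
      [4, 1, 3, 9, 7], [8, 1, 3, 5, 7], [4, 1, 9, 3, 7], [8, 1, 5, 3, 7]],
     [[7, 2, 5, 3, 7], [7, 2, 3, 5, 7], [6, 7, 1, 3, 7], [6, 3, 5, 3, 7], [6, 3, 3, 5, 7],
      [5, 7, 2, 3, 7], [3, 7, 4, 3, 7], [3, 6, 5, 3, 7], [3, 5, 6, 3, 7], [3, 5, 2, 7, 7],
      [3, 4, 3, 7, 7], [3, 3, 6, 5, 7], [3, 3, 4, 7, 7], [3, 1, 7, 6, 7], [3, 1, 6, 7, 7],
      [2, 1, 7, 7, 7], [1, 7, 2, 7, 7], [6, 1, 3, 3, 11], [5, 2, 3, 3, 11], [3, 8, 3, 3, 7],
      [3, 3, 1, 14, 3], [3, 3, 1, 11, 6], [3, 3, 1, 7, 10], [3, 2, 5, 3, 11], [3, 2, 3, 9, 7],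
      [3, 1, 10, 3, 7], [3, 1, 6, 3, 11], [2, 3, 1, 11, 7], [2, 1, 11, 3, 7], [2, 1, 3, 11, 7],
      [6, 1, 5, 5, 7], [5, 4, 5, 3, 7], [5, 4, 3, 5, 7], [5, 2, 5, 5, 7], [4, 5, 1, 7, 7],
      [4, 1, 7, 5, 7], [4, 1, 5, 7, 7], [3, 4, 5, 5, 7]])"

lemmas dual_4221_defs =
  dual_4221_1_def dual_4221_2_def dual_4221_3_def dual_4221_4_def dual_4221_5_def dual_4221_6_def
  dual_4221_7_def dual_4221_8_def dual_4221_9_def dual_4221_10_def dual_4221_11_def dual_4221_12_def
  dual_4221_13_def dual_4221_14_def dual_4221_15_def dual_4221_16_def dual_4221_17_def
  dual_4221_18_def dual_4221_19_def dual_4221_20_def dual_4221_21_def dual_4221_22_def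
  dual_4221_23_def

definition functionals_4221 :: "functional list" where
  "functionals_4221 =
    [(dual_4221_2, [0, 4, 2, 3, 1]), (dual_4221_2, [0, 4, 3, 2, 1]),
     (dual_4221_22, [3, 4, 1, 2, 0]), (dual_4221_1, [0, 4, 2, 3, 1]),
     (dual_4221_5, [0, 4, 3, 1, 2]), (dual_4221_2, [0, 4, 2, 1, 3]),
     (dual_4221_21, [3, 4, 2, 0, 1]), (dual_4221_21, [3, 4, 2, 1, 0]),
     (dual_4221_20, [0, 1, 2, 3, 4]), (dual_4221_22, [3, 4, 1, 0, 2]),
     (dual_4221_2, [0, 4, 3, 1, 2]), (dual_4221_8, [4, 3, 2, 1, 0]), (dual_4221_8, [4, 3, 2, 0, 1]),
     (dual_4221_11, [0, 1, 2, 3, 4]), (dual_4221_4, [4, 3, 2, 0, 1]),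
     (dual_4221_10, [3, 2, 1, 0, 4]), (dual_4221_1, [0, 4, 2, 1, 3]),
     (dual_4221_20, [0, 1, 3, 4, 2]), (dual_4221_20, [0, 1, 3, 2, 4]),
     (dual_4221_5, [0, 4, 1, 3, 2]), (dual_4221_21, [3, 4, 1, 2, 0]),
     (dual_4221_2, [0, 4, 1, 2, 3]), (dual_4221_22, [3, 4, 0, 1, 2]),
     (dual_4221_5, [0, 4, 1, 2, 3]), (dual_4221_2, [0, 4, 1, 3, 2]), (dual_4221_8, [4, 3, 1, 2, 0]),
     (dual_4221_11, [0, 1, 3, 2, 4]), (dual_4221_8, [4, 3, 0, 2, 1]),
     (dual_4221_4, [4, 3, 0, 2, 1]), (dual_4221_11, [0, 1, 3, 4, 2]),
     (dual_4221_8, [4, 3, 1, 0, 2]), (dual_4221_8, [4, 3, 0, 1, 2]), (dual_4221_4, [4, 3, 0, 1, 2]),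
     (dual_4221_10, [3, 2, 0, 1, 4]), (dual_4221_10, [3, 2, 0, 4, 1]),
     (dual_4221_1, [0, 4, 1, 2, 3]), (dual_4221_1, [4, 0, 2, 3, 1]),
     (dual_4221_14, [0, 1, 2, 3, 4]), (dual_4221_14, [0, 1, 3, 2, 4]),
     (dual_4221_9, [0, 3, 2, 4, 1]), (dual_4221_8, [3, 4, 2, 1, 0]), (dual_4221_8, [3, 4, 2, 0, 1]),
     (dual_4221_11, [1, 0, 2, 3, 4]), (dual_4221_15, [4, 3, 2, 0, 1]),
     (dual_4221_10, [2, 3, 1, 0, 4]), (dual_4221_1, [4, 0, 2, 1, 3]),
     (dual_4221_14, [0, 1, 3, 4, 2]), (dual_4221_4, [3, 4, 2, 0, 1]),
     (dual_4221_9, [0, 3, 2, 1, 4]), (dual_4221_8, [3, 4, 1, 2, 0]),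
     (dual_4221_11, [1, 0, 3, 2, 4]), (dual_4221_8, [3, 4, 0, 2, 1]),
     (dual_4221_15, [4, 3, 0, 2, 1]), (dual_4221_11, [1, 0, 3, 4, 2]),
     (dual_4221_8, [3, 4, 1, 0, 2]), (dual_4221_8, [3, 4, 0, 1, 2]),
     (dual_4221_15, [4, 3, 0, 1, 2]), (dual_4221_10, [2, 3, 0, 1, 4]),
     (dual_4221_10, [2, 3, 0, 4, 1]), (dual_4221_1, [4, 0, 1, 2, 3]),
     (dual_4221_4, [3, 4, 0, 2, 1]), (dual_4221_4, [3, 4, 0, 1, 2]), (dual_4221_9, [0, 3, 1, 2, 4]),
     (dual_4221_2, [0, 2, 4, 3, 1]), (dual_4221_1, [0, 2, 4, 3, 1]),
     (dual_4221_23, [0, 1, 2, 3, 4]), (dual_4221_7, [2, 3, 0, 1, 4]),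
     (dual_4221_5, [0, 3, 4, 1, 2]), (dual_4221_2, [0, 2, 4, 1, 3]), (dual_4221_8, [2, 4, 3, 1, 0]),
     (dual_4221_8, [2, 4, 3, 0, 1]), (dual_4221_4, [2, 4, 3, 0, 1]),
     (dual_4221_10, [1, 3, 2, 0, 4]), (dual_4221_1, [0, 2, 4, 1, 3]),
     (dual_4221_7, [2, 3, 0, 4, 1]), (dual_4221_1, [2, 4, 0, 3, 1]),
     (dual_4221_22, [3, 1, 4, 2, 0]), (dual_4221_9, [2, 0, 3, 4, 1]),
     (dual_4221_8, [2, 3, 4, 1, 0]), (dual_4221_8, [2, 3, 4, 0, 1]),
     (dual_4221_11, [0, 2, 1, 3, 4]), (dual_4221_22, [3, 1, 4, 0, 2]),
     (dual_4221_1, [2, 4, 0, 1, 3]), (dual_4221_4, [2, 3, 4, 0, 1]), (dual_4221_9, [2, 0, 3, 1, 4]),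
     (dual_4221_20, [0, 3, 1, 4, 2]), (dual_4221_20, [0, 3, 1, 2, 4]),
     (dual_4221_8, [4, 1, 3, 2, 0]), (dual_4221_11, [0, 3, 1, 2, 4]),
     (dual_4221_4, [4, 0, 3, 2, 1]), (dual_4221_11, [0, 3, 1, 4, 2]),
     (dual_4221_8, [4, 1, 3, 0, 2]), (dual_4221_4, [4, 0, 3, 1, 2]), (dual_4221_5, [0, 1, 4, 3, 2]),
     (dual_4221_21, [3, 1, 4, 2, 0]), (dual_4221_6, [2, 0, 4, 1, 3]),
     (dual_4221_2, [0, 1, 4, 2, 3]), (dual_4221_22, [3, 0, 4, 1, 2]),
     (dual_4221_5, [0, 1, 4, 2, 3]), (dual_4221_6, [2, 0, 4, 3, 1]), (dual_4221_2, [0, 1, 4, 3, 2]),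
     (dual_4221_7, [3, 0, 2, 1, 4]), (dual_4221_7, [3, 0, 2, 4, 1]), (dual_4221_3, [3, 0, 1, 2, 4]),
     (dual_4221_1, [0, 1, 4, 2, 3]), (dual_4221_1, [4, 2, 0, 3, 1]),
     (dual_4221_22, [1, 3, 4, 2, 0]), (dual_4221_14, [0, 3, 1, 2, 4]),
     (dual_4221_9, [0, 2, 3, 4, 1]), (dual_4221_8, [3, 2, 4, 1, 0]), (dual_4221_8, [3, 2, 4, 0, 1]),
     (dual_4221_11, [2, 0, 1, 3, 4]), (dual_4221_22, [1, 3, 4, 0, 2]),
     (dual_4221_1, [4, 2, 0, 1, 3]), (dual_4221_11, [1, 2, 0, 3, 4]),
     (dual_4221_14, [0, 3, 1, 4, 2]), (dual_4221_4, [3, 2, 4, 0, 1]),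
     (dual_4221_9, [0, 2, 3, 1, 4]), (dual_4221_20, [3, 0, 1, 4, 2]),
     (dual_4221_20, [3, 0, 1, 2, 4]), (dual_4221_8, [1, 4, 3, 2, 0]),
     (dual_4221_11, [3, 0, 1, 2, 4]), (dual_4221_4, [0, 4, 3, 2, 1]),
     (dual_4221_11, [3, 0, 1, 4, 2]), (dual_4221_8, [1, 4, 3, 0, 2]),
     (dual_4221_4, [0, 4, 3, 1, 2]), (dual_4221_12, [3, 4, 2, 1, 0]),
     (dual_4221_18, [3, 4, 2, 1, 0]), (dual_4221_16, [2, 3, 4, 1, 0]),
     (dual_4221_6, [4, 0, 2, 1, 3]), (dual_4221_18, [3, 4, 2, 0, 1]),
     (dual_4221_12, [3, 4, 2, 0, 1]), (dual_4221_16, [2, 3, 4, 0, 1]),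
     (dual_4221_6, [4, 0, 2, 3, 1]), (dual_4221_17, [0, 1, 2, 3, 4]),
     (dual_4221_17, [0, 1, 2, 4, 3]), (dual_4221_13, [2, 4, 3, 0, 1]),
     (dual_4221_5, [1, 0, 4, 3, 2]), (dual_4221_21, [1, 3, 4, 2, 0]),
     (dual_4221_6, [0, 2, 4, 1, 3]), (dual_4221_6, [0, 4, 2, 1, 3]), (dual_4221_2, [1, 0, 4, 2, 3]),
     (dual_4221_22, [0, 3, 4, 1, 2]), (dual_4221_5, [1, 0, 4, 2, 3]),
     (dual_4221_6, [0, 2, 4, 3, 1]), (dual_4221_6, [0, 4, 2, 3, 1]), (dual_4221_2, [1, 0, 4, 3, 2]),
     (dual_4221_7, [0, 3, 2, 1, 4]), (dual_4221_7, [0, 3, 2, 4, 1]), (dual_4221_3, [0, 3, 1, 2, 4]),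
     (dual_4221_19, [2, 4, 3, 0, 1]), (dual_4221_1, [1, 0, 4, 2, 3]),
     (dual_4221_8, [1, 3, 4, 2, 0]), (dual_4221_11, [1, 3, 0, 2, 4]),
     (dual_4221_15, [0, 4, 3, 2, 1]), (dual_4221_11, [1, 3, 0, 4, 2]),
     (dual_4221_8, [1, 3, 4, 0, 2]), (dual_4221_15, [0, 4, 3, 1, 2]),
     (dual_4221_4, [0, 3, 4, 2, 1]), (dual_4221_4, [0, 3, 4, 1, 2]), (dual_4221_7, [2, 0, 3, 1, 4]),
     (dual_4221_7, [2, 0, 3, 4, 1]), (dual_4221_13, [2, 3, 4, 0, 1]),
     (dual_4221_1, [4, 1, 0, 2, 3]), (dual_4221_4, [3, 0, 4, 2, 1]), (dual_4221_4, [3, 0, 4, 1, 2]),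
     (dual_4221_7, [0, 2, 3, 1, 4]), (dual_4221_7, [0, 2, 3, 4, 1]),
     (dual_4221_13, [3, 2, 4, 0, 1]), (dual_4221_3, [0, 1, 3, 2, 4]),
     (dual_4221_1, [1, 4, 0, 2, 3]), (dual_4221_13, [3, 4, 2, 0, 1]),
     (dual_4221_1, [0, 2, 3, 4, 1]), (dual_4221_7, [1, 2, 3, 0, 4]), (dual_4221_1, [2, 3, 4, 0, 1]),
     (dual_4221_9, [2, 4, 0, 3, 1]), (dual_4221_8, [2, 4, 1, 3, 0]), (dual_4221_4, [2, 4, 0, 3, 1]),
     (dual_4221_5, [0, 3, 1, 4, 2]), (dual_4221_6, [1, 2, 0, 4, 3]), (dual_4221_2, [0, 2, 1, 4, 3]),
     (dual_4221_7, [1, 3, 0, 2, 4]), (dual_4221_3, [2, 3, 0, 1, 4]), (dual_4221_1, [0, 2, 1, 4, 3]),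
     (dual_4221_1, [2, 4, 3, 0, 1]), (dual_4221_22, [3, 1, 2, 4, 0]),
     (dual_4221_9, [2, 0, 4, 3, 1]), (dual_4221_8, [2, 1, 4, 3, 0]), (dual_4221_4, [2, 0, 4, 3, 1]),
     (dual_4221_20, [0, 3, 4, 1, 2]), (dual_4221_16, [1, 2, 3, 4, 0]),
     (dual_4221_6, [1, 4, 0, 2, 3]), (dual_4221_11, [0, 3, 4, 1, 2]),
     (dual_4221_4, [4, 0, 1, 3, 2]), (dual_4221_5, [0, 1, 3, 4, 2]), (dual_4221_6, [1, 0, 2, 4, 3]),
     (dual_4221_6, [1, 0, 4, 2, 3]), (dual_4221_2, [0, 1, 2, 4, 3]), (dual_4221_7, [1, 0, 3, 2, 4]),
     (dual_4221_3, [2, 0, 3, 1, 4]), (dual_4221_10, [3, 0, 4, 2, 1]),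
     (dual_4221_1, [0, 1, 2, 4, 3]), (dual_4221_8, [2, 1, 3, 4, 0]),
     (dual_4221_11, [0, 2, 3, 1, 4]), (dual_4221_4, [2, 0, 3, 4, 1]),
     (dual_4221_22, [3, 1, 0, 4, 2]), (dual_4221_6, [2, 3, 0, 4, 1]),
     (dual_4221_1, [2, 4, 1, 0, 3]), (dual_4221_4, [2, 3, 0, 4, 1]),
     (dual_4221_22, [3, 0, 1, 4, 2]), (dual_4221_6, [2, 0, 3, 4, 1]),
     (dual_4221_3, [2, 0, 1, 3, 4]), (dual_4221_1, [2, 1, 4, 0, 3]), (dual_4221_7, [3, 0, 4, 2, 1]),
     (dual_4221_1, [4, 2, 3, 0, 1]), (dual_4221_22, [1, 3, 2, 4, 0]),
     (dual_4221_22, [1, 2, 3, 4, 0]), (dual_4221_9, [0, 2, 4, 3, 1]),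
     (dual_4221_8, [1, 2, 4, 3, 0]), (dual_4221_4, [0, 2, 4, 3, 1]),
     (dual_4221_20, [3, 0, 4, 1, 2]), (dual_4221_16, [2, 1, 3, 4, 0]),
     (dual_4221_6, [4, 1, 0, 2, 3]), (dual_4221_11, [3, 0, 4, 1, 2]),
     (dual_4221_4, [0, 4, 1, 3, 2]), (dual_4221_20, [3, 4, 0, 1, 2]),
     (dual_4221_16, [2, 3, 1, 4, 0]), (dual_4221_18, [1, 3, 4, 2, 0]),
     (dual_4221_6, [4, 0, 1, 2, 3]), (dual_4221_11, [3, 4, 0, 1, 2]),
     (dual_4221_4, [0, 1, 4, 3, 2]), (dual_4221_17, [0, 2, 4, 1, 3]),
     (dual_4221_5, [1, 0, 3, 4, 2]), (dual_4221_6, [0, 1, 2, 4, 3]), (dual_4221_6, [0, 1, 4, 2, 3]),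
     (dual_4221_6, [0, 4, 1, 2, 3]), (dual_4221_2, [1, 0, 2, 4, 3]), (dual_4221_7, [0, 1, 3, 2, 4]),
     (dual_4221_3, [0, 2, 3, 1, 4]), (dual_4221_10, [0, 3, 4, 2, 1]),
     (dual_4221_10, [0, 4, 3, 2, 1]), (dual_4221_1, [1, 0, 2, 4, 3]),
     (dual_4221_8, [1, 2, 3, 4, 0]), (dual_4221_11, [2, 0, 3, 1, 4]),
     (dual_4221_4, [0, 2, 3, 4, 1]), (dual_4221_22, [1, 3, 0, 4, 2]),
     (dual_4221_6, [3, 2, 0, 4, 1]), (dual_4221_1, [4, 2, 1, 0, 3]),
     (dual_4221_11, [1, 2, 3, 0, 4]), (dual_4221_11, [3, 4, 1, 0, 2]),
     (dual_4221_15, [0, 1, 4, 3, 2]), (dual_4221_12, [3, 4, 0, 2, 1]),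
     (dual_4221_6, [4, 0, 3, 2, 1]), (dual_4221_4, [0, 1, 3, 4, 2]), (dual_4221_4, [3, 2, 0, 4, 1]),
     (dual_4221_22, [0, 3, 1, 4, 2]), (dual_4221_6, [0, 2, 3, 4, 1]),
     (dual_4221_3, [0, 2, 1, 3, 4]), (dual_4221_6, [0, 4, 3, 2, 1]), (dual_4221_1, [1, 2, 4, 0, 3]),
     (dual_4221_7, [0, 3, 4, 2, 1]), (dual_4221_8, [1, 3, 2, 4, 0]),
     (dual_4221_11, [2, 3, 0, 1, 4]), (dual_4221_11, [1, 3, 2, 0, 4]),
     (dual_4221_11, [1, 3, 4, 0, 2]), (dual_4221_15, [0, 4, 1, 3, 2]),
     (dual_4221_6, [3, 4, 0, 2, 1]), (dual_4221_4, [0, 3, 2, 4, 1]),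
     (dual_4221_22, [1, 0, 3, 4, 2]), (dual_4221_6, [3, 0, 2, 4, 1]),
     (dual_4221_6, [3, 0, 4, 2, 1]), (dual_4221_1, [4, 1, 2, 0, 3]), (dual_4221_4, [0, 3, 1, 4, 2]),
     (dual_4221_4, [3, 0, 2, 4, 1]), (dual_4221_22, [0, 1, 3, 4, 2]),
     (dual_4221_6, [0, 3, 2, 4, 1]), (dual_4221_6, [0, 3, 4, 2, 1]), (dual_4221_3, [0, 1, 2, 3, 4]),
     (dual_4221_1, [1, 4, 2, 0, 3]), (dual_4221_4, [3, 0, 1, 4, 2]), (dual_4221_7, [0, 4, 3, 2, 1]),
     (dual_4221_3, [2, 3, 4, 0, 1]), (dual_4221_1, [0, 2, 3, 1, 4]), (dual_4221_4, [2, 4, 0, 1, 3]),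
     (dual_4221_3, [2, 3, 0, 4, 1]), (dual_4221_10, [1, 3, 0, 4, 2]),
     (dual_4221_1, [0, 2, 1, 3, 4]), (dual_4221_6, [1, 2, 3, 0, 4]), (dual_4221_1, [2, 3, 4, 1, 0]),
     (dual_4221_6, [1, 2, 0, 3, 4]), (dual_4221_3, [2, 4, 0, 1, 3]), (dual_4221_1, [2, 3, 1, 4, 0]),
     (dual_4221_7, [1, 3, 0, 4, 2]), (dual_4221_4, [2, 0, 4, 1, 3]), (dual_4221_4, [2, 0, 1, 4, 3]),
     (dual_4221_17, [3, 0, 2, 4, 1]), (dual_4221_3, [2, 0, 3, 4, 1]),
     (dual_4221_10, [1, 0, 3, 4, 2]), (dual_4221_10, [1, 0, 4, 3, 2]),
     (dual_4221_1, [0, 1, 2, 3, 4]), (dual_4221_6, [1, 3, 2, 0, 4]), (dual_4221_1, [2, 4, 3, 1, 0]),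
     (dual_4221_11, [0, 3, 4, 2, 1]), (dual_4221_12, [1, 3, 4, 0, 2]),
     (dual_4221_6, [1, 4, 0, 3, 2]), (dual_4221_4, [2, 0, 1, 3, 4]), (dual_4221_6, [1, 0, 2, 3, 4]),
     (dual_4221_3, [2, 0, 4, 1, 3]), (dual_4221_6, [1, 0, 4, 3, 2]), (dual_4221_1, [2, 1, 3, 4, 0]),
     (dual_4221_7, [1, 0, 3, 4, 2]), (dual_4221_11, [0, 2, 3, 4, 1]),
     (dual_4221_6, [1, 3, 4, 0, 2]), (dual_4221_6, [1, 3, 0, 2, 4]), (dual_4221_6, [1, 3, 0, 4, 2]),
     (dual_4221_1, [2, 4, 1, 3, 0]), (dual_4221_4, [2, 0, 3, 1, 4]), (dual_4221_6, [1, 0, 3, 2, 4]),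
     (dual_4221_6, [1, 0, 3, 4, 2]), (dual_4221_3, [2, 0, 1, 4, 3]), (dual_4221_1, [2, 1, 4, 3, 0]),
     (dual_4221_4, [2, 3, 0, 1, 4]), (dual_4221_7, [1, 0, 4, 3, 2]), (dual_4221_4, [0, 2, 4, 1, 3]),
     (dual_4221_4, [0, 2, 1, 4, 3]), (dual_4221_17, [0, 3, 2, 4, 1]),
     (dual_4221_4, [0, 1, 2, 4, 3]), (dual_4221_17, [0, 2, 3, 4, 1]),
     (dual_4221_17, [0, 2, 4, 3, 1]), (dual_4221_3, [0, 2, 3, 4, 1]),
     (dual_4221_10, [0, 1, 3, 4, 2]), (dual_4221_10, [0, 1, 4, 3, 2]),
     (dual_4221_10, [0, 4, 1, 3, 2]), (dual_4221_1, [1, 0, 2, 3, 4]),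
     (dual_4221_6, [3, 1, 2, 0, 4]), (dual_4221_1, [4, 2, 3, 1, 0]),
     (dual_4221_11, [3, 0, 4, 2, 1]), (dual_4221_12, [3, 1, 4, 0, 2]),
     (dual_4221_6, [4, 1, 0, 3, 2]), (dual_4221_4, [0, 2, 1, 3, 4]),
     (dual_4221_11, [3, 4, 0, 2, 1]), (dual_4221_12, [3, 4, 1, 0, 2]),
     (dual_4221_18, [1, 3, 4, 0, 2]), (dual_4221_6, [4, 0, 1, 3, 2]),
     (dual_4221_4, [0, 1, 2, 3, 4]), (dual_4221_6, [0, 1, 2, 3, 4]), (dual_4221_3, [0, 2, 4, 1, 3]),
     (dual_4221_6, [0, 1, 4, 3, 2]), (dual_4221_6, [0, 4, 1, 3, 2]), (dual_4221_1, [1, 2, 3, 4, 0]),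
     (dual_4221_7, [0, 1, 3, 4, 2]), (dual_4221_11, [2, 0, 3, 4, 1]),
     (dual_4221_6, [3, 1, 4, 0, 2]), (dual_4221_6, [3, 1, 0, 2, 4]), (dual_4221_6, [3, 1, 0, 4, 2]),
     (dual_4221_1, [4, 2, 1, 3, 0]), (dual_4221_4, [0, 2, 3, 1, 4]),
     (dual_4221_11, [3, 4, 2, 0, 1]), (dual_4221_18, [1, 3, 0, 4, 2]),
     (dual_4221_12, [3, 4, 0, 1, 2]), (dual_4221_6, [4, 0, 3, 1, 2]),
     (dual_4221_11, [1, 2, 3, 4, 0]), (dual_4221_4, [0, 1, 3, 2, 4]),
     (dual_4221_6, [0, 1, 3, 2, 4]), (dual_4221_6, [0, 1, 3, 4, 2]), (dual_4221_3, [0, 2, 1, 4, 3]),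
     (dual_4221_6, [0, 4, 3, 1, 2]), (dual_4221_1, [1, 2, 4, 3, 0]), (dual_4221_4, [3, 2, 0, 1, 4]),
     (dual_4221_7, [0, 1, 4, 3, 2]), (dual_4221_11, [2, 3, 0, 4, 1]),
     (dual_4221_6, [3, 4, 1, 0, 2]), (dual_4221_11, [2, 3, 4, 0, 1]),
     (dual_4221_18, [0, 1, 3, 4, 2]), (dual_4221_6, [3, 4, 0, 1, 2]),
     (dual_4221_11, [1, 3, 2, 4, 0]), (dual_4221_6, [3, 0, 1, 2, 4]),
     (dual_4221_6, [3, 0, 1, 4, 2]), (dual_4221_6, [3, 0, 4, 1, 2]), (dual_4221_1, [4, 1, 2, 3, 0]),
     (dual_4221_4, [0, 3, 2, 1, 4]), (dual_4221_4, [0, 3, 1, 2, 4]), (dual_4221_6, [0, 3, 1, 2, 4]),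
     (dual_4221_6, [0, 3, 1, 4, 2]), (dual_4221_6, [0, 3, 4, 1, 2]), (dual_4221_3, [0, 1, 2, 4, 3]),
     (dual_4221_1, [1, 4, 2, 3, 0]), (dual_4221_4, [3, 0, 2, 1, 4]), (dual_4221_4, [3, 0, 1, 2, 4]),
     (dual_4221_7, [0, 4, 1, 3, 2])]"

text \<open>No weight of degree 24 in five variables exceeds (4,4,3), so these sets have no elements
  of larger weight and the list of larger weights is empty.\<close>

lemma dual_sets_443:
  "dual_set [4, 4, 3] [] dual_443_1"
  "dual_set [4, 4, 3] [] dual_443_2"
  "dual_set [4, 4, 3] [] dual_443_3"
  "dual_set [4, 4, 3] [] dual_443_4"
  by (simp_all only: dual_443_defs dual_set_def evaluate
      cong: eval_congs if_weak_cong let_weak_cong)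

text \<open>Annihilation is checked once for each set and then looked up for all its
  permutations.\<close>

lemma functionals_443_dual: "list_all (\<lambda>(S, p). dual_set [4, 4, 3] [] S) functionals_443"
  by (simp only: functionals_443_def eval_list prod.case dual_sets_443 simp_thms)

lemma functionals_443_ascending: "ascending [4, 4, 3] [0, 0, 0, 0, 0] functionals_443"
  by (simp only: functionals_443_def dual_443_defs evaluate
      cong: eval_congs if_weak_cong let_weak_cong)

lemma dual_sets_4411:
  "dual_set [4, 4, 1, 1] [[4, 4, 3]] dual_4411_1"
  "dual_set [4, 4, 1, 1] [[4, 4, 3]] dual_4411_2"
  "dual_set [4, 4, 1, 1] [[4, 4, 3]] dual_4411_3"
  "dual_set [4, 4, 1, 1] [[4, 4, 3]] dual_4411_4"
  "dual_set [4, 4, 1, 1] [[4, 4, 3]] dual_4411_5"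
  "dual_set [4, 4, 1, 1] [[4, 4, 3]] dual_4411_6"
  "dual_set [4, 4, 1, 1] [[4, 4, 3]] dual_4411_7"
  "dual_set [4, 4, 1, 1] [[4, 4, 3]] dual_4411_8"
  by (simp_all only: dual_4411_defs dual_set_def evaluate
      cong: eval_congs if_weak_cong let_weak_cong)

lemma functionals_4411_dual: "list_all (\<lambda>(S, p). dual_set [4, 4, 1, 1] [[4, 4, 3]] S) functionals_4411"
  by (simp only: functionals_4411_def eval_list prod.case dual_sets_4411 simp_thms)

lemma functionals_4411_ascending: "ascending [4, 4, 1, 1] [0, 0, 0, 0, 0] functionals_4411"
  by (simp only: functionals_4411_def dual_4411_defs evaluate
      cong: eval_congs if_weak_cong let_weak_cong)

lemma dual_sets_424:
  "dual_set [4, 2, 4] [[4, 4, 3], [4, 4, 1, 1]] dual_424_1"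
  by (simp_all only: dual_424_defs dual_set_def evaluate
      cong: eval_congs if_weak_cong let_weak_cong)

lemma functionals_424_dual: "list_all (\<lambda>(S, p). dual_set [4, 2, 4] [[4, 4, 3], [4, 4, 1, 1]] S) functionals_424"
  by (simp only: functionals_424_def eval_list prod.case dual_sets_424 simp_thms)

lemma functionals_424_ascending: "ascending [4, 2, 4] [0, 0, 0, 0, 0] functionals_424"
  by (simp only: functionals_424_def dual_424_defs evaluate
      cong: eval_congs if_weak_cong let_weak_cong)

lemma dual_sets_4221:
  "dual_set [4, 2, 2, 1] [[4, 4, 3], [4, 4, 1, 1], [4, 2, 4]] dual_4221_1"
  "dual_set [4, 2, 2, 1] [[4, 4, 3], [4, 4, 1, 1], [4, 2, 4]] dual_4221_2"
  "dual_set [4, 2, 2, 1] [[4, 4, 3], [4, 4, 1, 1], [4, 2, 4]] dual_4221_3"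
  "dual_set [4, 2, 2, 1] [[4, 4, 3], [4, 4, 1, 1], [4, 2, 4]] dual_4221_4"
  "dual_set [4, 2, 2, 1] [[4, 4, 3], [4, 4, 1, 1], [4, 2, 4]] dual_4221_5"
  "dual_set [4, 2, 2, 1] [[4, 4, 3], [4, 4, 1, 1], [4, 2, 4]] dual_4221_6"
  "dual_set [4, 2, 2, 1] [[4, 4, 3], [4, 4, 1, 1], [4, 2, 4]] dual_4221_7"
  "dual_set [4, 2, 2, 1] [[4, 4, 3], [4, 4, 1, 1], [4, 2, 4]] dual_4221_8"
  "dual_set [4, 2, 2, 1] [[4, 4, 3], [4, 4, 1, 1], [4, 2, 4]] dual_4221_9"
  "dual_set [4, 2, 2, 1] [[4, 4, 3], [4, 4, 1, 1], [4, 2, 4]] dual_4221_10"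
  "dual_set [4, 2, 2, 1] [[4, 4, 3], [4, 4, 1, 1], [4, 2, 4]] dual_4221_11"
  "dual_set [4, 2, 2, 1] [[4, 4, 3], [4, 4, 1, 1], [4, 2, 4]] dual_4221_12"
  "dual_set [4, 2, 2, 1] [[4, 4, 3], [4, 4, 1, 1], [4, 2, 4]] dual_4221_13"
  "dual_set [4, 2, 2, 1] [[4, 4, 3], [4, 4, 1, 1], [4, 2, 4]] dual_4221_14"
  "dual_set [4, 2, 2, 1] [[4, 4, 3], [4, 4, 1, 1], [4, 2, 4]] dual_4221_15"
  "dual_set [4, 2, 2, 1] [[4, 4, 3], [4, 4, 1, 1], [4, 2, 4]] dual_4221_16"
  "dual_set [4, 2, 2, 1] [[4, 4, 3], [4, 4, 1, 1], [4, 2, 4]] dual_4221_17"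
  "dual_set [4, 2, 2, 1] [[4, 4, 3], [4, 4, 1, 1], [4, 2, 4]] dual_4221_18"
  "dual_set [4, 2, 2, 1] [[4, 4, 3], [4, 4, 1, 1], [4, 2, 4]] dual_4221_19"
  "dual_set [4, 2, 2, 1] [[4, 4, 3], [4, 4, 1, 1], [4, 2, 4]] dual_4221_20"
  "dual_set [4, 2, 2, 1] [[4, 4, 3], [4, 4, 1, 1], [4, 2, 4]] dual_4221_21"
  "dual_set [4, 2, 2, 1] [[4, 4, 3], [4, 4, 1, 1], [4, 2, 4]] dual_4221_22"
  "dual_set [4, 2, 2, 1] [[4, 4, 3], [4, 4, 1, 1], [4, 2, 4]] dual_4221_23"
  by (simp_all only: dual_4221_defs dual_set_def evaluate
      cong: eval_congs if_weak_cong let_weak_cong)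

lemma functionals_4221_dual: "list_all (\<lambda>(S, p). dual_set [4, 2, 2, 1] [[4, 4, 3], [4, 4, 1, 1], [4, 2, 4]] S) functionals_4221"
  by (simp only: functionals_4221_def eval_list prod.case dual_sets_4221 simp_thms)

lemma functionals_4221_ascending: "ascending [4, 2, 2, 1] [0, 0, 0, 0, 0] functionals_4221"
  by (simp only: functionals_4221_def dual_4221_defs evaluate
      cong: eval_congs if_weak_cong let_weak_cong)

lemma eval_length_ge:
  "0 \<le> length xs" "1 \<le> length (x # xs) \<longleftrightarrow> 0 \<le> length xs"
  "numeral (num.Bit0 k) \<le> length (x # xs) \<longleftrightarrow> numeral (Num.BitM k) \<le> length xs"
  "numeral (num.Bit1 k) \<le> length (x # xs) \<longleftrightarrow> numeral (num.Bit0 k) \<le> length xs"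
  by (simp_all add: numeral_eq_Suc)

lemma functionals_count:
  "75 \<le> length functionals_443" "145 \<le> length functionals_4411"
  "1 \<le> length functionals_424" "390 \<le> length functionals_4221"
  by (simp_all only: functionals_443_def functionals_4411_def functionals_424_def functionals_4221_def
      eval_length_ge Num.BitM.simps numeral_One simp_thms cong: eval_congs(1))

theorem theorem3p4:
  shows "dim_QPplus 5 [4,4,3] = 75 \<and> dim_QPplus 5 [4,4,1,1] = 145 \<and>
         dim_QPplus 5 [4,2,2,1] = 390 \<and> dim_QPplus 5 [4,2,4] = 1"
proof (intro conjI)
  show "dim_QPplus 5 [4,4,3] = 75"
    by (rule dim_QPplus_certified[OF irreducibles_count(1) rules_certified functionals_443_dual
          functionals_443_ascending functionals_count(1)]) (simp add: deg_w_Cons deg_w_Nil)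
  show "dim_QPplus 5 [4,4,1,1] = 145"
    by (rule dim_QPplus_certified[OF irreducibles_count(2) rules_certified functionals_4411_dual
          functionals_4411_ascending functionals_count(2)]) (simp add: deg_w_Cons deg_w_Nil)
  show "dim_QPplus 5 [4,2,2,1] = 390"
    by (rule dim_QPplus_certified[OF irreducibles_count(4) rules_certified functionals_4221_dual
          functionals_4221_ascending functionals_count(4)]) (simp add: deg_w_Cons deg_w_Nil)
  show "dim_QPplus 5 [4,2,4] = 1"
    by (rule dim_QPplus_certified[OF irreducibles_count(3) rules_certified functionals_424_dual
          functionals_424_ascending functionals_count(3)]) (simp add: deg_w_Cons deg_w_Nil)
qed

end
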